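(* Suppose that the cluster variety $\mathcal A$ satisfies the Louise property and is of full rank. Then there is an element $g\in\Lambda$ such that for all sufficiently large primes $p$ and all prime powers $q=p^a$ ($a\geq1$), we have $\#\mathcal A(\mathbb F_q)=g(q)$. If, in addition, $\mathcal A$ is of really full rank, then the function $q\mapsto\#\mathcal A(\mathbb F_q)$, on all prime powers $q$, is a polynomial in $q$.
   Context: **Cluster varieties.** An extended exchange matrix is an $(n+m)\times n$ integer matrix $\tilde B$ whose top $n\times n$ submatrix is skew-symmetric. A seed $(\mathbf x,\tilde B)$ consists of $\tilde B$ together with $n+m$ algebraically independent elements $x_1,\dots,x_{n+m}$ generating a rational function field $\mathcal F$. Write $[a]_+=\max(a,0)$, $[a]_-=\min(a,0)$. For $1\le k\le n$, mutation $\mu_k$ replaces $\tilde B$ by $\tilde B'$ with $\tilde B'_{ij}=-\tilde B_{ij}$ if $i=k$ or $j=k$, and $\tilde B'_{ij}=\tilde B_{ij}+[\tilde B_{ik}]_+[\tilde B_{kj}]_+-[\tilde B_{ik}]_-[\tilde B_{kj}]_-$ otherwise; and replaces $x_k$ by $x_k'=\big(\prod_i x_i^{[\tilde B_{ik}]_+}+\prod_i x_i^{[-\tilde B_{ik}]_+}\big)/x_k$, leaving the other $x_i$ unchanged. The entries of the tuples in seeds obtained by iterated mutation are cluster variables; $x_{n+1},\dots,x_{n+m}$ are frozen. The cluster algebra $A=A(\tilde B)$ is the subalgebra of $\mathcal F$ generated by all cluster variables and the inverses of the frozen variables; $\mathcal A=\operatorname{Spec}A$. It is defined over $\mathbb Z$: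 $A_{\mathbb Z}$ is the $\mathbb Z$-subalgebra with the same generators, and $\mathcal A(\mathbb F_q)$ denotes the set of $\mathbb F_q$-points of $\operatorname{Spec}A_{\mathbb Z}$, i.e. ring homomorphisms $A_{\mathbb Z}\to\mathbb F_q$. Full rank means $\operatorname{rank}\tilde B=n$; really full rank means the rows of $\tilde B$ span $\mathbb Z^n$ over $\mathbb Z$ (both conditions are mutation invariant). **Louise property.** The quiver $\vec\Gamma(\tilde B)$ has vertices $1,\dots,n$ and an edge $i\to j$ whenever $\tilde B_{ij}>0$. For $S\subseteq[n]$, $\tilde B_S$ is the matrix formed by the columns of $\tilde B$ indexed by $S$ (variables $x_i$, $i\notin S$, become frozen). An edge $i\to j$ is separating if there is no bi-infinite directed path in the quiver through this edge. The Louise property is defined recursively: $A$ satisfies it if either (a) for some seed of $A$ the quiver has no edges, or (b) for some seed $(\mathbf x,\tilde B)$ of $A$, with quiver $\vec\Gamma$, there is a separating edge $i\to j$ such that $A(\tilde B_{\vec\Gamma\setminus\{i\}})$, $A(\tilde B_{\vec\Gamma\setminus\{j\}})$ and $A(\tilde B_{\vec\Gamma\setminus\{i,j\}})$ all satisfy the Louise property. **The ring $\Lambda$.** A Dirichlet character of modulus $N$ is a function $\chi:\mathbb Z\to\mathbb C$ with $\chi(a+N)=\chi(a)$, $\chi(ab)=\chi(a)\chi(b)$, and $\chi(a)\neq0$ if and only if $\gcd(a,N)=1$. In the ring (under pointwise operations) of all functions from the set of prime powers to $\mathbb C$, $\Lambda$ is the subring generated over $\mathbb Z$ by the function $q\mapsto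 q$ and the functions $q\mapsto\chi(q)$ for all Dirichlet characters $\chi$. *)

theory Defs
  imports
    "HOL-Library.Poly_Mapping"
    "HOL-Library.FuncSet"
    "HOL-Number_Theory.Prime_Powers"
    "HOL-Computational_Algebra.Polynomial"
    "HOL-Algebra.Generated_Rings"
    "HOL-Algebra.Generated_Fields"
    "HOL-Algebra.Algebraic_Closure_Type"
    "Jordan_Normal_Form.DL_Rank"
begin

text \<open>
  Indices start at 0: the cluster consists of the values at \<open>{..<N}\<close> (with \<open>N = n + m\<close>), and
  \<open>S \<subseteq> {..<N}\<close> is the set of mutable indices, so that an \<open>(n + m) \<times> n\<close> matrix corresponds to
  \<open>S = {..<n}\<close>.  An extended exchange matrix has rows indexed by \<open>{..<N}\<close> and columns indexed by
  \<open>S\<close>; values of the function outside of \<open>{..<N} \<times> S\<close> are junk, and no entry in \<open>{..<N} \<times> S\<close> ever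
  depends on them.  With this convention, passing to the submatrix formed by the columns in
  \<open>T \<subseteq> S\<close> (which turns the indices in \<open>S - T\<close> into frozen ones) amounts to replacing \<open>S\<close> by \<open>T\<close>.
\<close>

type_synonym exchange_matrix = "nat \<Rightarrow> nat \<Rightarrow> int"
type_synonym 'f seed = "(nat \<Rightarrow> 'f) \<times> exchange_matrix"

definition ext_exchange_matrix :: "nat \<Rightarrow> nat set \<Rightarrow> exchange_matrix \<Rightarrow> bool" where
  "ext_exchange_matrix N S B \<longleftrightarrow> S \<subseteq> {..<N} \<and> (\<forall>i\<in>S. \<forall>j\<in>S. B i j = - B j i)"

text \<open>
  Multivariate polynomials are finitely supported maps from monomials (finitely supported
  exponent functions) to coefficients.
\<close>

definition mpoly_eval :: "(nat \<Rightarrow> 'f::comm_ring_1) \<Rightarrow> ((nat \<Rightarrow>\<^sub>0 nat) \<Rightarrow>\<^sub>0 'f) \<Rightarrow> 'f" where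
  "mpoly_eval x p =
     (\<Sum>t\<in>Poly_Mapping.keys p. Poly_Mapping.lookup p t *
        (\<Prod>i\<in>Poly_Mapping.keys t. x i ^ Poly_Mapping.lookup t i))"

definition algebraically_independent :: "'f::field set \<Rightarrow> nat \<Rightarrow> (nat \<Rightarrow> 'f) \<Rightarrow> bool" where
  "algebraically_independent k N x \<longleftrightarrow>
     (\<forall>p. range (Poly_Mapping.lookup p) \<subseteq> k
        \<and> (\<forall>t\<in>Poly_Mapping.keys p. Poly_Mapping.keys t \<subseteq> {..<N})
        \<and> mpoly_eval x p = 0 \<longrightarrow> p = 0)"

text \<open>The whole type \<open>'f\<close> is the rational function field generated by the cluster over \<open>k\<close>.\<close>

definition is_seed :: "'f::field_char_0 set \<Rightarrow> nat \<Rightarrow> nat set \<Rightarrow> 'f seed \<Rightarrow> bool" where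
  "is_seed k N S s \<longleftrightarrow>
     (case s of (x, B) \<Rightarrow>
        ext_exchange_matrix N S B
        \<and> subfield k (ring_of_type_algebra :: 'f ring)
        \<and> algebraically_independent k N x
        \<and> generate_field (ring_of_type_algebra :: 'f ring) (k \<union> x ` {..<N}) = UNIV)"

definition mutate_matrix :: "nat \<Rightarrow> exchange_matrix \<Rightarrow> exchange_matrix" where
  "mutate_matrix k B = (\<lambda>i j.
     if i = k \<or> j = k then - B i j
     else B i j + max (B i k) 0 * max (B k j) 0 - min (B i k) 0 * min (B k j) 0)"

definition mutate_cluster ::
    "nat \<Rightarrow> nat \<Rightarrow> exchange_matrix \<Rightarrow> (nat \<Rightarrow> 'f::field) \<Rightarrow> (nat \<Rightarrow> 'f)" where
  "mutate_cluster N k B x =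
     x(k := ((\<Prod>i<N. x i ^ nat (max (B i k) 0)) + (\<Prod>i<N. x i ^ nat (max (- B i k) 0))) / x k)"

definition mutate_seed :: "nat \<Rightarrow> nat \<Rightarrow> 'f::field seed \<Rightarrow> 'f seed" where
  "mutate_seed N k s = (mutate_cluster N k (snd s) (fst s), mutate_matrix k (snd s))"

inductive_set seeds :: "nat \<Rightarrow> nat set \<Rightarrow> 'f::field seed \<Rightarrow> 'f seed set"
  for N S s where
    initial: "s \<in> seeds N S s"
  | mutate: "s' \<in> seeds N S s \<Longrightarrow> k \<in> S \<Longrightarrow> mutate_seed N k s' \<in> seeds N S s"

definition cluster_variables :: "nat \<Rightarrow> nat set \<Rightarrow> 'f::field seed \<Rightarrow> 'f set" where
  "cluster_variables N S s = {x i | x B i. (x, B) \<in> seeds N S s \<and> i < N}"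

definition cluster_algebra_Z :: "nat \<Rightarrow> nat set \<Rightarrow> 'f::field seed \<Rightarrow> 'f set" where
  "cluster_algebra_Z N S s =
     generate_ring (ring_of_type_algebra :: 'f ring)
       (cluster_variables N S s \<union> (\<lambda>i. inverse (fst s i)) ` ({..<N} - S))"

text \<open>Extensionality makes distinct elements correspond to distinct homomorphisms on \<open>A\<close>.\<close>

definition ring_points :: "'f::field set \<Rightarrow> ('c, 'd) ring_scheme \<Rightarrow> ('f \<Rightarrow> 'c) set" where
  "ring_points A K =
     Ring.ring_hom ((ring_of_type_algebra :: 'f ring)\<lparr>carrier := A\<rparr>) K \<inter> extensional A"

text \<open>
  A copy of the field with \<open>q\<close> elements.  Every finite field is isomorphic to one whose carrier
  is a set of natural numbers.
\<close>

definition is_finite_field :: "nat \<Rightarrow> nat ring \<Rightarrow> bool" where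
  "is_finite_field q K \<longleftrightarrow> Ring.field K \<and> finite (carrier K) \<and> card (carrier K) = q"

definition full_rank :: "nat \<Rightarrow> nat \<Rightarrow> exchange_matrix \<Rightarrow> bool" where
  "full_rank n m B \<longleftrightarrow>
     vec_space.rank (n + m) (mat (n + m) n (\<lambda>(i, j). rat_of_int (B i j))) = n"

definition really_full_rank :: "nat \<Rightarrow> nat \<Rightarrow> exchange_matrix \<Rightarrow> bool" where
  "really_full_rank n m B \<longleftrightarrow>
     (\<forall>v :: nat \<Rightarrow> int. \<exists>c :: nat \<Rightarrow> int. \<forall>j<n. v j = (\<Sum>i<n + m. c i * B i j))"

definition quiver_edges :: "nat set \<Rightarrow> exchange_matrix \<Rightarrow> (nat \<times> nat) set" where
  "quiver_edges S B = {(i, j). i \<in> S \<and> j \<in> S \<and> B i j > 0}"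

definition separating_edge :: "(nat \<times> nat) set \<Rightarrow> nat \<Rightarrow> nat \<Rightarrow> bool" where
  "separating_edge E i j \<longleftrightarrow>
     (i, j) \<in> E \<and>
     \<not> (\<exists>v :: int \<Rightarrow> nat. (\<forall>t. (v t, v (t + 1)) \<in> E) \<and> (\<exists>t. v t = i \<and> v (t + 1) = j))"

inductive louise :: "nat \<Rightarrow> nat set \<Rightarrow> 'f::field seed \<Rightarrow> bool" for N where
    no_edges:
      "(x, B) \<in> seeds N S s \<Longrightarrow> quiver_edges S B = {} \<Longrightarrow> louise N S s"
  | separating:
      "(x, B) \<in> seeds N S s \<Longrightarrow> separating_edge (quiver_edges S B) i j \<Longrightarrow>
       louise N (S - {i}) (x, B) \<Longrightarrow> louise N (S - {j}) (x, B) \<Longrightarrow>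
       louise N (S - {i, j}) (x, B) \<Longrightarrow> louise N S s"

definition dirichlet_character :: "nat \<Rightarrow> (int \<Rightarrow> complex) \<Rightarrow> bool" where
  "dirichlet_character N \<chi> \<longleftrightarrow>
     N > 0
     \<and> (\<forall>a. \<chi> (a + int N) = \<chi> a)
     \<and> (\<forall>a b. \<chi> (a * b) = \<chi> a * \<chi> b)
     \<and> (\<forall>a. \<chi> a \<noteq> 0 \<longleftrightarrow> gcd a (int N) = 1)"

abbreviation prime_powers :: "nat set" where
  "prime_powers \<equiv> {q. primepow q}"

definition prime_power_functions :: "(nat \<Rightarrow> complex) ring" where
  "prime_power_functions =
     \<lparr>carrier = prime_powers \<rightarrow>\<^sub>E UNIV,
      monoid.mult = (\<lambda>f g. \<lambda>q\<in>prime_powers. f q * g q),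
      one = (\<lambda>q\<in>prime_powers. 1),
      zero = (\<lambda>q\<in>prime_powers. 0),
      add = (\<lambda>f g. \<lambda>q\<in>prime_powers. f q + g q)\<rparr>"

definition Lambda_ring :: "(nat \<Rightarrow> complex) set" where
  "Lambda_ring =
     generate_ring prime_power_functions
       (insert (\<lambda>q\<in>prime_powers. of_nat q)
         {\<lambda>q\<in>prime_powers. \<chi> (int q) | N \<chi>. dirichlet_character N \<chi>})"

end

(*
For a full rank seed, exchange binomials of different mutable indices are coprime, so that the
upper bound, the intersection of the Laurent ring of a seed with those of its neighbours, does
not change under mutation; hence it contains the cluster algebra.  For a quiver without edges
the two agree, and a point of the cluster variety is a solution of y_i z_i = P_i(y).
A separating edge i -> j makes x_i and x_j generate the unit ideal of the cluster algebra.
The localization at x_i (x_j, x_i x_j) is the cluster algebra in which i (j, both) is frozen, so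
the number of points satisfies inclusion-exclusion along the Louise recursion.
Without edges, the solutions are counted by discrete logarithms: prescribing which of the P_i(y)
vanish gives a system of congruences modulo q - 1, which is diagonalized over the integers.  The
resulting factors gcd(d, q - 1) are the sums of phi(e) [q = 1 mod e] over the divisors e of d,
and phi(e) [q = 1 mod e] is the sum of all Dirichlet characters modulo e at q.  In the really full
rank case every pivot d is a unit, and only powers of q and q - 1 remain.
*)

theory Submission
  imports Defs "HOL-Number_Theory.Residues"
begin

subsection \<open>Subrings of a field\<close>

text \<open>The obstacle is that the inclusion of \<open>calg N S s\<close> in
  \<open>calg N (S - {i}) s\<close> is not formal: a cluster variable may need mutations at
  \<open>i\<close>, and nothing shows directly that it is a polynomial in generators obtained with
  \<open>i\<close> frozen. Upper bounds, in contrast, visibly grow when an index is frozen. Equality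
  of algebra and upper bound, proved along the same recursion, is what turns freezing into
  localization. All rings are subrings of the given field, generated over the integers. The rank
  condition is used only there, to keep exchange binomials coprime, and never over the finite field;
  a point is a homomorphism out of the integral algebra, so the count by congruences holds for every
  \<open>q\<close>. Primes are lost only when this count is expressed by characters:
  \<open>p\<close> must not divide the moduli \<open>e\<close>, because characters vanish at
  nonunits, and \<open>q - 1\<close> has to be even for the logarithm of -1 to be
  \<open>(q - 1) / 2\<close>. With unit pivots neither restriction arises, which is why the
  polynomial count covers all prime powers.\<close>

definition sring :: "'f::field set \<Rightarrow> bool" where
  "sring A \<longleftrightarrow> 1 \<in> A \<and> (\<forall>a\<in>A. \<forall>b\<in>A. a - b \<in> A \<and> a * b \<in> A)"

lemma sring_one: "sring A \<Longrightarrow> 1 \<in> A"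
  and sring_diff: "sring A \<Longrightarrow> a \<in> A \<Longrightarrow> b \<in> A \<Longrightarrow> a - b \<in> A"
  and sring_mult: "sring A \<Longrightarrow> a \<in> A \<Longrightarrow> b \<in> A \<Longrightarrow> a * b \<in> A"
  by (auto simp: sring_def)

lemma sring_zero: "sring A \<Longrightarrow> 0 \<in> A"
  using sring_diff[of A 1 1] sring_one[of A] by simp

lemma sring_uminus: "sring A \<Longrightarrow> a \<in> A \<Longrightarrow> - a \<in> A"
  using sring_diff[of A 0 a] sring_zero[of A] by simp

lemma sring_add: "sring A \<Longrightarrow> a \<in> A \<Longrightarrow> b \<in> A \<Longrightarrow> a + b \<in> A"
  using sring_diff[of A a "- b"] sring_uminus[of A b] by simp

lemma sring_power: "sring A \<Longrightarrow> a \<in> A \<Longrightarrow> a ^ n \<in> A"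
  by (induction n) (auto intro: sring_one sring_mult)

lemma sring_sum: "sring A \<Longrightarrow> (\<And>i. i \<in> I \<Longrightarrow> f i \<in> A) \<Longrightarrow> (\<Sum>i\<in>I. f i) \<in> A"
  by (induction I rule: infinite_finite_induct) (auto intro: sring_zero sring_add)

lemma sring_prod: "sring A \<Longrightarrow> (\<And>i. i \<in> I \<Longrightarrow> f i \<in> A) \<Longrightarrow> (\<Prod>i\<in>I. f i) \<in> A"
  by (induction I rule: infinite_finite_induct) (auto intro: sring_one sring_mult)

lemmas sring_intros = sring_one sring_diff sring_mult sring_zero sring_uminus sring_add
  sring_power sring_sum sring_prod

lemma sring_powi:
  assumes "sring A" "a \<in> A" "inverse a \<in> A"
  shows "a powi n \<in> A"
  using assms by (auto simp: power_int_def intro: sring_power)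

lemma sring_Int: "sring A \<Longrightarrow> sring B \<Longrightarrow> sring (A \<inter> B)"
  by (auto simp: sring_def)

lemma sring_INT: "(\<And>i. i \<in> I \<Longrightarrow> sring (A i)) \<Longrightarrow> sring (\<Inter>i\<in>I. A i)"
  by (auto simp: sring_def)

text \<open>Closure under differences, rather than under sums and negatives, matches
  \<open>sring\<close> and leaves a single additive case in inductions.\<close>

inductive_set gen :: "'f::field set \<Rightarrow> 'f set" for G where
  gen_base: "a \<in> G \<Longrightarrow> a \<in> gen G"
| gen_one: "1 \<in> gen G"
| gen_diff: "a \<in> gen G \<Longrightarrow> b \<in> gen G \<Longrightarrow> a - b \<in> gen G"
| gen_mult: "a \<in> gen G \<Longrightarrow> b \<in> gen G \<Longrightarrow> a * b \<in> gen G"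

lemma sring_gen [simp, intro]: "sring (gen G)"
  by (auto simp: sring_def intro: gen.intros)

lemma gen_least:
  assumes "sring A" "G \<subseteq> A"
  shows "gen G \<subseteq> A"
proof
  fix a assume "a \<in> gen G"
  then show "a \<in> A"
    by (induction rule: gen.induct) (use assms in \<open>auto intro: sring_intros\<close>)
qed

lemma gen_mono: "G \<subseteq> H \<Longrightarrow> gen G \<subseteq> gen H"
  by (rule gen_least) (auto intro: gen_base)

lemma a_minus_type_algebra:
  "\<ominus>\<^bsub>(ring_of_type_algebra :: 'f::field ring)\<^esub> a = - a"
proof -
  interpret ring "ring_of_type_algebra :: 'f ring" by (rule ring_from_type_algebra)
  show ?thesis
    by (rule minus_equality) (simp_all add: ring_of_type_algebra_def)
qed

lemma generate_ring_eq_gen: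
  "generate_ring (ring_of_type_algebra :: 'f::field ring) H = gen H"
proof (intro equalityI subsetI)
  fix a assume "a \<in> generate_ring (ring_of_type_algebra :: 'f ring) H"
  then show "a \<in> gen H"
  proof (induction rule: generate_ring.induct)
    case (a_inv h)
    then show ?case by (simp add: a_minus_type_algebra sring_intros)
  qed (auto simp: ring_of_type_algebra_def intro: gen.intros sring_intros)
next
  fix a assume "a \<in> gen H"
  then show "a \<in> generate_ring (ring_of_type_algebra :: 'f ring) H"
  proof (induction rule: gen.induct)
    case (gen_diff a b)
    from generate_ring.eng_add[OF gen_diff(3) generate_ring.a_inv[OF gen_diff(4)]]
    show ?case unfolding a_minus_type_algebra by (simp add: ring_of_type_algebra_def)
  next
    case (gen_mult a b)
    from generate_ring.eng_mult[OF gen_mult(3,4)] show ?case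
      by (simp add: ring_of_type_algebra_def)
  next
    case gen_one
    then show ?case
      using generate_ring.one[of "ring_of_type_algebra :: 'f ring" H]
      by (simp add: ring_of_type_algebra_def)
  qed (auto intro: generate_ring.incl)
qed

section \<open>Localization at one element, inside the field\<close>

definition loc :: "'f::field set \<Rightarrow> 'f \<Rightarrow> 'f set" where
  "loc A w = {f. \<exists>n. w ^ n * f \<in> A}"

lemma subset_loc: "A \<subseteq> loc A w"
  unfolding loc_def by (auto intro: exI[of _ 0])

lemma locI: "w ^ n * f \<in> A \<Longrightarrow> f \<in> loc A w"
  by (auto simp: loc_def)

lemma sring_loc:
  assumes A: "sring A" and w: "w \<in> A"
  shows "sring (loc A w)"
  unfolding sring_def
proof (intro conjI ballI)
  show "1 \<in> loc A w" using subset_loc sring_one[OF A] by blast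
next
  fix f g assume "f \<in> loc A w" "g \<in> loc A w"
  then obtain m n where m: "w ^ m * f \<in> A" and n: "w ^ n * g \<in> A"
    by (auto simp: loc_def)
  have "w ^ n * (w ^ m * f) - w ^ m * (w ^ n * g) \<in> A"
    by (intro sring_intros A w m n)
  then show "f - g \<in> loc A w"
    by (intro locI[of _ "m + n"]) (simp add: power_add algebra_simps)
  have "(w ^ m * f) * (w ^ n * g) \<in> A"
    by (intro sring_intros A m n)
  then show "f * g \<in> loc A w"
    by (intro locI[of _ "m + n"]) (simp add: power_add algebra_simps)
qed

lemma inverse_in_loc: "sring A \<Longrightarrow> w \<noteq> 0 \<Longrightarrow> inverse w \<in> loc A w"
  by (rule locI[of _ 1]) (auto intro: sring_one)

text \<open>No element of the field outside \<open>A\<close> is multiplied into \<open>A\<close> by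
  both \<open>u\<close> and \<open>v\<close>. For nonzero elements of a factorial domain this is the
  absence of a common prime factor, but no factorization theory is involved.\<close>

definition coprimal :: "'f::field set \<Rightarrow> 'f \<Rightarrow> 'f \<Rightarrow> bool" where
  "coprimal A u v \<longleftrightarrow> (\<forall>f. u * f \<in> A \<longrightarrow> v * f \<in> A \<longrightarrow> f \<in> A)"

lemma coprimal_comaximal:
  assumes "sring A" "a \<in> A" "b \<in> A" "a * u + b * v = 1"
  shows "coprimal A u v"
  unfolding coprimal_def
proof (intro allI impI)
  fix f assume "u * f \<in> A" "v * f \<in> A"
  then have "a * (u * f) + b * (v * f) \<in> A"
    using assms by (intro sring_add[OF assms(1)] sring_mult[OF assms(1) assms(2)] sring_mult[OF assms(1) assms(3)])
  also have "a * (u * f) + b * (v * f) = (a * u + b * v) * f" by (simp add: algebra_simps)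
  finally show "f \<in> A" using assms by simp
qed

text \<open>A fraction with a power of \<open>u\<close> as denominator, and also with a power of
  \<open>v\<close>, has no denominator at all: from \<open>u ^ Suc m * f\<close> in \<open>A\<close>
  the powers of \<open>v\<close> are removed one by one from \<open>v ^ n * (u ^ m * f)\<close>,
  which lowers the power of \<open>u\<close>.\<close>

lemma coprimal_loc:
  assumes A: "sring A" and uv: "u \<in> A" "v \<in> A" "coprimal A u v"
    and f: "f \<in> loc A u" "f \<in> loc A v"
  shows "f \<in> A"
proof -
  obtain m n where m: "u ^ m * f \<in> A" and n: "v ^ n * f \<in> A"
    using f by (auto simp: loc_def)
  show ?thesis using m
  proof (induction m)
    case (Suc m)
    have "v ^ j * (u ^ m * f) \<in> A \<Longrightarrow> u ^ m * f \<in> A" for j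
    proof (induction j)
      case (Suc j)
      have "v ^ j * (u ^ m * f) \<in> A"
      proof -
        have "u * (v ^ j * (u ^ m * f)) = v ^ j * (u ^ Suc m * f)" by simp
        also have "\<dots> \<in> A" by (intro sring_intros A uv \<open>u ^ Suc m * f \<in> A\<close>)
        finally have "u * (v ^ j * (u ^ m * f)) \<in> A" .
        moreover have "v * (v ^ j * (u ^ m * f)) \<in> A" using Suc.prems by (simp add: mult.assoc)
        ultimately show ?thesis using uv(3) unfolding coprimal_def by blast
      qed
      then show ?case by (rule Suc.IH)
    qed simp
    moreover have "v ^ n * (u ^ m * f) \<in> A"
    proof -
      have "u ^ m * (v ^ n * f) \<in> A" by (intro sring_intros A uv n)
      then show ?thesis by (simp add: algebra_simps)
    qed
    ultimately have "u ^ m * f \<in> A" by blast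
    then show ?case by (rule Suc.IH)
  qed simp
qed

subsection \<open>Laurent monomials and transcendental elements\<close>

text \<open>The coefficients come from the prime ring only, as they do in
  \<open>cluster_algebra_Z\<close>; the ground field does not enter.\<close>

definition laur :: "nat set \<Rightarrow> (nat \<Rightarrow> 'f::field) \<Rightarrow> 'f set" where
  "laur I x = gen (x ` I \<union> (\<lambda>i. inverse (x i)) ` I)"

lemma sring_laur [simp, intro]: "sring (laur I x)"
  by (simp add: laur_def)

lemma laur_base: "i \<in> I \<Longrightarrow> x i \<in> laur I x"
  and laur_inverse: "i \<in> I \<Longrightarrow> inverse (x i) \<in> laur I x"
  by (auto simp: laur_def intro: gen_base)

lemma laur_mono: "I \<subseteq> J \<Longrightarrow> laur I x \<subseteq> laur J x"
  unfolding laur_def by (rule gen_mono) auto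

lemma laur_cong: "(\<And>i. i \<in> I \<Longrightarrow> x i = y i) \<Longrightarrow> laur I x = laur I y"
  unfolding laur_def by (intro arg_cong[of _ _ gen] arg_cong2[of _ _ _ _ "(\<union>)"] image_cong) auto

lemma laur_upd: "j \<notin> I \<Longrightarrow> laur I (x(j := t)) = laur I x"
  by (rule laur_cong) auto

lemma laur_least:
  "sring A \<Longrightarrow> (\<And>i. i \<in> I \<Longrightarrow> x i \<in> A) \<Longrightarrow> (\<And>i. i \<in> I \<Longrightarrow> inverse (x i) \<in> A) \<Longrightarrow> laur I x \<subseteq> A"
  unfolding laur_def by (rule gen_least) auto

lemma laur_powi: "i \<in> I \<Longrightarrow> x i powi n \<in> laur I x"
  by (intro sring_powi laur_base laur_inverse) auto

section \<open>Transcendental elements and Laurent expansions in one variable\<close>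

definition transc :: "'f::field set \<Rightarrow> 'f \<Rightarrow> bool" where
  "transc R t \<longleftrightarrow> (\<forall>F c. finite F \<longrightarrow> (\<forall>r\<in>F. c r \<in> R) \<longrightarrow> (\<Sum>r\<in>F. c r * t powi r) = 0
                    \<longrightarrow> (\<forall>r\<in>F. c r = 0))"

lemma transcD:
  "transc R t \<Longrightarrow> finite F \<Longrightarrow> (\<And>r. r \<in> F \<Longrightarrow> c r \<in> R) \<Longrightarrow> (\<Sum>r\<in>F. c r * t powi r) = 0
     \<Longrightarrow> r \<in> F \<Longrightarrow> c r = 0"
  unfolding transc_def by blast

lemma transc_mono: "transc R t \<Longrightarrow> R' \<subseteq> R \<Longrightarrow> transc R' t"
  unfolding transc_def by (meson subset_iff)

text \<open>Exponents run over all integers, and \<open>0 powi 1 = 0\<close> would be a nontrivial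
  relation.\<close>

lemma transc_nonzero:
  assumes "transc R t" "sring R" shows "t \<noteq> 0"
proof
  assume "t = 0"
  then have "(\<Sum>r\<in>{1::int}. (\<lambda>_. 1) r * t powi r) = 0" by simp
  from transcD[OF assms(1) _ _ this, of 1] sring_one[OF assms(2)] show False by auto
qed

lemma transc_eqD:
  assumes t: "transc R t" and R: "sring R" and F: "finite F" "finite G"
    and c: "\<And>r. r \<in> F \<Longrightarrow> c r \<in> R" and d: "\<And>r. r \<in> G \<Longrightarrow> d r \<in> R"
    and eq: "(\<Sum>r\<in>F. c r * t powi r) = (\<Sum>r\<in>G. d r * t powi r)"
  shows "(if r \<in> F then c r else 0) = (if r \<in> G then d r else 0)"
proof (cases "r \<in> F \<union> G")
  case True
  let ?e = "\<lambda>r. (if r \<in> F then c r else 0) - (if r \<in> G then d r else 0)"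
  have "(\<Sum>r\<in>F \<union> G. ?e r * t powi r) = (\<Sum>r\<in>F. c r * t powi r) - (\<Sum>r\<in>G. d r * t powi r)"
  proof -
    have "(\<Sum>r\<in>F \<union> G. (if r \<in> F then c r else 0) * t powi r) = (\<Sum>r\<in>F. c r * t powi r)"
      by (rule sum.mono_neutral_cong_right) (use F in auto)
    moreover have "(\<Sum>r\<in>F \<union> G. (if r \<in> G then d r else 0) * t powi r) = (\<Sum>r\<in>G. d r * t powi r)"
      by (rule sum.mono_neutral_cong_right) (use F in auto)
    ultimately show ?thesis by (simp add: left_diff_distrib sum_subtractf)
  qed
  also have "\<dots> = 0" using eq by simp
  finally have eq0: "(\<Sum>r\<in>F \<union> G. ?e r * t powi r) = 0" .
  have "?e r \<in> R" for r
    by (rule sring_diff[OF R]) (simp_all add: c d sring_zero[OF R])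
  from transcD[OF t _ this eq0 True] have "?e r = 0" using F by simp
  then show ?thesis by simp
qed auto

text \<open>The ring \<open>R[t, 1/t]\<close>, written through sums so that coefficients can be
  compared; \<open>lsums_eq_gen\<close> identifies it with a generated ring.\<close>

definition lsums :: "'f::field set \<Rightarrow> 'f \<Rightarrow> 'f set" where
  "lsums R t = {\<Sum>r\<in>F. c r * t powi r | F c. finite F \<and> (\<forall>r\<in>F. c r \<in> R)}"

lemma lsumsI:
  "finite F \<Longrightarrow> (\<And>r. r \<in> F \<Longrightarrow> c r \<in> R) \<Longrightarrow> f = (\<Sum>r\<in>F. c r * t powi r) \<Longrightarrow> f \<in> lsums R t"
  unfolding lsums_def by blast

lemma lsumsE:
  assumes "f \<in> lsums R t"
  obtains F c where "finite F" "\<forall>r\<in>F. c r \<in> R" "f = (\<Sum>r\<in>F. c r * t powi r)"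
  using assms unfolding lsums_def by auto

lemma lsums_term: "c \<in> R \<Longrightarrow> c * t powi r \<in> lsums R t"
  by (rule lsumsI[of "{r}" "\<lambda>_. c"]) auto

lemma sring_lsums:
  assumes R: "sring R" and t: "t \<noteq> 0"
  shows "sring (lsums R t)"
  unfolding sring_def
proof (intro conjI ballI)
  show "1 \<in> lsums R t" using lsums_term[OF sring_one[OF R], of t 0] by simp
next
  have add: "f + g \<in> lsums R t" if "f \<in> lsums R t" "g \<in> lsums R t" for f g
  proof -
    from that(1) obtain F c where F: "finite F" "\<forall>r\<in>F. c r \<in> R"
      "f = (\<Sum>r\<in>F. c r * t powi r)" by (rule lsumsE)
    from that(2) obtain G d where G: "finite G" "\<forall>r\<in>G. d r \<in> R"
      "g = (\<Sum>r\<in>G. d r * t powi r)" by (rule lsumsE)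
    have 1: "(\<Sum>r\<in>F \<union> G. (if r \<in> F then c r else 0) * t powi r) = f"
      unfolding F(3) by (rule sum.mono_neutral_cong_right) (use F G in auto)
    have 2: "(\<Sum>r\<in>F \<union> G. (if r \<in> G then d r else 0) * t powi r) = g"
      unfolding G(3) by (rule sum.mono_neutral_cong_right) (use F G in auto)
    show ?thesis
    proof (rule lsumsI[of "F \<union> G" "\<lambda>r. (if r \<in> F then c r else 0) + (if r \<in> G then d r else 0)"])
      show "f + g = (\<Sum>r\<in>F \<union> G. ((if r \<in> F then c r else 0) + (if r \<in> G then d r else 0)) * t powi r)"
        by (simp only: distrib_right sum.distrib 1 2)
    qed (use F G R in \<open>auto intro: sring_intros\<close>)
  qed
  have sum: "(\<Sum>i\<in>I. f i) \<in> lsums R t" if "\<And>i. i \<in> I \<Longrightarrow> f i \<in> lsums R t" for I and f :: "int \<Rightarrow> 'a"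
    using that
    by (induction I rule: infinite_finite_induct)
       (use lsums_term[OF sring_zero[OF R], of t 0] add in auto)
  fix f g assume f: "f \<in> lsums R t" and g: "g \<in> lsums R t"
  from f obtain F c where F: "finite F" "\<forall>r\<in>F. c r \<in> R"
    "f = (\<Sum>r\<in>F. c r * t powi r)" by (rule lsumsE)
  from g obtain G d where G: "finite G" "\<forall>r\<in>G. d r \<in> R"
    "g = (\<Sum>r\<in>G. d r * t powi r)" by (rule lsumsE)
  have "- g \<in> lsums R t"
    by (rule lsumsI[OF G(1), of "\<lambda>r. - d r"]) (use G R in \<open>auto simp: sum_negf intro: sring_intros\<close>)
  with add[of f "- g"] f show "f - g \<in> lsums R t" by simp
  have "f * g = (\<Sum>r\<in>F. \<Sum>s\<in>G. (c r * d s) * t powi (r + s))"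
    unfolding F(3) G(3) sum_product using t by (simp add: power_int_add mult_ac)
  also have "\<dots> \<in> lsums R t"
    by (intro sum lsums_term sring_mult[OF R]) (use F G in auto)
  finally show "f * g \<in> lsums R t" .
qed

lemma lsums_eq_gen:
  assumes R: "sring R" and t: "t \<noteq> 0"
  shows "lsums R t = gen (R \<union> {t, inverse t})"
proof
  show "gen (R \<union> {t, inverse t}) \<subseteq> lsums R t"
  proof (rule gen_least[OF sring_lsums[OF assms]])
    show "R \<union> {t, inverse t} \<subseteq> lsums R t"
      using lsums_term[of _ R t 0] lsums_term[OF sring_one[OF R], of t 1]
        lsums_term[OF sring_one[OF R], of t "-1"] by auto
  qed
  show "lsums R t \<subseteq> gen (R \<union> {t, inverse t})"
  proof
    fix f assume "f \<in> lsums R t"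
    then obtain F c where "finite F" "\<forall>r\<in>F. c r \<in> R" "f = (\<Sum>r\<in>F. c r * t powi r)"
      by (rule lsumsE)
    then show "f \<in> gen (R \<union> {t, inverse t})"
      by (simp add: sring_sum sring_mult sring_powi gen_base)
  qed
qed

lemma laur_split:
  assumes "j \<in> I" "x j \<noteq> 0"
  shows "laur I x = lsums (laur (I - {j}) x) (x j)"
proof -
  have "laur I x = gen (laur (I - {j}) x \<union> {x j, inverse (x j)})"
  proof
    show "laur I x \<subseteq> gen (laur (I - {j}) x \<union> {x j, inverse (x j)})"
    proof (rule laur_least)
      fix i assume "i \<in> I"
      show "x i \<in> gen (laur (I - {j}) x \<union> {x j, inverse (x j)})"
        by (rule gen_base, cases "i = j") (use \<open>i \<in> I\<close> in \<open>auto intro: laur_base\<close>)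
      show "inverse (x i) \<in> gen (laur (I - {j}) x \<union> {x j, inverse (x j)})"
        by (rule gen_base, cases "i = j") (use \<open>i \<in> I\<close> in \<open>auto intro: laur_inverse\<close>)
    qed auto
    show "gen (laur (I - {j}) x \<union> {x j, inverse (x j)}) \<subseteq> laur I x"
    proof (rule gen_least)
      show "laur (I - {j}) x \<union> {x j, inverse (x j)} \<subseteq> laur I x"
        using laur_mono[of "I - {j}" I x] laur_base[OF assms(1), of x] laur_inverse[OF assms(1), of x]
        by blast
    qed simp
  qed
  then show ?thesis unfolding lsums_eq_gen[OF sring_laur assms(2)] .
qed

text \<open>If \<open>P / t\<close> is inverted as well, the negative part of a Laurent expansion must be divisible
  by the corresponding powers of \<open>P\<close>.\<close>
lemma transc_mutate_coeff:
  assumes t: "transc R t" and R: "sring R" and P: "P \<in> R" "P \<noteq> 0"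
    and F: "finite F" "\<And>r. r \<in> F \<Longrightarrow> c r \<in> R" and mem: "(\<Sum>r\<in>F. c r * t powi r) \<in> lsums R (P / t)"
    and r: "r \<in> F" "r < 0"
  shows "c r / P ^ nat (- r) \<in> R"
proof -
  have t0: "t \<noteq> 0" using transc_nonzero[OF t R] .
  from mem obtain G d where G: "finite G" "\<forall>r\<in>G. d r \<in> R"
    "(\<Sum>r\<in>F. c r * t powi r) = (\<Sum>r\<in>G. d r * (P / t) powi r)" by (rule lsumsE)
  \<comment> \<open>Every exponent in \<open>G\<close> is at least \<open>- M\<close>, so after
    multiplication by \<open>P powi M\<close> only nonnegative powers of \<open>P\<close> occur, and
    the coefficients of the powers of \<open>t\<close> lie in \<open>R\<close>.\<close>
  define M where "M = (\<Sum>r\<in>G. \<bar>r\<bar>)"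
  have M: "r + M \<ge> 0" if "r \<in> G" for r
  proof -
    have "\<bar>r\<bar> \<le> M" unfolding M_def by (rule member_le_sum) (use that G in auto)
    then show ?thesis by linarith
  qed
  have M0: "M \<ge> 0" by (auto simp: M_def intro: sum_nonneg)
  have PM: "P powi n \<in> R" if "n \<ge> 0" for n
    using that P R by (auto simp: power_int_def intro: sring_power)
  have "(\<Sum>r\<in>F. (P powi M * c r) * t powi r) = P powi M * (\<Sum>r\<in>G. d r * (P / t) powi r)"
    unfolding G(3)[symmetric] by (simp add: sum_distrib_left mult_ac)
  also have "\<dots> = (\<Sum>r\<in>G. (d r * P powi (M + r)) * t powi (- r))"
    unfolding sum_distrib_left
    by (rule sum.cong) (use P t0 in \<open>auto simp: power_int_divide_distrib power_int_minus power_int_add field_simps\<close>)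
  also have "\<dots> = (\<Sum>r\<in>uminus ` G. (d (- r) * P powi (M - r)) * t powi r)"
    by (subst sum.reindex) (auto simp: inj_on_def)
  finally have eq0: "(\<Sum>r\<in>F. (P powi M * c r) * t powi r)
      = (\<Sum>r\<in>uminus ` G. (d (- r) * P powi (M - r)) * t powi r)" .
  have c': "P powi M * c r \<in> R" if "r \<in> F" for r
    by (intro sring_mult R PM M0 F that)
  have d': "d (- r) * P powi (M - r) \<in> R" if "r \<in> uminus ` G" for r
  proof (intro sring_mult R PM)
    show "d (- r) \<in> R" using that G(2) by auto
    show "0 \<le> M - r" using that M by force
  qed
  have "(if r \<in> F then P powi M * c r else 0)
      = (if r \<in> uminus ` G then d (- r) * P powi (M - r) else 0)"
    by (rule transc_eqD[OF t R F(1) finite_imageI[OF G(1)] c' d' eq0])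
  with r have eq: "P powi M * c r = (if r \<in> uminus ` G then d (- r) * P powi (M - r) else 0)" by simp
  show ?thesis
  proof (cases "r \<in> uminus ` G")
    case True
    with eq have "c r = d (- r) * P powi (- r)"
      using P by (simp add: power_int_diff power_int_minus field_simps)
    also have "P powi (- r) = P ^ nat (- r)" using r by (simp add: power_int_def)
    finally have "c r / P ^ nat (- r) = d (- r)" using P by simp
    with G(2) True show ?thesis by force
  next
    case False
    with eq P have "c r = 0" by simp
    then show ?thesis using R by (simp add: sring_zero)
  qed
qed

text \<open>A relation for \<open>P / t\<close>, multiplied by a high power of \<open>P\<close>, is
  a relation for \<open>t\<close> with negated exponents and coefficients
  \<open>d r * P powi (M + r)\<close>.\<close>

lemma transc_mutate:
  assumes t: "transc R t" and R: "sring R" and P: "P \<in> R" "P \<noteq> 0"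
  shows "transc R (P / t)"
  unfolding transc_def
proof (intro allI impI ballI)
  fix G d r assume G: "finite G" "\<forall>r\<in>G. d r \<in> R" "(\<Sum>r\<in>G. d r * (P / t) powi r) = 0" and r: "r \<in> G"
  have t0: "t \<noteq> 0" using transc_nonzero[OF t R] .
  define M where "M = (\<Sum>r\<in>G. \<bar>r\<bar>)"
  have M: "r + M \<ge> 0" if "r \<in> G" for r
  proof -
    have "\<bar>r\<bar> \<le> M" unfolding M_def by (rule member_le_sum) (use that G in auto)
    then show ?thesis by linarith
  qed
  have PM: "P powi n \<in> R" if "n \<ge> 0" for n
    using that P R by (auto simp: power_int_def intro: sring_power)
  have "0 = P powi M * (\<Sum>r\<in>G. d r * (P / t) powi r)" using G by simp
  also have "\<dots> = (\<Sum>r\<in>G. (d r * P powi (M + r)) * t powi (- r))"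
    unfolding sum_distrib_left
    by (rule sum.cong) (use P t0 in \<open>auto simp: power_int_divide_distrib power_int_minus power_int_add field_simps\<close>)
  also have "\<dots> = (\<Sum>r\<in>uminus ` G. (d (- r) * P powi (M - r)) * t powi r)"
    by (subst sum.reindex) (auto simp: inj_on_def)
  finally have "(\<Sum>r\<in>uminus ` G. (d (- r) * P powi (M - r)) * t powi r) = 0" by simp
  moreover have "d (- i) * P powi (M - i) \<in> R" if "i \<in> uminus ` G" for i
  proof (intro sring_mult R PM)
    show "d (- i) \<in> R" using that G(2) by auto
    show "0 \<le> M - i" using that M by force
  qed
  ultimately have "d (- (- r)) * P powi (M - (- r)) = 0"
    by (intro transcD[OF t, of "uminus ` G" "\<lambda>r. d (- r) * P powi (M - r)" "- r"]) (use G r in simp_all)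
  with P show "d r = 0" by simp
qed

text \<open>A relation of \<open>s\<close> over \<open>R[t, 1/t]\<close> is a double sum. Sorted by
  powers of \<open>t\<close> with coefficients in \<open>R[s, 1/s]\<close>, it vanishes by the
  hypothesis on \<open>t\<close> and then by the one on \<open>s\<close>.\<close>

lemma transc_swap:
  assumes s: "transc R s" and t: "transc (lsums R s) t" and R: "sring R"
  shows "transc (lsums R t) s"
  unfolding transc_def
proof (intro allI impI ballI)
  fix F f r assume F: "finite F" "\<forall>r\<in>F. f r \<in> lsums R t" "(\<Sum>r\<in>F. f r * s powi r) = 0" and r: "r \<in> F"
  have "\<exists>Gc. finite (fst Gc) \<and> (\<forall>i\<in>fst Gc. snd Gc i \<in> R) \<and> f r = (\<Sum>i\<in>fst Gc. snd Gc i * t powi i)"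
    if "r \<in> F" for r
  proof -
    from F(2) that have "f r \<in> lsums R t" by blast
    then obtain G c where "finite G" "\<forall>i\<in>G. c i \<in> R" "f r = (\<Sum>i\<in>G. c i * t powi i)"
      by (rule lsumsE)
    then show ?thesis by (intro exI[of _ "(G, c)"]) simp
  qed
  then have "\<forall>r\<in>F. \<exists>Gc. finite (fst Gc) \<and> (\<forall>i\<in>fst Gc. snd Gc i \<in> R) \<and> f r = (\<Sum>i\<in>fst Gc. snd Gc i * t powi i)"
    by blast
  from bchoice[OF this] obtain Gc where Gc: "\<forall>r\<in>F. finite (fst (Gc r)) \<and>
     (\<forall>i\<in>fst (Gc r). snd (Gc r) i \<in> R) \<and> f r = (\<Sum>i\<in>fst (Gc r). snd (Gc r) i * t powi i)"
    by blast
  define G where "G = (\<lambda>r. fst (Gc r))"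
  define c where "c = (\<lambda>r. snd (Gc r))"
  have G: "\<And>r. r \<in> F \<Longrightarrow> finite (G r)" "\<And>r i. r \<in> F \<Longrightarrow> i \<in> G r \<Longrightarrow> c r i \<in> R"
    and f: "\<And>r. r \<in> F \<Longrightarrow> f r = (\<Sum>i\<in>G r. c r i * t powi i)"
    using Gc by (simp_all add: G_def c_def)
  \<comment> \<open>All coefficients are expanded over one common set of exponents, padded with
    zeros, so that the two sums can be exchanged.\<close>
  define H where "H = (\<Union>r\<in>F. G r)"
  define c' where "c' = (\<lambda>r i. if i \<in> G r then c r i else 0)"
  have H: "finite H" using F G by (auto simp: H_def)
  have c': "c' r i \<in> R" if "r \<in> F" for r i using G R that by (auto simp: c'_def sring_zero)
  have f': "f r = (\<Sum>i\<in>H. c' r i * t powi i)" if "r \<in> F" for r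
    unfolding f[OF that] c'_def using H that G by (intro sum.mono_neutral_cong_left) (auto simp: H_def)
  have "0 = (\<Sum>r\<in>F. (\<Sum>i\<in>H. c' r i * t powi i) * s powi r)" using F(3) f' by simp
  also have "\<dots> = (\<Sum>i\<in>H. (\<Sum>r\<in>F. c' r i * s powi r) * t powi i)"
    unfolding sum_distrib_right by (subst sum.swap) (simp add: mult_ac)
  finally have eq: "(\<Sum>i\<in>H. (\<Sum>r\<in>F. c' r i * s powi r) * t powi i) = 0" by simp
  have "(\<Sum>r\<in>F. c' r i * s powi r) = 0" if "i \<in> H" for i
    by (rule transcD[OF t H _ eq that]) (use F c' in \<open>auto intro!: lsumsI\<close>)
  then have "c' r i = 0" if "i \<in> H" for i
    using transcD[OF s F(1) _ _ r, of "\<lambda>r. c' r i"] c' that by auto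
  then show "f r = 0" using f'[OF r] by simp
qed

text \<open>Coefficients extended by 0 to all integers allow shifted ones such as
  \<open>h (r - d)\<close> to be used without a case distinction.\<close>

lemma lsumsE0:
  assumes "f \<in> lsums R t" "sring R"
  obtains F c where "finite F" "\<forall>r. c r \<in> R" "\<forall>r. r \<notin> F \<longrightarrow> c r = 0" "f = (\<Sum>r\<in>F. c r * t powi r)"
proof -
  from assms(1) obtain F c where F: "finite F" "\<forall>r\<in>F. c r \<in> R" "f = (\<Sum>r\<in>F. c r * t powi r)"
    by (rule lsumsE)
  show thesis
    by (rule that[of F "\<lambda>r. if r \<in> F then c r else 0"]) (use F assms(2) in \<open>auto simp: sring_zero\<close>)
qed

text \<open>A factor with constant term 1 and its other term in higher degree cannot create
  divisibility by \<open>c\<close>: if \<open>h\<close> are the coefficients of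
  \<open>c * f\<close>, then \<open>c\<close> divides \<open>h r + m * h (r - d)\<close> for all
  \<open>r\<close>, and hence, from the lowest exponent upwards, every \<open>h r\<close>.\<close>

lemma coprimal_const_pos:
  assumes t: "transc R t" and R: "sring R" and m: "m \<in> R" and d: "d > 0"
    and c: "c \<in> R" "c \<noteq> 0"
    and f1: "c * f \<in> lsums R t" and f2: "(1 + m * t powi d) * f \<in> lsums R t"
  shows "f \<in> lsums R t"
proof -
  have t0: "t \<noteq> 0" using transc_nonzero[OF t R] .
  from f1 R obtain F h where F: "finite F" "\<forall>r. h r \<in> R" "\<forall>r. r \<notin> F \<longrightarrow> h r = 0"
    "c * f = (\<Sum>r\<in>F. h r * t powi r)" by (rule lsumsE0)
  from f2 R obtain G e where G: "finite G" "\<forall>r. e r \<in> R" "\<forall>r. r \<notin> G \<longrightarrow> e r = 0"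
    "(1 + m * t powi d) * f = (\<Sum>r\<in>G. e r * t powi r)" by (rule lsumsE0)
  define H where "H = F \<union> (\<lambda>r. r + d) ` F"
  have H: "finite H" using F by (simp add: H_def)
  have "(\<Sum>r\<in>G. (c * e r) * t powi r) = c * ((1 + m * t powi d) * f)"
    unfolding G(4) by (simp add: sum_distrib_left mult_ac)
  also have "\<dots> = c * f + m * t powi d * (c * f)" by (simp add: algebra_simps)
  also have "\<dots> = (\<Sum>r\<in>F. h r * t powi r) + (\<Sum>r\<in>F. m * h r * t powi (r + d))"
    unfolding F(4) using t0 by (simp add: sum_distrib_left power_int_add mult_ac)
  also have "(\<Sum>r\<in>F. m * h r * t powi (r + d)) = (\<Sum>r\<in>(\<lambda>r. r + d) ` F. m * h (r - d) * t powi r)"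
    by (subst sum.reindex) (auto simp: inj_on_def)
  also have "(\<Sum>r\<in>F. h r * t powi r) = (\<Sum>r\<in>H. h r * t powi r)"
    by (rule sum.mono_neutral_left) (use F H in \<open>auto simp: H_def\<close>)
  also have "(\<Sum>r\<in>(\<lambda>r. r + d) ` F. m * h (r - d) * t powi r) = (\<Sum>r\<in>H. m * h (r - d) * t powi r)"
  proof (rule sum.mono_neutral_left)
    show "\<forall>r\<in>H - (\<lambda>r. r + d) ` F. m * h (r - d) * t powi r = 0"
    proof
      fix r assume "r \<in> H - (\<lambda>r. r + d) ` F"
      then have "r - d \<notin> F" by force
      then show "m * h (r - d) * t powi r = 0" using F(3) by simp
    qed
  qed (use H in \<open>auto simp: H_def\<close>)
  also have "(\<Sum>r\<in>H. h r * t powi r) + (\<Sum>r\<in>H. m * h (r - d) * t powi r)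
      = (\<Sum>r\<in>H. (h r + m * h (r - d)) * t powi r)"
    by (simp add: sum.distrib distrib_right)
  finally have eq: "(\<Sum>r\<in>G. (c * e r) * t powi r) = (\<Sum>r\<in>H. (h r + m * h (r - d)) * t powi r)" .
  have eq': "c * e r = h r + m * h (r - d)" for r
  proof -
    have "(if r \<in> G then c * e r else 0) = (if r \<in> H then h r + m * h (r - d) else 0)"
    proof (rule transc_eqD[OF t R G(1) H _ _ eq])
      show "c * e r \<in> R" for r using G(2) c R by (simp add: sring_mult)
      show "h r + m * h (r - d) \<in> R" for r using F(2) m R by (simp add: sring_mult sring_add)
    qed
    moreover have "h r + m * h (r - d) = 0" if "r \<notin> H"
    proof -
      have "r \<notin> F" "r - d \<notin> F" using that unfolding H_def by force+
      then show ?thesis using F(3) by simp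
    qed
    ultimately show ?thesis using G(3) by (auto split: if_splits)
  qed
  \<comment> \<open>Below \<open>b\<close> all coefficients \<open>h r\<close> vanish, which starts
    the induction over \<open>r < b + int n\<close>.\<close>
  obtain b where b: "\<forall>r\<in>F. b \<le> r"
    using F(1) by (metis Min_le)
  have "r < b + int n \<Longrightarrow> h r / c \<in> R" for n r
  proof (induction n arbitrary: r)
    case 0
    then have "r \<notin> F" using b by force
    then show ?case using F(3) R by (simp add: sring_zero)
  next
    case (Suc n)
    have "r - d < b + int n" using Suc.prems d by simp
    then have "h (r - d) / c \<in> R" by (rule Suc.IH)
    then have "e r - m * (h (r - d) / c) \<in> R"
      by (intro sring_diff[OF R] sring_mult[OF R m] G(2)[rule_format])
    also have "e r - m * (h (r - d) / c) = h r / c"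
      using eq'[of r] c(2) by (simp add: field_simps)
    finally show ?case .
  qed
  note hc' = this
  have hc: "h r / c \<in> R" for r
    by (rule hc'[of r "nat (r + 1 - b)"]) simp
  show ?thesis
  proof (rule lsumsI[OF F(1)])
    show "h r / c \<in> R" for r by (rule hc)
    show "f = (\<Sum>r\<in>F. h r / c * t powi r)"
      using F(4) c(2) by (simp add: sum_divide_distrib[symmetric] field_simps)
  qed
qed

text \<open>For negative \<open>d\<close> the unit \<open>m * t powi d\<close> is factored out,
  which replaces \<open>m\<close> and \<open>d\<close> by \<open>inverse m\<close> and
  \<open>- d\<close>.\<close>

lemma coprimal_const:
  assumes t: "transc R t" and R: "sring R" and m: "m \<in> R" "inverse m \<in> R" "m \<noteq> 0" and d: "d \<noteq> 0"
    and c: "c \<in> R" "c \<noteq> 0"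
    and f1: "c * f \<in> lsums R t" and f2: "(1 + m * t powi d) * f \<in> lsums R t"
  shows "f \<in> lsums R t"
proof (cases "d > 0")
  case True
  show ?thesis by (rule coprimal_const_pos[OF t R m(1) True c f1 f2])
next
  case False
  have t0: "t \<noteq> 0" using transc_nonzero[OF t R] .
  have "(inverse m * t powi (- d)) * ((1 + m * t powi d) * f) \<in> lsums R t"
    by (intro sring_mult sring_lsums R t0 f2 lsums_term m)
  also have "(inverse m * t powi (- d)) * ((1 + m * t powi d) * f) = (1 + inverse m * t powi (- d)) * f"
    using t0 m by (simp add: field_simps power_int_minus)
  finally have f3: "(1 + inverse m * t powi (- d)) * f \<in> lsums R t" .
  show ?thesis by (rule coprimal_const_pos[OF t R m(2) _ c f1 f3]) (use d False in simp)
qed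

section \<open>Laurent monomials and independent clusters\<close>

definition lmon :: "nat set \<Rightarrow> (nat \<Rightarrow> 'f::field) \<Rightarrow> (nat \<Rightarrow> int) \<Rightarrow> 'f" where
  "lmon I x u = (\<Prod>i\<in>I. x i powi u i)"

lemma lmon_in_laur: "I \<subseteq> J \<Longrightarrow> lmon I x u \<in> laur J x"
  unfolding lmon_def by (intro sring_prod laur_powi) auto

lemma inverse_lmon: "inverse (lmon I x u) = lmon I x (\<lambda>i. - u i)"
  unfolding lmon_def by (simp add: prod_inversef[symmetric] power_int_minus)

lemma lmon_split: "finite I \<Longrightarrow> l \<in> I \<Longrightarrow> lmon I x u = x l powi u l * lmon (I - {l}) x u"
  unfolding lmon_def by (simp add: prod.remove)

lemma lmon_nonzero:
  assumes "\<And>i. i \<in> I \<Longrightarrow> x i \<noteq> 0"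
  shows "lmon I x u \<noteq> 0"
proof (cases "finite I")
  case True
  have "x i powi u i \<noteq> 0" if "i \<in> I" for i using assms[OF that] by simp
  with True show ?thesis by (auto simp: lmon_def)
qed (simp add: lmon_def)

lemma lmon_add:
  assumes "\<And>i. i \<in> I \<Longrightarrow> x i \<noteq> 0"
  shows "lmon I x (\<lambda>i. u i + v i) = lmon I x u * lmon I x v"
  unfolding lmon_def prod.distrib[symmetric]
  by (rule prod.cong) (use assms in \<open>auto simp: power_int_add\<close>)

lemma lmon_cong:
  assumes "\<And>i. i \<in> I \<Longrightarrow> u i = v i" "\<And>i. i \<in> I \<Longrightarrow> v i \<noteq> 0 \<Longrightarrow> x i = y i"
  shows "lmon I x u = lmon I y v"
  unfolding lmon_def
proof (rule prod.cong)
  fix i assume "i \<in> I"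
  with assms[of i] show "x i powi u i = y i powi v i" by (cases "v i = 0") simp_all
qed simp

lemma lmon_powi: "lmon I x u powi n = lmon I x (\<lambda>i. n * u i)"
proof (cases "finite I")
  case True
  then show ?thesis unfolding lmon_def
    by (induction I) (auto simp: power_int_mult_distrib power_int_mult[symmetric] mult.commute)
qed (simp add: lmon_def)

text \<open>Algebraic independence, tested one variable at a time over the Laurent ring of the
  others; in this form a mutation can be followed through the one-variable lemmas.\<close>

definition indep :: "nat set \<Rightarrow> (nat \<Rightarrow> 'f::field) \<Rightarrow> bool" where
  "indep I x \<longleftrightarrow> (\<forall>j\<in>I. transc (laur (I - {j}) x) (x j))"

lemma indepD: "indep I x \<Longrightarrow> j \<in> I \<Longrightarrow> transc (laur (I - {j}) x) (x j)"
  by (simp add: indep_def)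

lemma indep_nonzero: "indep I x \<Longrightarrow> j \<in> I \<Longrightarrow> x j \<noteq> 0"
  using transc_nonzero[OF indepD] by blast

text \<open>For \<open>j\<close> other than \<open>k\<close>, the new variable is known to be
  transcendental over a ring that contains \<open>x j\<close>, whereas \<open>x j\<close> has to be
  transcendental over a ring that contains the new variable; \<open>transc_swap\<close> exchanges
  the two.\<close>

lemma indep_upd:
  assumes x: "indep I x" and k: "k \<in> I" and P: "P \<in> laur (I - {k}) x" "P \<noteq> 0"
  shows "indep I (x(k := P / x k))"
  unfolding indep_def
proof
  fix j assume j: "j \<in> I"
  let ?x = "x(k := P / x k)"
  have tk: "transc (laur (I - {k}) x) (P / x k)"
    by (rule transc_mutate[OF indepD[OF x k] sring_laur P])
  show "transc (laur (I - {j}) ?x) (?x j)"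
  proof (cases "j = k")
    case True
    then show ?thesis using tk by (simp add: laur_upd)
  next
    case False
    define R where "R = laur (I - {j} - {k}) x"
    have R: "sring R" by (simp add: R_def)
    have t0: "P / x k \<noteq> 0" using P indep_nonzero[OF x k] by simp
    have "laur (I - {k}) x = lsums (laur (I - {k} - {j}) x) (x j)"
      by (rule laur_split) (use j False indep_nonzero[OF x j] in auto)
    also have "I - {k} - {j} = I - {j} - {k}" by auto
    finally have split: "laur (I - {k}) x = lsums R (x j)" by (simp add: R_def)
    have "transc R (x j)"
      unfolding R_def by (rule transc_mono[OF indepD[OF x j]]) (rule laur_mono, auto)
    then have "transc (lsums R (P / x k)) (x j)"
      by (rule transc_swap[OF _ _ R]) (use tk split in simp)
    also have "lsums R (P / x k) = laur (I - {j}) ?x"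
      using laur_split[of k "I - {j}" ?x] k False t0 by (simp add: R_def laur_upd)
    finally show ?thesis using False by simp
  qed
qed

text \<open>Compared in powers of \<open>x l\<close>, the monomial has the nonzero degree
  \<open>u l\<close>, and 1 has degree 0.\<close>

lemma lmon_ne_unit:
  assumes x: "indep I x" and I: "finite I" and l: "l \<in> I" "u l \<noteq> 0" and c: "c = 1 \<or> c = - 1"
  shows "c * lmon I x u \<noteq> 1"
proof
  assume eq: "c * lmon I x u = 1"
  let ?m = "c * lmon (I - {l}) x u"
  have m: "?m \<in> laur (I - {l}) x"
    using c lmon_in_laur[of "I - {l}" "I - {l}" x u] sring_uminus[OF sring_laur, of "lmon (I - {l}) x u" "I - {l}" x]
    by auto
  have eq0: "(\<Sum>r\<in>{0, u l}. (if r = 0 then - 1 else ?m) * x l powi r) = 0"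
    using l eq lmon_split[OF I l(1), of x u] by (simp add: mult_ac)
  have "(if r = 0 then - 1 else ?m) \<in> laur (I - {l}) x" for r :: int
    using m sring_uminus[OF sring_laur sring_one[OF sring_laur], of "I - {l}" x] by simp
  from transcD[OF indepD[OF x l(1)] _ this eq0, of 0] show False by simp
qed

text \<open>\<open>1 - y\<close> divides \<open>1 - y powi n\<close>; for negative \<open>n\<close>
  the quotient picks up a sign and a power of the unit \<open>inverse y\<close>.\<close>

lemma one_minus_powi_mem:
  assumes L: "sring L" and y: "y \<in> L" "inverse y \<in> L" and f: "(1 - y) * f \<in> L"
  shows "(1 - y powi n) * f \<in> L"
proof -
  have pos: "(1 - y ^ m) * f \<in> L" for m
  proof -
    have "(\<Sum>i<m. y ^ i) * ((1 - y) * f) \<in> L" by (intro sring_intros L y f)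
    also have "(\<Sum>i<m. y ^ i) * ((1 - y) * f) = (1 - y ^ m) * f"
      by (simp add: one_diff_power_eq mult_ac)
    finally show ?thesis .
  qed
  show ?thesis
  proof (cases "n \<ge> 0")
    case True
    then show ?thesis using pos[of "nat n"] by (simp add: power_int_def)
  next
    case False
    show ?thesis
    proof (cases "y = 0")
      case True
      then show ?thesis using False f by (simp add: power_int_def power_0_left)
    next
      case y0: False
      have "- (inverse y ^ nat (- n)) * ((1 - y ^ nat (- n)) * f) \<in> L"
        by (intro sring_mult sring_uminus sring_power L y pos)
      also have "- (inverse y ^ nat (- n)) * ((1 - y ^ nat (- n)) * f) = (1 - y powi n) * f"
        using False y0 by (simp add: power_int_def field_simps)
      finally show ?thesis .
    qed
  qed
qed

lemma minus_one_powi: "(- 1 :: 'f::field) powi n = 1 \<or> (- 1 :: 'f) powi n = - 1"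
  by (cases "even n") auto

text \<open>Two binomials whose exponent vectors are linearly independent have no common factor:
  modulo the first one, the second one divides a nonzero element which does not involve \<open>x l\<close>.\<close>
lemma coprimal_binomials:
  assumes x: "indep I x" and I: "finite I" and l: "l \<in> I" "u l \<noteq> 0"
    and l': "l' \<in> I" "u l * v l' - v l * u l' \<noteq> 0"
  shows "coprimal (laur I x) (1 + lmon I x u) (1 + lmon I x v)"
  unfolding coprimal_def
proof (intro allI impI)
  fix f assume f: "(1 + lmon I x u) * f \<in> laur I x" "(1 + lmon I x v) * f \<in> laur I x"
  let ?L = "laur I x" and ?R = "laur (I - {l}) x"
  \<comment> \<open>With the sign absorbed, the binomials read \<open>1 - y\<close> and
    \<open>1 - z\<close>: modulo both of them, every product of powers of \<open>y\<close> and
    \<open>z\<close> is 1.\<close>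
  define y z where "y = (- 1) * lmon I x u" and "z = (- 1) * lmon I x v"
  \<comment> \<open>The combination of the exponent vectors whose entry at \<open>l\<close> cancels;
    by the assumption on the minor it is nonzero at \<open>l'\<close>.\<close>
  define w where "w = (\<lambda>i. u l * v i - v l * u i)"
  define s where "s = (- 1 :: 'a) powi (u l) * (- 1) powi (- v l)"
  have nz: "\<And>i. i \<in> I \<Longrightarrow> x i \<noteq> 0" using indep_nonzero[OF x] .
  have s: "s = 1 \<or> s = - 1"
    using minus_one_powi[of "u l", where 'f = 'a] minus_one_powi[of "- v l", where 'f = 'a]
    unfolding s_def by auto
  have lmon_L: "lmon I x u' \<in> ?L" for u' by (rule lmon_in_laur) simp
  have yz: "y \<in> ?L" "inverse y \<in> ?L" "z \<in> ?L" "inverse z \<in> ?L"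
    unfolding y_def z_def by (simp_all add: inverse_lmon inverse_mult_distrib sring_uminus lmon_L)
  have "z powi u l * y powi (- v l) = s * (lmon I x v powi u l * lmon I x u powi (- v l))"
    unfolding y_def z_def s_def power_int_mult_distrib by (simp only: mult_ac)
  also have "lmon I x v powi u l * lmon I x u powi (- v l) = lmon I x w"
    unfolding lmon_powi by (subst lmon_add[symmetric]) (simp_all add: nz w_def)
  finally have zy: "z powi u l * y powi (- v l) = s * lmon I x w" .
  have fy: "(1 - y) * f \<in> ?L" and fz: "(1 - z) * f \<in> ?L"
    using f by (simp_all add: y_def z_def)
  \<comment> \<open>\<open>1 - a * b = (1 - a) + a * (1 - b)\<close>, with \<open>a\<close> the
    power of \<open>z\<close> and \<open>b\<close> the power of \<open>y\<close>.\<close>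
  have "(1 - z powi u l) * f + z powi u l * ((1 - y powi (- v l)) * f) \<in> ?L"
    by (intro sring_add sring_mult sring_laur one_minus_powi_mem sring_powi yz fy fz)
  also have "(1 - z powi u l) * f + z powi u l * ((1 - y powi (- v l)) * f)
      = (1 - z powi u l * y powi (- v l)) * f" by (simp add: algebra_simps)
  finally have c_f: "(1 - s * lmon I x w) * f \<in> ?L" unfolding zy .
  have c0: "1 - s * lmon I x w \<noteq> 0"
    using lmon_ne_unit[OF x I l'(1) _ s, of w] l'(2) by (simp add: w_def)
  have "lmon I x w = lmon (I - {l}) x w"
    using lmon_split[OF I l(1), of x w] by (simp add: w_def)
  then have w_R: "lmon I x w \<in> ?R"
    using lmon_in_laur[of "I - {l}" "I - {l}" x w] by simp
  have cR: "1 - s * lmon I x w \<in> ?R"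
    using s sring_diff[OF sring_laur sring_one[OF sring_laur] w_R]
      sring_add[OF sring_laur sring_one[OF sring_laur] w_R] by (elim disjE) simp_all
  have L: "?L = lsums ?R (x l)" by (rule laur_split) (use l nz in auto)
  have p: "1 + lmon I x u = 1 + lmon (I - {l}) x u * x l powi u l"
    using lmon_split[OF I l(1), of x u] by (simp add: mult.commute)
  show "f \<in> ?L" unfolding L
  proof (rule coprimal_const[where m = "lmon (I - {l}) x u" and d = "u l" and c = "1 - s * lmon I x w",
        OF indepD[OF x l(1)] sring_laur])
    show "lmon (I - {l}) x u \<in> ?R" "inverse (lmon (I - {l}) x u) \<in> ?R"
      by (simp_all add: inverse_lmon lmon_in_laur)
    show "lmon (I - {l}) x u \<noteq> 0" by (rule lmon_nonzero) (use nz in auto)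
    show "(1 + lmon (I - {l}) x u * x l powi u l) * f \<in> lsums ?R (x l)"
      using f(1) unfolding p L .
    show "(1 - s * lmon I x w) * f \<in> lsums ?R (x l)" using c_f unfolding L .
    show "u l \<noteq> 0" by (rule l)
    show "1 - s * lmon I x w \<in> ?R" "1 - s * lmon I x w \<noteq> 0" by (rule cR, rule c0)
  qed
qed

subsection \<open>Mutation\<close>

definition epoly :: "nat \<Rightarrow> exchange_matrix \<Rightarrow> nat \<Rightarrow> (nat \<Rightarrow> 'f::field) \<Rightarrow> 'f" where
  "epoly N B k x = (\<Prod>i<N. x i ^ nat (max (B i k) 0)) + (\<Prod>i<N. x i ^ nat (max (- B i k) 0))"

lemma mutate_cluster_eq: "mutate_cluster N k B x = x(k := epoly N B k x / x k)"
  by (simp add: mutate_cluster_def epoly_def)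

lemma epoly_mem:
  assumes A: "sring A" and x: "\<And>i. i < N \<Longrightarrow> B i k \<noteq> 0 \<Longrightarrow> x i \<in> A"
  shows "epoly N B k x \<in> A"
proof -
  have "x i ^ nat (max (B i k) 0) \<in> A" "x i ^ nat (max (- B i k) 0) \<in> A" if "i < N" for i
    using x[OF that] A by (cases "B i k = 0"; simp add: sring_one sring_power)+
  then show ?thesis unfolding epoly_def by (intro sring_add sring_prod A) auto
qed

lemma epoly_cong:
  assumes "\<And>i. i < N \<Longrightarrow> B i k \<noteq> 0 \<Longrightarrow> x i = y i" "\<And>i. i < N \<Longrightarrow> B i k = C i k"
  shows "epoly N B k x = epoly N C k y"
proof -
  have "x i ^ nat (max (B i k) 0) = y i ^ nat (max (C i k) 0)"
    "x i ^ nat (max (- B i k) 0) = y i ^ nat (max (- C i k) 0)" if "i < N" for i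
    using assms(1)[OF that] assms(2)[OF that] by (cases "B i k = 0"; simp)+
  then show ?thesis unfolding epoly_def by simp
qed

lemma epoly_uminus: "epoly N (\<lambda>i j. - B i j) k x = epoly N B k x"
  by (simp add: epoly_def)

lemma power_eq_lmon: "(\<Prod>i\<in>I. x i ^ nat (max (u i) 0)) = lmon I x (\<lambda>i. max (u i) 0)"
  unfolding lmon_def by (rule prod.cong) (auto simp: power_int_def)

lemma epoly_lmon:
  "epoly N B k x = lmon {..<N} x (\<lambda>i. max (B i k) 0) + lmon {..<N} x (\<lambda>i. max (- B i k) 0)"
  unfolding epoly_def power_eq_lmon[symmetric] ..

text \<open>Up to a monomial, which is a unit of the Laurent ring, the exchange polynomial is 1 plus
  the monomial of column \<open>k\<close>; this is the form to which
  \<open>coprimal_binomials\<close> applies.\<close>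

lemma epoly_factor:
  assumes "\<And>i. i < N \<Longrightarrow> x i \<noteq> 0"
  shows "epoly N B k x = lmon {..<N} x (\<lambda>i. max (- B i k) 0) * (1 + lmon {..<N} x (\<lambda>i. B i k))"
proof -
  have "lmon {..<N} x (\<lambda>i. max (B i k) 0) = lmon {..<N} x (\<lambda>i. max (- B i k) 0 + B i k)"
    by (rule lmon_cong) auto
  also have "\<dots> = lmon {..<N} x (\<lambda>i. max (- B i k) 0) * lmon {..<N} x (\<lambda>i. B i k)"
    by (rule lmon_add) (use assms in auto)
  finally show ?thesis by (simp add: epoly_lmon algebra_simps)
qed

text \<open>Linear independence of the columns over the rationals; by clearing denominators it can
  be tested on integer vectors.\<close>

definition colindep :: "nat \<Rightarrow> nat set \<Rightarrow> exchange_matrix \<Rightarrow> bool" where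
  "colindep N S B \<longleftrightarrow>
     (\<forall>c. (\<forall>i<N. (\<Sum>j\<in>S. B i j * c j) = 0) \<longrightarrow> (\<forall>j\<in>S. c j = 0))"

definition valid :: "nat \<Rightarrow> nat set \<Rightarrow> 'f::field seed \<Rightarrow> bool" where
  "valid N S s \<longleftrightarrow> ext_exchange_matrix N S (snd s) \<and> indep {..<N} (fst s) \<and> colindep N S (snd s)"

lemma colindepD:
  "colindep N S B \<Longrightarrow> (\<And>i. i < N \<Longrightarrow> (\<Sum>j\<in>S. B i j * c j) = 0) \<Longrightarrow> j \<in> S \<Longrightarrow> c j = 0"
  unfolding colindep_def by blast

lemma colindep_subset:
  assumes "colindep N S B" "T \<subseteq> S" "finite S"
  shows "colindep N T B"
  unfolding colindep_def
proof (intro allI impI)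
  fix c assume c: "\<forall>i<N. (\<Sum>j\<in>T. B i j * c j) = 0"
  define c' where "c' = (\<lambda>j. if j \<in> T then c j else 0)"
  have "(\<Sum>j\<in>S. B i j * c' j) = (\<Sum>j\<in>T. B i j * c j)" for i
    by (rule sum.mono_neutral_cong_right) (use assms in \<open>auto simp: c'_def\<close>)
  with c have "(\<Sum>j\<in>S. B i j * c' j) = 0" if "i < N" for i using that by simp
  then have "\<forall>j\<in>S. c' j = 0" using colindepD[OF assms(1)] by blast
  show "\<forall>j\<in>T. c j = 0"
  proof
    fix j assume "j \<in> T"
    then have "c' j = 0" using \<open>\<forall>j\<in>S. c' j = 0\<close> assms(2) by blast
    moreover have "c' j = c j" using \<open>j \<in> T\<close> by (simp add: c'_def)
    ultimately show "c j = 0" by simp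
  qed
qed

text \<open>If all minors through the pivot row \<open>l\<close> vanished, \<open>B l k\<close>
  times column \<open>j\<close> would equal \<open>B l j\<close> times column \<open>k\<close>, a
  nontrivial relation.\<close>

lemma colindep_minor:
  assumes B: "colindep N S B" and S: "finite S" and jk: "j \<in> S" "k \<in> S" "j \<noteq> k"
  obtains l l' where "l < N" "B l k \<noteq> 0" "l' < N" "B l k * B l' j - B l j * B l' k \<noteq> 0"
proof -
  have 2: "colindep N {j, k} B" using colindep_subset[OF B _ S, of "{j, k}"] jk by simp
  have "\<exists>l<N. B l k \<noteq> 0"
  proof (rule ccontr)
    assume "\<not> ?thesis"
    then have "(\<Sum>i'\<in>{j, k}. B i i' * (if i' = k then 1 else 0)) = 0" if "i < N" for i
      using jk that by simp
    from colindepD[OF 2 this, of k] show False by simp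
  qed
  then obtain l where l: "l < N" "B l k \<noteq> 0" by blast
  have "\<exists>l'<N. B l k * B l' j - B l j * B l' k \<noteq> 0"
  proof (rule ccontr)
    assume "\<not> ?thesis"
    then have "(\<Sum>i'\<in>{j, k}. B i i' * (if i' = k then - B l j else B l k)) = 0" if "i < N" for i
      using jk that by (simp add: mult.commute)
    from colindepD[OF 2 this, of j] jk l show False by simp
  qed
  with l that show thesis by blast
qed

text \<open>In this asymmetric form, mutation adds a multiple of row \<open>k\<close> and a multiple
  of column \<open>k\<close>, so that linear relations can be followed through it.\<close>

lemma mutate_matrix_alt:
  "i \<noteq> k \<Longrightarrow> j \<noteq> k \<Longrightarrow> mutate_matrix k B i j = B i j + max (B i k) 0 * B k j + B i k * max (- B k j) 0"
  by (simp add: mutate_matrix_def max_def min_def algebra_simps)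

lemma mutate_matrix_k: "mutate_matrix k B k j = - B k j" "mutate_matrix k B i k = - B i k"
  by (simp_all add: mutate_matrix_def)

lemma mutate_matrix_uminus: "mutate_matrix k (\<lambda>i j. - B i j) = (\<lambda>i j. - mutate_matrix k B i j)"
  by (intro ext) (simp add: mutate_matrix_def max_def min_def)

lemma mutate_matrix_twice: "mutate_matrix k (mutate_matrix k B) = B"
  by (intro ext) (auto simp: mutate_matrix_def max_def min_def)

lemma ext_exchange_mutate:
  assumes "ext_exchange_matrix N S B" "k \<in> S"
  shows "ext_exchange_matrix N S (mutate_matrix k B)"
proof -
  have "mutate_matrix k B i j = - mutate_matrix k B j i" if "i \<in> S" "j \<in> S" for i j
  proof -
    have "B i j = - B j i" "B i k = - B k i" "B j k = - B k j"
      using assms that unfolding ext_exchange_matrix_def by blast+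
    then show ?thesis by (auto simp: mutate_matrix_def max_def min_def)
  qed
  with assms show ?thesis unfolding ext_exchange_matrix_def by blast
qed

lemma colindep_mutate:
  assumes B: "ext_exchange_matrix N S B" "colindep N S B" and k: "k \<in> S"
  shows "colindep N S (mutate_matrix k B)"
  unfolding colindep_def
proof (intro allI impI)
  let ?B = "mutate_matrix k B"
  fix c assume c: "\<forall>i<N. (\<Sum>j\<in>S. ?B i j * c j) = 0"
  have S: "S \<subseteq> {..<N}" "\<forall>i\<in>S. \<forall>j\<in>S. B i j = - B j i"
    using B unfolding ext_exchange_matrix_def by blast+
  have fin: "finite S" using S(1) by (rule finite_subset) simp
  have kN: "k < N" using S(1) k by blast
  have "B k k = - B k k" using S(2) k by blast
  then have Bkk: "B k k = 0" by simp
  have split: "(\<Sum>j\<in>S. f j) = f k + (\<Sum>j\<in>S - {k}. f j)" for f :: "nat \<Rightarrow> int"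
    by (rule sum.remove[OF fin k])
  \<comment> \<open>\<open>d\<close> is the relation \<open>c\<close> carried back through the
    column operation; by \<open>row_k\<close> the contribution of the row operation is zero.\<close>
  define d where "d = (\<lambda>j. if j = k then (\<Sum>j\<in>S - {k}. max (- B k j) 0 * c j) - c k else c j)"
  have row_k: "(\<Sum>j\<in>S - {k}. B k j * c j) = 0"
    using c[rule_format, OF kN] by (simp add: split mutate_matrix_k Bkk sum_negf)
  have d0: "(\<Sum>j\<in>S. B i j * d j) = 0" if i: "i < N" for i
  proof (cases "i = k")
    case True
    then show ?thesis using row_k by (simp add: split Bkk d_def)
  next
    case False
    have "(\<Sum>j\<in>S - {k}. ?B i j * c j)
        = (\<Sum>j\<in>S - {k}. B i j * c j + max (B i k) 0 * (B k j * c j) + B i k * (max (- B k j) 0 * c j))"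
      by (rule sum.cong) (use False in \<open>auto simp: mutate_matrix_alt algebra_simps\<close>)
    also have "\<dots> = (\<Sum>j\<in>S - {k}. B i j * c j) + B i k * (\<Sum>j\<in>S - {k}. max (- B k j) 0 * c j)"
      by (simp add: sum.distrib sum_distrib_left[symmetric] row_k)
    finally have "(\<Sum>j\<in>S. ?B i j * c j) = (\<Sum>j\<in>S - {k}. B i j * c j) + B i k * d k"
      by (simp add: split mutate_matrix_k d_def algebra_simps)
    also have "\<dots> = (\<Sum>j\<in>S. B i j * d j)"
      by (simp add: split) (simp add: d_def)
    finally show ?thesis using c i by simp
  qed
  have d: "\<forall>j\<in>S. d j = 0" using colindepD[OF B(2) d0] by blast
  then have 0: "c j = 0" if "j \<in> S - {k}" for j using that by (auto simp: d_def split: if_splits)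
  show "\<forall>j\<in>S. c j = 0"
  proof
    fix j assume "j \<in> S"
    show "c j = 0"
    proof (cases "j = k")
      case True
      have "d k = 0" using d k by blast
      with 0 True show ?thesis by (simp add: d_def)
    qed (use 0 \<open>j \<in> S\<close> in auto)
  qed
qed

lemma valid_simps:
  assumes "valid N S (x, B)"
  shows "S \<subseteq> {..<N}" "finite S" "indep {..<N} x" "colindep N S B" "ext_exchange_matrix N S B"
    "i \<in> S \<Longrightarrow> B i i = 0" "i \<in> S \<Longrightarrow> j \<in> S \<Longrightarrow> B i j = - B j i" "i < N \<Longrightarrow> x i \<noteq> 0"
proof -
  show 1: "S \<subseteq> {..<N}" and 2: "indep {..<N} x" "colindep N S B" "ext_exchange_matrix N S B"
    using assms by (simp_all add: valid_def) (simp add: ext_exchange_matrix_def)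
  show "finite S" using 1 by (rule finite_subset) simp
  show 3: "B i j = - B j i" if "i \<in> S" "j \<in> S" for i j
    using 2(3) that unfolding ext_exchange_matrix_def by blast
  show "B i i = 0" if "i \<in> S" using 3[OF that that] by simp
  show "x i \<noteq> 0" if "i < N" using indep_nonzero[OF 2(1)] that by simp
qed

lemma valid_epoly:
  assumes v: "valid N S (x, B)" and k: "k \<in> S"
  shows "epoly N B k x \<in> laur ({..<N} - {k}) x" "epoly N B k x \<noteq> 0"
proof -
  note vs = valid_simps[OF v]
  show "epoly N B k x \<in> laur ({..<N} - {k}) x"
    by (rule epoly_mem) (use vs(6)[OF k] in \<open>auto intro!: laur_base\<close>)
  have "\<exists>l<N. B l k \<noteq> 0"
  proof (rule ccontr)
    assume "\<not> ?thesis"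
    then have "(\<Sum>j\<in>S. B i j * (if j = k then 1 else 0)) = 0" if "i < N" for i
      using k vs(2) that by (simp add: if_distrib cong: if_cong)
    from colindepD[OF vs(4) this k] show False by simp
  qed
  then obtain l where l: "l < N" "B l k \<noteq> 0" by blast
  \<comment> \<open>The binomial vanishes only if the monomial equals -1, which its nonzero exponent
    at \<open>l\<close> excludes.\<close>
  have "1 + lmon {..<N} x (\<lambda>i. B i k) \<noteq> 0"
    using lmon_ne_unit[OF vs(3), of l "\<lambda>i. B i k" "- 1"] l by (simp add: minus_equation_iff add_eq_0_iff)
  then show "epoly N B k x \<noteq> 0"
    using lmon_nonzero[of "{..<N}" x] vs(8) by (simp add: epoly_factor)
qed

lemma valid_mutate:
  assumes v: "valid N S (x, B)" and k: "k \<in> S"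
  shows "valid N S (mutate_cluster N k B x, mutate_matrix k B)"
proof -
  note vs = valid_simps[OF v]
  have "indep {..<N} (mutate_cluster N k B x)"
    unfolding mutate_cluster_eq
    by (rule indep_upd[OF vs(3)]) (use valid_epoly[OF v k] k vs(1) in auto)
  then show ?thesis
    using ext_exchange_mutate[OF vs(5) k] colindep_mutate[OF vs(5,4) k] by (simp add: valid_def)
qed

lemma mutate_seed_twice:
  assumes v: "valid N S (x, B)" and k: "k \<in> S"
  shows "mutate_seed N k (mutate_seed N k (x, B)) = (x, B)"
proof -
  note vs = valid_simps[OF v]
  have "epoly N (mutate_matrix k B) k (x(k := epoly N B k x / x k)) = epoly N (\<lambda>i j. - B i j) k x"
    by (rule epoly_cong) (use vs(6)[OF k] in \<open>auto simp: mutate_matrix_k\<close>)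
  then have "mutate_cluster N k (mutate_matrix k B) (mutate_cluster N k B x) = x"
    using valid_epoly(2)[OF v k] vs(8)[of k] vs(1) k by (auto simp: mutate_cluster_eq epoly_uminus)
  then show ?thesis by (simp add: mutate_seed_def mutate_matrix_twice)
qed

subsection \<open>Upper bounds\<close>

text \<open>The upper bound of Berenstein, Fomin and Zelevinsky.\<close>
definition ubound :: "nat \<Rightarrow> nat set \<Rightarrow> 'f::field seed \<Rightarrow> 'f set" where
  "ubound N S s = laur {..<N} (fst s) \<inter> (\<Inter>k\<in>S. laur {..<N} (fst (mutate_seed N k s)))"

text \<open>Elements of both Laurent rings are polynomials in \<open>x j\<close> and
  \<open>P / x j\<close> over the Laurent ring of the other variables: in the negative part
  \<open>c r\<close> is divisible by the matching power of \<open>P\<close>, so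
  \<open>c r * x j powi r\<close> is a multiple of a power of \<open>P / x j\<close>.\<close>

lemma laur_Int_mutate:
  assumes x: "indep I x" and j: "j \<in> I" and P: "P \<in> laur (I - {j}) x" "P \<noteq> 0"
    and f: "f \<in> laur I x" "f \<in> laur I (x(j := P / x j))"
    and A: "sring A" "laur (I - {j}) x \<subseteq> A" "x j \<in> A" "P / x j \<in> A"
  shows "f \<in> A"
proof -
  let ?R = "laur (I - {j}) x"
  have x0: "x j \<noteq> 0" using indep_nonzero[OF x j] .
  from f(1) have "f \<in> lsums ?R (x j)" using laur_split[of j I x] j x0 by simp
  then obtain F c where F: "finite F" "\<forall>r\<in>F. c r \<in> ?R" "f = (\<Sum>r\<in>F. c r * x j powi r)"
    by (rule lsumsE)
  have "f \<in> lsums ?R (P / x j)"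
    using f(2) laur_split[of j I "x(j := P / x j)"] j x0 P by (simp add: laur_upd)
  note mem = this[unfolded F(3)]
  show ?thesis unfolding F(3)
  proof (rule sring_sum[OF A(1)])
    fix r assume r: "r \<in> F"
    show "c r * x j powi r \<in> A"
    proof (cases "r \<ge> 0")
      case True
      have "c r \<in> A" using F(2) r A(2) by blast
      then have "c r * x j ^ nat r \<in> A" by (intro sring_mult[OF A(1)] sring_power[OF A(1)] A(3))
      then show ?thesis using True by (simp add: power_int_def)
    next
      case False
      have "c r / P ^ nat (- r) \<in> ?R"
        by (rule transc_mutate_coeff[OF indepD[OF x j] sring_laur P F(1) _ mem r]) (use F False in auto)
      with A(2) have "c r / P ^ nat (- r) \<in> A" by blast
      then have "c r / P ^ nat (- r) * (P / x j) ^ nat (- r) \<in> A"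
        by (intro sring_mult[OF A(1)] sring_power[OF A(1)] A(4))
      also have "c r / P ^ nat (- r) * (P / x j) ^ nat (- r) = c r * x j powi r"
        using False P x0 by (simp add: power_int_def field_simps)
      finally show ?thesis .
    qed
  qed
qed

lemma power_add_multiple:
  assumes A: "sring A" "a \<in> A" "c \<in> A" "y \<in> A"
  shows "\<exists>Q\<in>A. (a + y * c) ^ n = a ^ n + y * Q"
proof (induction n)
  case 0
  then show ?case using sring_zero[OF A(1)] by (intro bexI[of _ 0]) auto
next
  case (Suc n)
  then obtain Q where Q: "Q \<in> A" "(a + y * c) ^ n = a ^ n + y * Q" by blast
  have "a * Q + c * (a ^ n + y * Q) \<in> A" by (intro sring_add sring_mult sring_power A Q)
  moreover have "(a + y * c) ^ Suc n = a ^ Suc n + y * (a * Q + c * (a ^ n + y * Q))"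
    unfolding power_Suc Q(2) by (simp add: algebra_simps)
  ultimately show ?case by blast
qed

lemma coprimal_units:
  assumes A: "sring A" and c: "coprimal A p q" and u: "u \<noteq> 0" "inverse u \<in> A" and v: "v \<noteq> 0" "inverse v \<in> A"
  shows "coprimal A (u * p) (v * q)"
  unfolding coprimal_def
proof (intro allI impI)
  fix f assume f: "u * p * f \<in> A" "v * q * f \<in> A"
  have "inverse u * (u * p * f) \<in> A" "inverse v * (v * q * f) \<in> A"
    by (intro sring_mult[OF A] u v f)+
  then have "p * f \<in> A" "q * f \<in> A" using u v by (simp_all add: mult.assoc[symmetric])
  with c show "f \<in> A" unfolding coprimal_def by blast
qed

section \<open>The Laurent ring after two successive mutations\<close>

context
  fixes N S B k j and x :: "nat \<Rightarrow> 'f::field"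
  assumes v: "valid N S (x, B)" and k: "k \<in> S" and j: "j \<in> S" and jk: "j \<noteq> k"
begin

text \<open>\<open>x1\<close> is the cluster mutated at \<open>k\<close>, \<open>x2\<close> is
  \<open>x1\<close> mutated at \<open>j\<close>, and \<open>L\<close> is the Laurent ring of
  \<open>x2\<close>; \<open>xj'\<close> is the variable obtained by mutating \<open>x\<close> itself
  at \<open>j\<close>. Membership in \<open>L\<close> is what the upper bound at \<open>x1\<close>
  requires beyond the Laurent rings of \<open>x1\<close> and \<open>x\<close>.\<close>

private definition xk where "xk = epoly N B k x / x k"
private definition x1 where "x1 = x(k := xk)"
private definition B' where "B' = mutate_matrix k B"
private definition xj where "xj = epoly N B' j x1 / x j"
private definition x2 where "x2 = x1(j := xj)"
private definition L where "L = laur {..<N} x2"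
private definition xj' where "xj' = epoly N B j x / x j"

private lemma basics:
  "k < N" "j < N" "indep {..<N} x1" "indep {..<N} x2" "x k \<noteq> 0" "x j \<noteq> 0" "xk \<noteq> 0" "xj \<noteq> 0"
  "epoly N B' j x1 \<noteq> 0" "sring L"
proof -
  note vs = valid_simps[OF v]
  have v1: "valid N S (x1, B')"
    using valid_mutate[OF v k] by (simp add: x1_def xk_def B'_def mutate_cluster_eq)
  have v2: "valid N S (x2, mutate_matrix j B')"
    using valid_mutate[OF v1 j] jk by (simp add: x2_def xj_def mutate_cluster_eq x1_def)
  show kN: "k < N" and jN: "j < N" using vs(1) k j by auto
  show "indep {..<N} x1" "indep {..<N} x2" using valid_simps(3)[OF v1] valid_simps(3)[OF v2] .
  show "x k \<noteq> 0" "x j \<noteq> 0" using vs(8) kN jN by auto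
  show "xk \<noteq> 0" using valid_simps(8)[OF v1 kN] by (simp add: x1_def)
  show "xj \<noteq> 0" using valid_simps(8)[OF v2 jN] by (simp add: x2_def)
  show "epoly N B' j x1 \<noteq> 0" using valid_epoly(2)[OF v1 j] .
  show "sring L" by (simp add: L_def)
qed

private lemma skew: "B k k = 0" "B j j = 0" "B j k = - B k j"
  using valid_simps(6,7)[OF v] k j by blast+

private lemma x2_simps: "x2 k = xk" "x2 j = xj" "i \<noteq> k \<Longrightarrow> i \<noteq> j \<Longrightarrow> x2 i = x i"
  using jk by (auto simp: x2_def x1_def)

private lemma units:
  "xk \<in> L" "inverse xk \<in> L" "xj \<in> L" "inverse xj \<in> L"
  "i < N \<Longrightarrow> i \<noteq> k \<Longrightarrow> i \<noteq> j \<Longrightarrow> x i \<in> L" "i < N \<Longrightarrow> i \<noteq> k \<Longrightarrow> i \<noteq> j \<Longrightarrow> inverse (x i) \<in> L"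
proof -
  have 1: "i < N \<Longrightarrow> x2 i \<in> L" "i < N \<Longrightarrow> inverse (x2 i) \<in> L" for i
    by (auto simp: L_def intro: laur_base laur_inverse)
  show "xk \<in> L" "inverse xk \<in> L" using 1[of k] basics(1) by (simp_all add: x2_simps)
  show "xj \<in> L" "inverse xj \<in> L" using 1[of j] basics(2) by (simp_all add: x2_simps)
  show "i < N \<Longrightarrow> i \<noteq> k \<Longrightarrow> i \<noteq> j \<Longrightarrow> x i \<in> L" "i < N \<Longrightarrow> i \<noteq> k \<Longrightarrow> i \<noteq> j \<Longrightarrow> inverse (x i) \<in> L"
    using 1[of i] by (simp_all add: x2_simps)
qed

private lemma x1_units: "i < N \<Longrightarrow> i \<noteq> j \<Longrightarrow> x1 i \<in> L" "i < N \<Longrightarrow> i \<noteq> j \<Longrightarrow> inverse (x1 i) \<in> L"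
  using units by (cases "i = k"; simp add: x1_def)+

private lemma xj_mem: "x j \<in> L"
proof -
  have "epoly N B' j x1 \<in> L"
  proof (rule epoly_mem[OF basics(10)])
    fix i assume "i < N" "B' i j \<noteq> 0"
    moreover have "B' j j = 0" using skew jk by (auto simp: B'_def mutate_matrix_def max_def min_def)
    ultimately show "x1 i \<in> L" using x1_units by metis
  qed
  then have "epoly N B' j x1 * inverse xj \<in> L" by (intro sring_mult basics(10) units)
  also have "epoly N B' j x1 * inverse xj = x j" using basics by (simp add: xj_def)
  finally show ?thesis .
qed

text \<open>\<open>x1\<close> differs from \<open>x2\<close> only in its entry \<open>x j\<close>,
  which belongs to \<open>L\<close>.\<close>

private lemma loc_xj:
  assumes "f \<in> laur {..<N} x1"
  shows "f \<in> loc L (x j)"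
proof -
  have "laur {..<N} x1 \<subseteq> loc L (x j)"
  proof (rule laur_least[OF sring_loc[OF basics(10) xj_mem]])
    fix i assume i: "i \<in> {..<N}"
    have "x1 j = x j" using jk by (simp add: x1_def)
    then show "x1 i \<in> loc L (x j)" "inverse (x1 i) \<in> loc L (x j)"
      using x1_units[of i] i xj_mem inverse_in_loc[OF basics(10,6)] subset_loc[of L "x j"]
      by (cases "i = j"; auto)+
  qed
  with assms show ?thesis by blast
qed

text \<open>Here the two mutations commute. The cluster \<open>x\<close> with \<open>xj'\<close>
  then differs from \<open>x2\<close> only at \<open>k\<close>, so \<open>f\<close> has a power of
  \<open>x k\<close> as denominator, and by \<open>loc_xj\<close> also a power of
  \<open>x j\<close>. Up to units of \<open>L\<close> these two are the exchange binomials of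
  \<open>k\<close> and \<open>j\<close>, which are coprime by the independence of the
  columns.\<close>

private lemma commuting_case:
  assumes b: "B k j = 0" and f: "f \<in> laur {..<N} x1" "f \<in> laur {..<N} (x(j := xj'))"
  shows "f \<in> L"
proof -
  note vs = valid_simps[OF v]
  have nz2: "\<And>i. i < N \<Longrightarrow> x2 i \<noteq> 0" using indep_nonzero[OF basics(4)] by simp
  have bj: "B j k = 0" using skew b by simp
  have ej: "epoly N B' j x1 = epoly N B j x"
    by (rule epoly_cong)
      (use b jk in \<open>auto simp: x1_def B'_def mutate_matrix_def max_def min_def\<close>)
  have xj'_eq: "xj' = xj" by (simp add: xj_def xj'_def ej)
  have ek2: "epoly N B k x = epoly N B k x2"
    by (rule epoly_cong) (use bj skew in \<open>auto simp: x2_def x1_def\<close>)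
  have ej2: "epoly N B j x = epoly N B j x2"
    by (rule epoly_cong) (use b skew in \<open>auto simp: x2_def x1_def\<close>)
  have xk_eq: "x k = epoly N B k x2 * inverse xk"
    using basics by (simp add: xk_def ek2[symmetric])
  have xj_eq: "x j = epoly N B j x2 * inverse xj"
    using basics by (simp add: xj_def ej ej2[symmetric])
  have xkL: "x k \<in> L" unfolding xk_eq
    by (intro sring_mult basics(10) units epoly_mem) (auto simp: L_def intro: laur_base)
  have "laur {..<N} (x(j := xj')) \<subseteq> loc L (x k)"
  proof (rule laur_least[OF sring_loc[OF basics(10) xkL]])
    fix i assume i: "i \<in> {..<N}"
    show "(x(j := xj')) i \<in> loc L (x k)" "inverse ((x(j := xj')) i) \<in> loc L (x k)"
      using units(3,4) units(5,6)[of i] i xkL inverse_in_loc[OF basics(10,5)] subset_loc[of L "x k"] xj'_eq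
      by (cases "i = j"; cases "i = k"; auto)+
  qed
  with f have fk: "f \<in> loc L (x k)" by blast
  obtain l l' where l: "l < N" "B l k \<noteq> 0" "l' < N" "B l k * B l' j - B l j * B l' k \<noteq> 0"
    using colindep_minor[OF vs(4) vs(2) j k jk] .
  have c: "coprimal L (1 + lmon {..<N} x2 (\<lambda>i. B i k)) (1 + lmon {..<N} x2 (\<lambda>i. B i j))"
    unfolding L_def by (rule coprimal_binomials[OF basics(4), of l _ l']) (use l in auto)
  define u where "u = inverse xk * lmon {..<N} x2 (\<lambda>i. max (- B i k) 0)"
  define w where "w = inverse xj * lmon {..<N} x2 (\<lambda>i. max (- B i j) 0)"
  have "coprimal L (u * (1 + lmon {..<N} x2 (\<lambda>i. B i k))) (w * (1 + lmon {..<N} x2 (\<lambda>i. B i j)))"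
  proof (rule coprimal_units[OF basics(10) c])
    show "u \<noteq> 0" "w \<noteq> 0" using nz2 lmon_nonzero[of "{..<N}" x2] basics by (auto simp: u_def w_def)
    have "inverse (lmon {..<N} x2 g) \<in> L" for g unfolding inverse_lmon L_def by (rule lmon_in_laur) simp
    then show "inverse u \<in> L" "inverse w \<in> L"
      unfolding u_def w_def inverse_mult_distrib inverse_inverse_eq
      by (auto intro: sring_mult[OF basics(10)] units)
  qed
  also have "u * (1 + lmon {..<N} x2 (\<lambda>i. B i k)) = x k"
    using epoly_factor[of N x2 B k, OF nz2] by (simp add: xk_eq u_def)
  also have "w * (1 + lmon {..<N} x2 (\<lambda>i. B i j)) = x j"
    using epoly_factor[of N x2 B j, OF nz2] by (simp add: xj_eq w_def)
  finally show ?thesis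
    by (rule coprimal_loc[OF basics(10) xkL xj_mem _ fk loc_xj[OF f(1)]])
qed

private lemma lmon_split2:
  "lmon {..<N} y u = y k powi u k * (y j powi u j * lmon ({..<N} - {k} - {j}) y u)"
  using lmon_split[of "{..<N}" k y u] lmon_split[of "{..<N} - {k}" j y u] basics(1,2) jk by simp

text \<open>Here \<open>x k\<close> and \<open>x j\<close> are comaximal in \<open>L\<close>,
  because \<open>x k * xk\<close> is a unit plus a multiple of \<open>x j\<close>. For
  \<open>f\<close> to have a power of \<open>x k\<close> as denominator, \<open>xj'\<close> is shown
  to lie in \<open>L\<close>; then \<open>laur_Int_mutate\<close> writes \<open>f\<close> as a
  polynomial in \<open>x j\<close> and \<open>xj'\<close> over the remaining variables.\<close>

private lemma positive_case:
  assumes b: "B k j > 0" and f: "f \<in> laur {..<N} x" "f \<in> laur {..<N} x1" "f \<in> laur {..<N} (x(j := xj'))"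
  shows "f \<in> L"
proof -
  note vs = valid_simps[OF v]
  let ?I = "{..<N} - {k} - {j}"
  define Z where "Z = lmon ?I x"
  define b where "b = nat (B k j)"
  have b: "B k j = int b" "b > 0" "B j k = - int b" using assms(1) skew by (auto simp: b_def)
  have L: "sring L" by (rule basics(10))
  have Z_L: "Z u \<in> L" for u
    unfolding Z_def lmon_def by (intro sring_prod L sring_powi) (auto intro: units)
  have Z_inv: "inverse (Z u) \<in> L" for u
    using Z_L[of "\<lambda>i. - u i"] by (simp add: Z_def inverse_lmon)
  have nz: "\<And>i. i < N \<Longrightarrow> x i \<noteq> 0" using vs(8) .
  have Z0: "Z u \<noteq> 0" for u unfolding Z_def by (rule lmon_nonzero) (use nz in auto)
  have Zadd: "Z (\<lambda>i. u i + w i) = Z u * Z w" for u w unfolding Z_def by (rule lmon_add) (use nz in auto)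
  define p n a c a' c' where "p = (\<lambda>i. max (B i k) 0)" and "n = (\<lambda>i. max (- B i k) 0)"
    and "a = (\<lambda>i. max (B i j) 0)" and "c = (\<lambda>i. max (- B i j) 0)"
    and "a' = (\<lambda>i. max (B i j + p i * int b) 0)" and "c' = (\<lambda>i. max (- (B i j + p i * int b)) 0)"
  have ek: "epoly N B k x = Z p + x j ^ b * Z n"
    unfolding epoly_lmon lmon_split2 using b skew by (simp add: Z_def p_def n_def)
  have ej: "epoly N B j x = x k ^ b * Z a + Z c"
    unfolding epoly_lmon lmon_split2 using b skew by (simp add: Z_def a_def c_def)
  have Z1: "lmon ?I x1 u = Z u" for u
    unfolding Z_def by (rule lmon_cong) (auto simp: x1_def)
  have B': "B' k j = - int b" "B' j j = 0" "i \<noteq> k \<Longrightarrow> B' i j = B i j + p i * int b" for i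
    using b jk skew by (simp_all add: B'_def mutate_matrix_k mutate_matrix_alt p_def)
  have "lmon ?I x1 (\<lambda>i. max (B' i j) 0) = lmon ?I x1 a'" "lmon ?I x1 (\<lambda>i. max (- B' i j) 0) = lmon ?I x1 c'"
    by (rule lmon_cong; simp add: B' a'_def c'_def)+
  then have ej': "epoly N B' j x1 = Z a' + xk ^ b * Z c'"
    unfolding epoly_lmon lmon_split2 using B'(1,2) by (simp add: Z1) (simp add: x1_def)
  \<comment> \<open>The exponents agree since \<open>max y 0 - max (- y) 0 = y\<close>, both for
    \<open>y = B i j\<close> and for \<open>y = B i j + p i * int b\<close>.\<close>
  have "Z a' * Z c = Z (\<lambda>i. a' i + c i)" by (simp add: Zadd)
  also have "(\<lambda>i. a' i + c i) = (\<lambda>i. (a i + c' i) + int b * p i)"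
    by (auto simp: a'_def c_def a_def c'_def max_def algebra_simps)
  also have "Z \<dots> = Z a * Z c' * Z p ^ b"
    unfolding Zadd using lmon_powi[of ?I x p "int b"] by (simp add: Z_def)
  finally have rel: "Z a' * Z c = Z a * Z c' * Z p ^ b" .
  have xkxk: "x k * xk = Z p + x j ^ b * Z n"
    using basics(5) by (simp add: xk_def ek)
  have xj_pow: "x j ^ b = x j * x j ^ (b - 1)" using b by (simp add: power_eq_if)
  have xkL: "x k \<in> L"
  proof -
    have "(Z p + x j ^ b * Z n) * inverse xk \<in> L"
      by (intro sring_intros L Z_L xj_mem units)
    then show ?thesis using xkxk basics(7) by (simp add: divide_simps split: if_splits)
        (metis mult.commute nonzero_mult_div_cancel_left field_class.field_divide_inverse)
  qed
  \<comment> \<open>Modulo \<open>x j\<close> the product \<open>x k * xk\<close> is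
    \<open>Z p\<close>. Inserted in the exchange relation of \<open>xj\<close>, this allows a
    division by \<open>x j\<close> and expresses \<open>xj'\<close> through elements of
    \<open>L\<close>.\<close>
  obtain Q where Q: "Q \<in> L" "(Z p + x j * (x j ^ (b - 1) * Z n)) ^ b = Z p ^ b + x j * Q"
    using power_add_multiple[of L "Z p" "x j ^ (b - 1) * Z n" "x j" b]
    by (metis L Z_L sring_mult sring_power xj_mem)
  have "x k ^ b * epoly N B' j x1 * Z c = x k ^ b * (Z a' * Z c) + (x k * xk) ^ b * Z c' * Z c"
    by (simp add: ej' algebra_simps power_mult_distrib)
  also have "\<dots> = Z c' * (Z p ^ b * epoly N B j x + x j * Q * Z c)"
    unfolding rel xkxk xj_pow mult.assoc[of "x j"] Q(2) ej by (simp add: algebra_simps)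
  finally have "x k ^ b * xj * Z c = Z c' * (Z p ^ b * xj' + Q * Z c)"
    using basics(6) by (simp add: xj_def xj'_def field_simps)
  then have "xj' = (x k ^ b * xj * Z c * inverse (Z c') - Q * Z c) * inverse (Z p) ^ b"
    using Z0 by (simp add: field_simps)
  also have "\<dots> \<in> L" by (intro sring_mult sring_diff sring_power L xkL units Z_L Z_inv Q(1))
  finally have xj'L: "xj' \<in> L" .
  have Lk: "sring (loc L (x k))" by (rule sring_loc[OF L xkL])
  have fk: "f \<in> loc L (x k)"
  proof (rule laur_Int_mutate[OF vs(3) _ valid_epoly[OF v j] f(1)])
    show "f \<in> laur {..<N} (x(j := epoly N B j x / x j))" using f(3) by (simp add: xj'_def)
    show "laur ({..<N} - {j}) x \<subseteq> loc L (x k)"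
    proof (rule laur_least[OF Lk])
      fix i assume i: "i \<in> {..<N} - {j}"
      show "x i \<in> loc L (x k)" "inverse (x i) \<in> loc L (x k)"
        using units(5,6)[of i] i xkL inverse_in_loc[OF L basics(5)] subset_loc[of L "x k"]
        by (cases "i = k"; auto)+
    qed
    show "x j \<in> loc L (x k)" "epoly N B j x / x j \<in> loc L (x k)"
      using subset_loc[of L "x k"] xj_mem xj'L by (auto simp: xj'_def)
  qed (use basics Lk in auto)
  have "coprimal L (x k) (x j)"
  proof (rule coprimal_comaximal[OF L])
    show "inverse (Z p) * xk \<in> L" "- (inverse (Z p) * x j ^ (b - 1) * Z n) \<in> L"
      by (intro sring_mult sring_uminus sring_power L units Z_inv Z_L xj_mem)+
    have "inverse (Z p) * xk * x k + - (inverse (Z p) * x j ^ (b - 1) * Z n) * x j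
        = inverse (Z p) * (x k * xk - x j ^ b * Z n)"
      unfolding xj_pow by (simp add: algebra_simps)
    also have "\<dots> = 1" unfolding xkxk using Z0 by simp
    finally show "inverse (Z p) * xk * x k + - (inverse (Z p) * x j ^ (b - 1) * Z n) * x j = 1" .
  qed
  then show ?thesis
    by (rule coprimal_loc[OF L xkL xj_mem _ fk loc_xj[OF f(2)]])
qed

lemma laur_mutate_twice_aux:
  assumes b: "B k j \<ge> 0"
    and f: "f \<in> laur {..<N} x" "f \<in> laur {..<N} (mutate_cluster N k B x)"
      "f \<in> laur {..<N} (mutate_cluster N j B x)"
  shows "f \<in> laur {..<N} (mutate_cluster N j (mutate_matrix k B) (mutate_cluster N k B x))"
proof -
  have "f \<in> laur {..<N} x1" "f \<in> laur {..<N} (x(j := xj'))"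
    using f by (simp_all add: mutate_cluster_eq x1_def xk_def xj'_def)
  then have "f \<in> L" using f(1) b commuting_case positive_case by (cases "B k j = 0") auto
  then show ?thesis
    using jk by (simp add: L_def x2_def xj_def x1_def xk_def B'_def mutate_cluster_eq)
qed

end

text \<open>Reversing all arrows changes no exchange polynomial; this reduces negative
  \<open>B k j\<close> to the positive case.\<close>

lemma valid_uminus:
  assumes v: "valid N S (x, B)"
  shows "valid N S (x, \<lambda>i j. - B i j)"
proof -
  have "ext_exchange_matrix N S (\<lambda>i j. - B i j)"
    unfolding ext_exchange_matrix_def
  proof (intro conjI ballI)
    fix i j assume "i \<in> S" "j \<in> S"
    then have "B i j = - B j i" by (rule valid_simps(7)[OF v])
    then show "- B i j = - (- B j i)" by (rule arg_cong[where f = uminus])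
  qed (rule valid_simps(1)[OF v])
  moreover have "colindep N S (\<lambda>i j. - B i j)"
    using valid_simps(4)[OF v]
    unfolding colindep_def mult_minus_left sum_negf neg_equal_0_iff_equal .
  ultimately show ?thesis using valid_simps(3)[OF v] by (simp add: valid_def)
qed

lemma laur_mutate_twice:
  assumes v: "valid N S (x, B)" and k: "k \<in> S" and j: "j \<in> S"
    and f: "f \<in> laur {..<N} x" "f \<in> laur {..<N} (mutate_cluster N k B x)"
      "f \<in> laur {..<N} (mutate_cluster N j B x)"
  shows "f \<in> laur {..<N} (mutate_cluster N j (mutate_matrix k B) (mutate_cluster N k B x))"
proof (cases "j = k")
  case True
  then show ?thesis using mutate_seed_twice[OF v k] f(1) by (simp add: mutate_seed_def)
next
  case jk: False
  show ?thesis
  proof (cases "B k j \<ge> 0")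
    case True
    then show ?thesis by (rule laur_mutate_twice_aux[OF v k j jk _ f])
  next
    case False
    have eq: "mutate_cluster N i (\<lambda>i j. - C i j) y = mutate_cluster N i C y" for i C and y :: "nat \<Rightarrow> 'a"
      by (simp add: mutate_cluster_eq epoly_uminus)
    show ?thesis
      using laur_mutate_twice_aux[OF valid_uminus[OF v] k j jk, of f] False f
      by (simp add: eq mutate_matrix_uminus)
  qed
qed

text \<open>The upper bound of the mutated seed asks for the mutated cluster and for those reached
  by a second mutation; the latter are the content of \<open>laur_mutate_twice\<close>.\<close>

lemma ubound_mutate_subset:
  assumes v: "valid N S s" and k: "k \<in> S"
  shows "ubound N S s \<subseteq> ubound N S (mutate_seed N k s)"
proof -
  obtain x B where s: "s = (x, B)" by (cases s)
  show ?thesis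
    using laur_mutate_twice[OF v[unfolded s] k] k
    unfolding ubound_def s by (auto simp: mutate_seed_def)
qed

lemma ubound_mutate:
  assumes v: "valid N S s" and k: "k \<in> S"
  shows "ubound N S (mutate_seed N k s) = ubound N S s"
proof
  obtain x B where s: "s = (x, B)" by (cases s)
  have v': "valid N S (mutate_seed N k s)"
    using valid_mutate[OF v[unfolded s] k] by (simp add: s mutate_seed_def)
  show "ubound N S (mutate_seed N k s) \<subseteq> ubound N S s"
    using ubound_mutate_subset[OF v' k] mutate_seed_twice[OF v[unfolded s] k] by (simp add: s)
qed (rule ubound_mutate_subset[OF v k])

section \<open>Mutation classes and the cluster algebra\<close>

lemma seeds_valid:
  assumes "valid N S s" "s' \<in> seeds N S s"
  shows "valid N S s'"
  using assms(2)
proof (induction rule: seeds.induct)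
  case (mutate s' k)
  then show ?case using valid_mutate[of N S "fst s'" "snd s'" k] by (simp add: mutate_seed_def)
qed (rule assms)

lemma seeds_ubound:
  assumes "valid N S s" "s' \<in> seeds N S s"
  shows "ubound N S s' = ubound N S s"
  using assms(2)
proof (induction rule: seeds.induct)
  case (mutate s' k)
  then show ?case using ubound_mutate[OF seeds_valid[OF assms(1)], of s' k] by simp
qed simp

lemma seeds_trans: "s' \<in> seeds N S s \<Longrightarrow> s'' \<in> seeds N S s' \<Longrightarrow> s'' \<in> seeds N S s"
  by (rotate_tac, induction rule: seeds.induct) (auto intro: seeds.intros)

lemma seeds_sym:
  assumes v: "valid N S s" and s': "s' \<in> seeds N S s"
  shows "s \<in> seeds N S s'"
  using s'
proof (induction rule: seeds.induct)
  case (mutate s' k)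
  have "valid N S (fst s', snd s')" using seeds_valid[OF v mutate.hyps(1)] by simp
  from mutate_seed_twice[OF this mutate.hyps(2)]
  have "s' \<in> seeds N S (mutate_seed N k s')"
    using seeds.mutate[OF seeds.initial[of "mutate_seed N k s'" N S] mutate.hyps(2)] by simp
  then show ?case using mutate.IH by (rule seeds_trans)
qed (rule seeds.initial)

lemma seeds_eq: "valid N S s \<Longrightarrow> s' \<in> seeds N S s \<Longrightarrow> seeds N S s' = seeds N S s"
  using seeds_trans seeds_sym by blast

lemma seeds_mono: "T \<subseteq> S \<Longrightarrow> seeds N T s \<subseteq> seeds N S s"
proof
  fix s' assume "T \<subseteq> S" "s' \<in> seeds N T s"
  from this(2) show "s' \<in> seeds N S s"
    by (induction rule: seeds.induct) (use \<open>T \<subseteq> S\<close> in \<open>auto intro: seeds.intros\<close>)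
qed

lemma seeds_frozen: "s' \<in> seeds N S s \<Longrightarrow> i \<notin> S \<Longrightarrow> fst s' i = fst s i"
  by (induction rule: seeds.induct) (auto simp: mutate_seed_def mutate_cluster_eq)

abbreviation (input) "calg \<equiv> cluster_algebra_Z"

lemma calg_gen:
  "calg N S s = gen (cluster_variables N S s \<union> (\<lambda>i. inverse (fst s i)) ` ({..<N} - S))"
  by (simp add: cluster_algebra_Z_def generate_ring_eq_gen)

lemma sring_calg [simp, intro]: "sring (calg N S s)"
  by (simp add: calg_gen)

lemma calg_var: "s' \<in> seeds N S s \<Longrightarrow> i < N \<Longrightarrow> fst s' i \<in> calg N S s"
  unfolding calg_gen cluster_variables_def by (rule gen_base, cases s') auto

lemma calg_frozen: "i < N \<Longrightarrow> i \<notin> S \<Longrightarrow> inverse (fst s i) \<in> calg N S s"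
  unfolding calg_gen by (rule gen_base) auto

lemma calg_least:
  assumes "sring A" "\<And>s' i. s' \<in> seeds N S s \<Longrightarrow> i < N \<Longrightarrow> fst s' i \<in> A"
    "\<And>i. i < N \<Longrightarrow> i \<notin> S \<Longrightarrow> inverse (fst s i) \<in> A"
  shows "calg N S s \<subseteq> A"
  unfolding calg_gen cluster_variables_def
proof (rule gen_least[OF assms(1)], intro Un_least subsetI)
  fix a assume "a \<in> {x i |x B i. (x, B) \<in> seeds N S s \<and> i < N}"
  then obtain x B i where "a = x i" "(x, B) \<in> seeds N S s" "i < N" by blast
  with assms(2)[of "(x, B)" i] show "a \<in> A" by simp
next
  fix a assume "a \<in> (\<lambda>i. inverse (fst s i)) ` ({..<N} - S)"
  with assms(3) show "a \<in> A" by blast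
qed

lemma calg_seeds:
  assumes v: "valid N S s" and s': "s' \<in> seeds N S s"
  shows "calg N S s' = calg N S s"
proof -
  have "(\<lambda>i. inverse (fst s' i)) ` ({..<N} - S) = (\<lambda>i. inverse (fst s i)) ` ({..<N} - S)"
    by (rule image_cong) (use seeds_frozen[OF s'] in auto)
  then show ?thesis unfolding calg_gen cluster_variables_def seeds_eq[OF v s'] by simp
qed

lemma sring_ubound [simp, intro]: "sring (ubound N S s)"
  unfolding ubound_def by (intro sring_Int sring_INT sring_laur)

text \<open>The Laurent phenomenon, in the strong form that follows from mutation invariance of
  upper bounds.\<close>
lemma calg_subset_ubound:
  assumes v: "valid N S s"
  shows "calg N S s \<subseteq> ubound N S s"
proof (rule calg_least)
  fix s' i assume s': "s' \<in> seeds N S s" and i: "i < N"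
  obtain x B where xB: "s' = (x, B)" by (cases s')
  have v': "valid N S (x, B)" using seeds_valid[OF v s'] xB by simp
  have "x i \<in> laur {..<N} (mutate_cluster N k B x)" if k: "k \<in> S" for k
  proof (cases "i = k")
    case True
    let ?x = "mutate_cluster N k B x"
    have kN: "k \<in> {..<N}" using valid_simps(1)[OF v'] k by blast
    have "epoly N B k x \<in> laur ({..<N} - {k}) x" using valid_epoly(1)[OF v' k] .
    also have "laur ({..<N} - {k}) x = laur ({..<N} - {k}) ?x"
      by (simp add: mutate_cluster_eq laur_upd)
    also have "\<dots> \<subseteq> laur {..<N} ?x" by (rule laur_mono) auto
    finally have "epoly N B k x * inverse (?x k) \<in> laur {..<N} ?x"
      by (intro sring_mult sring_laur laur_inverse kN)
    then show ?thesis
      using True valid_epoly(2)[OF v' k] by (simp add: mutate_cluster_eq)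
  next
    case False
    then show ?thesis using laur_base[of i "{..<N}" "mutate_cluster N k B x"] i
      by (simp add: mutate_cluster_eq)
  qed
  then have "fst s' i \<in> ubound N S s'"
    using i by (auto simp: ubound_def xB mutate_seed_def intro: laur_base)
  then show "fst s' i \<in> ubound N S s" using seeds_ubound[OF v s'] by simp
next
  fix i assume i: "i < N" "i \<notin> S"
  have eq: "fst (mutate_seed N k s) i = fst s i" if "k \<in> S" for k
    using that i by (auto simp: mutate_seed_def mutate_cluster_eq)
  have mem: "inverse (fst s' i) \<in> laur {..<N} (fst s')" for s' :: "'a seed"
    using i by (intro laur_inverse) simp
  show "inverse (fst s i) \<in> ubound N S s"
    unfolding ubound_def
  proof (intro IntI INT_I)
    fix k assume "k \<in> S"
    from mem[of "mutate_seed N k s"] eq[OF this]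
    show "inverse (fst s i) \<in> laur {..<N} (fst (mutate_seed N k s))" by simp
  qed (rule mem)
qed simp

subsection \<open>Seeds whose quiver has no edges\<close>

context
  fixes N S B and x :: "nat \<Rightarrow> 'f::field"
  assumes v: "valid N S (x, B)" and no_edges: "\<And>i k. i \<in> S \<Longrightarrow> k \<in> S \<Longrightarrow> B i k = 0"
begin

private definition P where "P k = epoly N B k x"

text \<open>The second generator at index \<open>i\<close>: the variable after mutation at
  \<open>i\<close> for \<open>i\<close> in \<open>T\<close>, the inverse of \<open>x i\<close>
  otherwise. Only \<open>T\<close> counts as mutable, which permits an induction on
  \<open>T\<close>.\<close>

private definition companion where
  "companion T i = (if i \<in> T then P i / x i else inverse (x i))"

private definition subalg where
  "subalg T I = gen (x ` I \<union> companion T ` I)"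

private lemma sring_subalg: "sring (subalg T I)"
  by (simp add: subalg_def)

private lemma subalg_base: "i \<in> I \<Longrightarrow> x i \<in> subalg T I" "i \<in> I \<Longrightarrow> companion T i \<in> subalg T I"
  by (auto simp: subalg_def intro: gen_base)

private lemma subalg_least:
  "sring A \<Longrightarrow> (\<And>i. i \<in> I \<Longrightarrow> x i \<in> A) \<Longrightarrow> (\<And>i. i \<in> I \<Longrightarrow> companion T i \<in> A) \<Longrightarrow> subalg T I \<subseteq> A"
  unfolding subalg_def by (rule gen_least) auto

private lemma x_nonzero: "i < N \<Longrightarrow> x i \<noteq> 0"
  by (rule valid_simps(8)[OF v])

private lemma S_less: "i \<in> S \<Longrightarrow> i < N"
  using valid_simps(1)[OF v] by auto

private lemma P_mem:
  assumes k: "k \<in> S" and "{..<N} - S \<subseteq> I"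
  shows "P k \<in> laur I x"
  unfolding P_def by (rule epoly_mem) (use assms no_edges[OF _ k] in \<open>auto intro!: laur_base\<close>)

private lemma P_nonzero: "k \<in> S \<Longrightarrow> P k \<noteq> 0"
  unfolding P_def by (rule valid_epoly(2)[OF v])

private lemma P_upd: "k \<in> S \<Longrightarrow> j \<in> S \<Longrightarrow> P k = epoly N B k (x(j := t))"
  unfolding P_def by (rule epoly_cong) (use no_edges[of j k] in auto)

private abbreviation "mut k \<equiv> x(k := P k / x k)"

private lemma indep_mut: "k \<in> S \<Longrightarrow> indep {..<N} (mut k)"
  using valid_simps(3)[OF valid_mutate[OF v]] by (simp add: mutate_cluster_eq P_def)

private lemma mut_nonzero: "k \<in> S \<Longrightarrow> i < N \<Longrightarrow> mut k i \<noteq> 0"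
  using indep_nonzero[OF indep_mut] by blast

text \<open>The upper bound in which only the indices in \<open>T\<close> count as mutable.\<close>

private definition bnd where
  "bnd T = laur {..<N} x \<inter> (\<Inter>k\<in>T. laur {..<N} (mut k))"

private lemma companion_mem:
  assumes T: "T \<subseteq> S" and i: "i < N"
  shows "companion T i \<in> bnd T"
  unfolding bnd_def
proof (intro IntI INT_I)
  have iI: "i \<in> {..<N}" using i by simp
  show "companion T i \<in> laur {..<N} x"
  proof (cases "i \<in> T")
    case True
    have "P i * inverse (x i) \<in> laur {..<N} x"
      using T True by (intro sring_mult sring_laur P_mem laur_inverse iI) auto
    then show ?thesis using True by (simp add: companion_def divide_inverse)
  qed (use iI in \<open>simp add: companion_def laur_inverse\<close>)
  fix k assume k: "k \<in> T"
  then have kS: "k \<in> S" using T by blast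
  show "companion T i \<in> laur {..<N} (mut k)"
  proof (cases "i = k")
    case True
    then show ?thesis using laur_base[OF iI, of "mut k"] k by (simp add: companion_def)
  next
    case False
    have inv: "inverse (x i) \<in> laur {..<N} (mut k)"
      using laur_inverse[OF iI, of "mut k"] False by simp
    show ?thesis
    proof (cases "i \<in> T")
      case True
      then have iS: "i \<in> S" using T by blast
      have "P i \<in> laur ({..<N} - {k}) (mut k)"
        using P_mem[OF iS, of "{..<N} - {k}"] kS by (auto simp: laur_upd)
      then have "P i \<in> laur {..<N} (mut k)" using laur_mono[of "{..<N} - {k}" "{..<N}"] by blast
      from sring_mult[OF sring_laur this inv] show ?thesis
        using True by (simp add: companion_def divide_inverse)
    qed (use inv in \<open>simp add: companion_def\<close>)
  qed
qed

private lemma sring_bnd: "sring (bnd T)"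
  unfolding bnd_def by (intro sring_Int sring_INT sring_laur)

private lemma subalg_subset_bnd:
  assumes T: "T \<subseteq> S"
  shows "subalg T {..<N} \<subseteq> bnd T"
proof (rule subalg_least[OF sring_bnd])
  fix i assume i: "i \<in> {..<N}"
  then show "companion T i \<in> bnd T" using companion_mem[OF T] by simp
  show "x i \<in> bnd T" unfolding bnd_def
  proof (intro IntI INT_I)
    show "x i \<in> laur {..<N} x" using i by (rule laur_base)
    fix k assume k: "k \<in> T"
    then have kS: "k \<in> S" using T by blast
    show "x i \<in> laur {..<N} (mut k)"
    proof (cases "i = k")
      case True
      have "P k \<in> laur ({..<N} - {k}) (mut k)"
        using P_mem[OF kS, of "{..<N} - {k}"] kS by (auto simp: laur_upd)
      then have "P k \<in> laur {..<N} (mut k)" using laur_mono[of "{..<N} - {k}" "{..<N}"] by blast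
      from sring_mult[OF sring_laur this laur_inverse[OF i]] show ?thesis
        using True P_nonzero[OF kS] by simp
    next
      case False
      then show ?thesis using laur_base[OF i, of "mut k"] by simp
    qed
  qed
qed

text \<open>In the Laurent ring of \<open>mut k\<close>, \<open>x k\<close> is a unit times the
  binomial of column \<open>k\<close>, and \<open>P j\<close> is a unit times the binomial of column
  \<open>j\<close>. These are coprime, so \<open>d\<close> cannot need a denominator: it has one
  that is a power of \<open>x k\<close>, from the passage from \<open>x\<close> to
  \<open>mut k\<close>, and another that is a power of \<open>P j\<close>.\<close>

private lemma divide_P_power:
  assumes k: "k \<in> S" and j: "j \<in> S" "j \<noteq> k"
    and d: "d \<in> laur {..<N} x" "P j ^ n * d \<in> laur {..<N} (mut k)"
  shows "d \<in> laur {..<N} (mut k)"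
proof -
  note vs = valid_simps[OF v]
  let ?x = "mut k"
  let ?L = "laur {..<N} ?x"
  have xk_mem: "x k \<in> ?L"
    using subalg_subset_bnd[of "{k}"] subalg_base(1)[of k "{..<N}" "{k}"] k S_less[OF k]
    by (auto simp: bnd_def)
  have Pj: "P j = epoly N B j ?x" by (rule P_upd) fact+
  have Pk: "P k = epoly N B k ?x" by (rule P_upd) fact+
  have Pj_mem: "P j \<in> ?L"
    unfolding Pj by (rule epoly_mem[OF sring_laur]) (rule laur_base, simp)
  have yk: "P k / x k \<noteq> 0" using mut_nonzero[OF k S_less[OF k]] by simp
  have nz: "\<And>i. i < N \<Longrightarrow> ?x i \<noteq> 0" by (rule mut_nonzero[OF k])
  have "laur {..<N} x \<subseteq> loc ?L (x k)"
  proof (rule laur_least[OF sring_loc[OF sring_laur xk_mem]])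
    fix i assume i: "i \<in> {..<N}"
    show "x i \<in> loc ?L (x k)"
      using xk_mem laur_base[OF i, of ?x] subset_loc[of ?L "x k"] by (cases "i = k") auto
    show "inverse (x i) \<in> loc ?L (x k)"
      using inverse_in_loc[OF sring_laur x_nonzero[OF S_less[OF k]], of "{..<N}" ?x]
        laur_inverse[OF i, of ?x] subset_loc[of ?L "x k"] by (cases "i = k") auto
  qed
  with d have dk: "d \<in> loc ?L (x k)" by blast
  obtain l l' where l: "l < N" "B l k \<noteq> 0" "l' < N" "B l k * B l' j - B l j * B l' k \<noteq> 0"
    using colindep_minor[OF vs(4) vs(2) j(1) k j(2)] .
  have c: "coprimal ?L (1 + lmon {..<N} ?x (\<lambda>i. B i k)) (1 + lmon {..<N} ?x (\<lambda>i. B i j))"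
    by (rule coprimal_binomials[OF indep_mut[OF k], of l _ l']) (use l in auto)
  have ek: "P k = lmon {..<N} ?x (\<lambda>i. max (- B i k) 0) * (1 + lmon {..<N} ?x (\<lambda>i. B i k))"
    by (rule trans[OF Pk epoly_factor]) (rule nz)
  have ej: "P j = lmon {..<N} ?x (\<lambda>i. max (- B i j) 0) * (1 + lmon {..<N} ?x (\<lambda>i. B i j))"
    by (rule trans[OF Pj epoly_factor]) (rule nz)
  define u where "u = inverse (P k / x k) * lmon {..<N} ?x (\<lambda>i. max (- B i k) 0)"
  define w where "w = lmon {..<N} ?x (\<lambda>i. max (- B i j) 0)"
  have inv: "inverse (lmon {..<N} ?x g) \<in> ?L" for g unfolding inverse_lmon by (rule lmon_in_laur) simp
  have "coprimal ?L (u * (1 + lmon {..<N} ?x (\<lambda>i. B i k))) (w * (1 + lmon {..<N} ?x (\<lambda>i. B i j)))"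
  proof (rule coprimal_units[OF sring_laur c])
    have "lmon {..<N} ?x g \<noteq> 0" for g by (rule lmon_nonzero) (rule nz, simp)
    then show "u \<noteq> 0" "w \<noteq> 0" using yk by (simp_all add: u_def w_def)
    have "P k / x k \<in> ?L" using laur_base[of k "{..<N}" ?x] S_less[OF k] by simp
    from sring_mult[OF sring_laur this inv]
    show "inverse u \<in> ?L" unfolding u_def inverse_mult_distrib inverse_inverse_eq .
    show "inverse w \<in> ?L" unfolding w_def by (rule inv)
  qed
  also have "u * (1 + lmon {..<N} ?x (\<lambda>i. B i k)) = inverse (P k / x k) * P k"
    unfolding u_def by (simp only: mult.assoc ek[symmetric])
  also have "inverse (P k / x k) * P k = x k" using P_nonzero[OF k] by simp
  also have "w * (1 + lmon {..<N} ?x (\<lambda>i. B i j)) = P j"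
    unfolding w_def by (simp only: ej[symmetric])
  finally show ?thesis
    by (rule coprimal_loc[OF sring_laur xk_mem Pj_mem _ dk]) (rule locI[OF d(2)])
qed

text \<open>In the expansion of \<open>f\<close> in powers of \<open>x j\<close>, a term
  \<open>c r * x j powi r\<close> with negative exponent requires \<open>c r\<close> to be divisible
  by \<open>P j ^ n\<close> within \<open>R\<close>. Divisibility in the Laurent ring follows from
  membership for \<open>mut j\<close>; the quotient stays in \<open>R\<close> by the induction
  hypothesis, because it lies in \<open>bnd T\<close> again.\<close>

private lemma bnd_subset_subalg:
  assumes "finite T" "T \<subseteq> S"
  shows "bnd T \<subseteq> subalg T {..<N}"
  using assms
proof (induction T rule: finite_induct)
  case empty
  have "laur {..<N} x \<subseteq> subalg {} {..<N}"
  proof (rule laur_least[OF sring_subalg])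
    fix i assume "i \<in> {..<N}"
    from subalg_base[OF this, of "{}"]
    show "x i \<in> subalg {} {..<N}" "inverse (x i) \<in> subalg {} {..<N}" by (simp_all add: companion_def)
  qed
  then show ?case by (simp add: bnd_def)
next
  case (insert j T)
  have jS: "j \<in> S" and TS: "T \<subseteq> S" using insert.prems by auto
  have IH: "bnd T \<subseteq> subalg T {..<N}" by (rule insert.IH[OF TS])
  have jN: "j < N" by (rule S_less[OF jS])
  \<comment> \<open>Both rings leave out \<open>x j\<close>: the coefficients lie in
    \<open>R\<close>, and \<open>x j\<close> is transcendental over the larger ring
    \<open>Rj\<close>.\<close>
  define R where "R = subalg T ({..<N} - {j})"
  define Rj where "Rj = laur ({..<N} - {j}) x"
  have R: "sring R" and Rj: "sring Rj" by (simp_all add: R_def Rj_def sring_subalg)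
  have xj: "x j \<noteq> 0" by (rule x_nonzero[OF jN])
  have tr: "transc Rj (x j)"
    unfolding Rj_def using indepD[OF valid_simps(3)[OF v], of j] jN by simp
  have Pj: "P j \<in> Rj" "P j \<noteq> 0"
    unfolding Rj_def using P_mem[OF jS, of "{..<N} - {j}"] jS P_nonzero[OF jS] by auto
  have R_Rj: "R \<subseteq> Rj"
    unfolding R_def
  proof (rule subalg_least[OF Rj])
    fix i assume i: "i \<in> {..<N} - {j}"
    show "x i \<in> Rj" unfolding Rj_def using i by (rule laur_base)
    have inv: "inverse (x i) \<in> Rj" unfolding Rj_def using i by (rule laur_inverse)
    show "companion T i \<in> Rj"
    proof (cases "i \<in> T")
      case True
      have "P i \<in> Rj" unfolding Rj_def by (rule P_mem) (use True TS jS in auto)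
      from sring_mult[OF Rj this inv] show ?thesis using True by (simp add: companion_def divide_inverse)
    qed (use inv in \<open>simp add: companion_def\<close>)
  qed
  have split: "subalg T {..<N} \<subseteq> lsums R (x j)"
    unfolding lsums_eq_gen[OF R xj]
  proof (rule subalg_least[OF sring_gen])
    fix i assume i: "i \<in> {..<N}"
    show "x i \<in> gen (R \<union> {x j, inverse (x j)})"
      by (rule gen_base, cases "i = j") (use i subalg_base(1)[of i "{..<N} - {j}" T] in \<open>auto simp: R_def\<close>)
    show "companion T i \<in> gen (R \<union> {x j, inverse (x j)})"
    proof (rule gen_base, cases "i = j")
      case True
      then show "companion T i \<in> R \<union> {x j, inverse (x j)}" using insert.hyps by (simp add: companion_def)
    next
      case False
      then show "companion T i \<in> R \<union> {x j, inverse (x j)}"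
        using i subalg_base(2)[of i "{..<N} - {j}" T] by (simp add: R_def)
    qed
  qed
  let ?A = "subalg (insert j T) {..<N}"
  have R_A: "R \<subseteq> ?A" unfolding R_def
  proof (rule subalg_least[OF sring_subalg])
    fix i assume i: "i \<in> {..<N} - {j}"
    then have "companion (insert j T) i = companion T i" by (simp add: companion_def)
    with i subalg_base[of i "{..<N}" "insert j T"]
    show "x i \<in> ?A" "companion T i \<in> ?A" by simp_all
  qed
  show ?case
  proof
    fix f assume "f \<in> bnd (insert j T)"
    then have fT: "f \<in> bnd T" and fj: "f \<in> laur {..<N} (mut j)" by (auto simp: bnd_def)
    from fT IH split have "f \<in> lsums R (x j)" by blast
    then obtain F c where F: "finite F" "\<forall>r\<in>F. c r \<in> R" "f = (\<Sum>r\<in>F. c r * x j powi r)"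
      by (rule lsumsE)
    have "f \<in> lsums Rj (P j / x j)"
      using fj laur_split[of j "{..<N}" "mut j"] jN mut_nonzero[OF jS jN] by (simp add: Rj_def laur_upd)
    note mem = this[unfolded F(3)]
    show "f \<in> ?A" unfolding F(3)
    proof (rule sring_sum[OF sring_subalg])
      fix r assume r: "r \<in> F"
      have cr: "c r \<in> R" using F(2) r by blast
      have base: "x j \<in> ?A" "P j / x j \<in> ?A"
        using subalg_base[of j "{..<N}" "insert j T"] jN by (simp_all add: companion_def)
      show "c r * x j powi r \<in> ?A"
      proof (cases "r \<ge> 0")
        case True
        have "c r * x j ^ nat r \<in> ?A"
          using cr R_A by (intro sring_mult[OF sring_subalg] sring_power[OF sring_subalg] base) auto
        then show ?thesis using True by (simp add: power_int_def)
      next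
        case False
        define n where "n = nat (- r)"
        define d where "d = c r / P j ^ n"
        have Pd: "P j ^ n * d = c r" using Pj by (simp add: d_def)
        have dRj: "d \<in> Rj" unfolding d_def n_def
          by (rule transc_mutate_coeff[OF tr Rj Pj F(1) _ mem r]) (use F(2) R_Rj False in auto)
        then have dL: "d \<in> laur {..<N} x"
          unfolding Rj_def using laur_mono[of "{..<N} - {j}" "{..<N}" x] by blast
        have R_bnd: "R \<subseteq> bnd T"
        proof -
          have "R \<subseteq> subalg T {..<N}" unfolding R_def
            by (rule subalg_least[OF sring_subalg]) (auto intro: subalg_base)
          with subalg_subset_bnd[OF TS] show ?thesis by blast
        qed
        have "d \<in> bnd T" unfolding bnd_def
        proof (intro IntI INT_I dL)
          fix k assume k: "k \<in> T"
          have "c r \<in> laur {..<N} (mut k)" using cr R_bnd k by (auto simp: bnd_def)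
          then show "d \<in> laur {..<N} (mut k)"
            using k TS insert.hyps by (intro divide_P_power[of k j d n] jS dL) (auto simp: Pd)
        qed
        with IH split have "d \<in> lsums R (x j)" by blast
        then obtain G e where G: "finite G" "\<forall>r\<in>G. e r \<in> R" "d = (\<Sum>r\<in>G. e r * x j powi r)"
          by (rule lsumsE)
        \<comment> \<open>\<open>d\<close> does not involve \<open>x j\<close>, so its expansion
          reduces to the term of exponent 0, whose coefficient is in \<open>R\<close>.\<close>
        have eq: "(\<Sum>r\<in>{0}. d * x j powi r) = (\<Sum>r\<in>G. e r * x j powi r)" using G(3) by simp
        have "(if 0 \<in> {0::int} then d else 0) = (if 0 \<in> G then e 0 else 0)"
          by (rule transc_eqD[OF tr Rj _ G(1) _ _ eq]) (use dRj G(2) R_Rj in auto)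
        then have "d \<in> R" using G(2) sring_zero[OF R] by (auto split: if_splits)
        then have "d * (P j / x j) ^ n \<in> ?A"
          using R_A by (intro sring_mult[OF sring_subalg] sring_power[OF sring_subalg] base) auto
        also have "d * (P j / x j) ^ n = c r * x j powi r"
          using False Pj xj by (simp add: d_def n_def power_int_def field_simps)
        finally show ?thesis .
      qed
    qed
  qed
qed

lemma no_edges_calg:
  shows "calg N S (x, B) = ubound N S (x, B)"
    and "calg N S (x, B) = gen (x ` {..<N} \<union>
           (\<lambda>i. if i \<in> S then epoly N B i x / x i else inverse (x i)) ` {..<N})"
proof -
  have 1: "ubound N S (x, B) = bnd S"
    by (simp add: ubound_def bnd_def mutate_seed_def mutate_cluster_eq P_def)
  have 2: "bnd S \<subseteq> subalg S {..<N}" by (rule bnd_subset_subalg) (use valid_simps(2)[OF v] in auto)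
  have 3: "subalg S {..<N} \<subseteq> calg N S (x, B)"
  proof (rule subalg_least[OF sring_calg])
    fix i assume i: "i \<in> {..<N}"
    then show "x i \<in> calg N S (x, B)"
      using calg_var[OF seeds.initial, of i N "(x, B)" S] by simp
    show "companion S i \<in> calg N S (x, B)"
    proof (cases "i \<in> S")
      case True
      from calg_var[OF seeds.mutate[OF seeds.initial[of "(x, B)"] True], of i N] i True
      show ?thesis by (simp add: companion_def mutate_seed_def mutate_cluster_eq P_def)
    next
      case False
      then show ?thesis using calg_frozen[of i N S "(x, B)"] i by (simp add: companion_def)
    qed
  qed
  have 4: "calg N S (x, B) \<subseteq> ubound N S (x, B)" by (rule calg_subset_ubound[OF v])
  show "calg N S (x, B) = ubound N S (x, B)" using 1 2 3 4 by blast
  have "calg N S (x, B) = subalg S {..<N}" using 1 2 3 4 by blast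
  moreover have "companion S = (\<lambda>i. if i \<in> S then epoly N B i x / x i else inverse (x i))"
    by (simp add: fun_eq_iff companion_def P_def)
  ultimately show "calg N S (x, B) = gen (x ` {..<N} \<union>
      (\<lambda>i. if i \<in> S then epoly N B i x / x i else inverse (x i)) ` {..<N})"
    by (simp only: subalg_def)
qed

end

subsection \<open>Separating edges\<close>

definition comax :: "'f::field set \<Rightarrow> 'f \<Rightarrow> 'f \<Rightarrow> bool" where
  "comax A u w \<longleftrightarrow> (\<exists>a\<in>A. \<exists>b\<in>A. a * u + b * w = 1)"

lemma comaxI: "a \<in> A \<Longrightarrow> b \<in> A \<Longrightarrow> a * u + b * w = 1 \<Longrightarrow> comax A u w"
  unfolding comax_def by blast

lemma comax_sym: "comax A u w \<Longrightarrow> comax A w u"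
  unfolding comax_def by (metis add.commute)

lemma comax_unit:
  assumes "sring A" "u \<noteq> 0" "inverse u \<in> A"
  shows "comax A u w"
  by (rule comaxI[of "inverse u" A 0]) (use assms in \<open>simp_all add: sring_zero\<close>)

lemma comax_mult:
  assumes A: "sring A" and w: "w \<in> A" and u: "u \<in> A" "comax A u w" and u': "u' \<in> A" "comax A u' w"
  shows "comax A (u * u') w"
proof -
  from u(2) obtain a b where ab: "a \<in> A" "b \<in> A" "a * u + b * w = 1" unfolding comax_def by blast
  from u'(2) obtain c d where cd: "c \<in> A" "d \<in> A" "c * u' + d * w = 1" unfolding comax_def by blast
  show ?thesis
  proof (rule comaxI)
    show "a * c \<in> A" "a * u * d + b * (c * u') + b * d * w \<in> A"
      by (intro sring_mult[OF A] sring_add[OF A] ab cd u u' w)+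
    have "1 = (a * u + b * w) * (c * u' + d * w)" using ab cd by simp
    then show "a * c * (u * u') + (a * u * d + b * (c * u') + b * d * w) * w = 1"
      by (simp add: algebra_simps)
  qed
qed

lemma comax_one: "sring A \<Longrightarrow> comax A 1 w"
  by (rule comax_unit) (auto intro: sring_one)

lemma comax_power:
  assumes "sring A" "w \<in> A" "u \<in> A" "comax A u w"
  shows "comax A (u ^ n) w"
  using assms by (induction n) (auto intro: comax_mult comax_one sring_power)

lemma comax_prod:
  assumes A: "sring A" "w \<in> A" and g: "\<And>i. i \<in> I \<Longrightarrow> g i \<in> A" "\<And>i. i \<in> I \<Longrightarrow> comax A (g i) w"
  shows "comax A (\<Prod>i\<in>I. g i) w"
  using g
proof (induction I rule: infinite_finite_induct)
  case (insert i I)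
  then show ?case using A by (simp add: comax_mult sring_prod)
qed (use A in \<open>simp_all add: comax_one\<close>)

text \<open>An ideal containing \<open>x i\<close> and \<open>x j\<close> contains, by the exchange relation at \<open>j\<close>, a product of
  variables at the heads of the edges leaving \<open>j\<close>, so the claim is propagated backwards along
  paths starting in \<open>j\<close>.\<close>
lemma comax_forward:
  assumes A: "sring A"
    and xA: "\<And>i. i < N \<Longrightarrow> x i \<in> A" and frozen: "\<And>i. i < N \<Longrightarrow> i \<notin> S \<Longrightarrow> x i \<noteq> 0 \<and> inverse (x i) \<in> A"
    and ex: "\<And>j. j \<in> S \<Longrightarrow> y j \<in> A \<and> x j * y j = epoly N B j x"
    and S: "S \<subseteq> {..<N}" and skew: "\<And>i j. i \<in> S \<Longrightarrow> j \<in> S \<Longrightarrow> B i j = - B j i"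
    and acc: "j \<in> Wellfounded.acc {(l, j). (j, l) \<in> quiver_edges S B}"
    and ij: "(i, j) \<in> quiver_edges S B"
  shows "comax A (x i) (x j)"
  using acc ij
proof (induction j arbitrary: i rule: acc.induct)
  case (accI j i)
  have iS: "i \<in> S" and jS: "j \<in> S" and Bij: "B i j > 0" using accI.prems by (auto simp: quiver_edges_def)
  have iN: "i < N" and jN: "j < N" using S iS jS by auto
  have xj: "x j \<in> A" by (rule xA[OF jN])
  define M where "M = (\<Prod>l<N. x l ^ nat (max (- B l j) 0))"
  \<comment> \<open>The monomial with positive exponents, divided by one factor \<open>x i\<close>;
    this is possible since \<open>B i j > 0\<close>.\<close>
  define M' where "M' = x i ^ (nat (max (B i j) 0) - 1) * (\<Prod>l\<in>{..<N} - {i}. x l ^ nat (max (B l j) 0))"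
  \<comment> \<open>A variable occurring in \<open>M\<close> is either frozen, hence a unit, or the
    head of an edge leaving \<open>j\<close>, to which the induction hypothesis applies.\<close>
  have "comax A M (x j)" unfolding M_def
  proof (rule comax_prod[OF A xj])
    fix l assume l: "l \<in> {..<N}"
    then have lN: "l < N" by simp
    show "x l ^ nat (max (- B l j) 0) \<in> A" by (intro sring_power[OF A] xA lN)
    show "comax A (x l ^ nat (max (- B l j) 0)) (x j)"
    proof (cases "B l j < 0")
      case True
      have "comax A (x l) (x j)"
      proof (cases "l \<in> S")
        case lS: True
        then have "(j, l) \<in> quiver_edges S B"
          using skew[OF jS lS] True jS by (simp add: quiver_edges_def)
        then have "comax A (x j) (x l)" by (intro accI.IH) simp
        then show ?thesis by (rule comax_sym)
      next
        case False
        then show ?thesis using frozen[OF lN] A by (simp add: comax_unit)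
      qed
      then show ?thesis by (rule comax_power[OF A xj xA[OF lN]])
    qed (simp add: comax_one[OF A])
  qed
  then obtain a b where ab: "a \<in> A" "b \<in> A" "a * M + b * x j = 1" unfolding comax_def by blast
  have "(\<Prod>l<N. x l ^ nat (max (B l j) 0))
      = x i ^ nat (max (B i j) 0) * (\<Prod>l\<in>{..<N} - {i}. x l ^ nat (max (B l j) 0))"
    using iN by (simp add: prod.remove)
  also have "x i ^ nat (max (B i j) 0) = x i * x i ^ (nat (max (B i j) 0) - 1)"
    using Bij by (simp add: power_eq_if)
  finally have "(\<Prod>l<N. x l ^ nat (max (B l j) 0)) = M' * x i" by (simp add: M'_def)
  then have rel: "x j * y j = M' * x i + M" using ex[OF jS] by (simp add: epoly_def M_def)
  have M'A: "M' \<in> A" unfolding M'_def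
    by (intro sring_mult[OF A] sring_power[OF A] sring_prod[OF A] xA iN) simp
  show ?case
  proof (rule comaxI)
    show "- (a * M') \<in> A" "a * y j + b \<in> A"
      using ex[OF jS] by (intro sring_uminus[OF A] sring_add[OF A] sring_mult[OF A] ab M'A; simp)+
    have "- (a * M') * x i + (a * y j + b) * x j = a * (x j * y j - M' * x i) + b * x j"
      by (simp add: algebra_simps)
    also have "\<dots> = 1" using ab(3) by (simp add: rel)
    finally show "- (a * M') * x i + (a * y j + b) * x j = 1" .
  qed
qed

lemma not_acc_chain:
  assumes "a \<notin> Wellfounded.acc r"
  obtains f :: "nat \<Rightarrow> 'a" where "f 0 = a" "\<And>n. (f (Suc n), f n) \<in> r"
proof -
  have step: "\<exists>y. y \<notin> Wellfounded.acc r \<and> (y, x) \<in> r" if "x \<notin> Wellfounded.acc r" for x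
    using that by (meson accI)
  have "\<exists>f. \<forall>n. (f n \<notin> Wellfounded.acc r \<and> (n = 0 \<longrightarrow> f n = a)) \<and> (f (Suc n), f n) \<in> r"
    by (rule dependent_nat_choice) (use assms step in auto)
  then show thesis using that by blast
qed

text \<open>An infinite path out of \<open>j\<close> and an infinite path into \<open>i\<close>,
  glued along the edge, would form a bi-infinite path.\<close>

lemma separating_edge_acc:
  assumes "separating_edge E i j"
  shows "j \<in> Wellfounded.acc {(l, j). (j, l) \<in> E} \<or> i \<in> Wellfounded.acc E"
proof (rule ccontr)
  assume neg: "\<not> ?thesis"
  from neg obtain f where f: "f 0 = j" "\<And>n. (f (Suc n), f n) \<in> {(l, j). (j, l) \<in> E}"
    using not_acc_chain[of j "{(l, j). (j, l) \<in> E}"] by auto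
  from neg obtain g where g: "g 0 = i" "\<And>n. (g (Suc n), g n) \<in> E"
    using not_acc_chain[of i E] by auto
  \<comment> \<open>Positions from 1 on follow the path out of \<open>j\<close>, positions up to 0
    run backwards along the path into \<open>i\<close>; the separating edge lies between 0 and
    1.\<close>
  define w where "w = (\<lambda>t::int. if t \<ge> 1 then f (nat (t - 1)) else g (nat (- t)))"
  have "(w t, w (t + 1)) \<in> E" for t
  proof -
    consider "t \<ge> 1" | "t = 0" | "t < 0" by linarith
    then show ?thesis
    proof cases
      case 1
      then have "nat (t + 1 - 1) = Suc (nat (t - 1))" by simp
      with 1 f(2)[of "nat (t - 1)"] show ?thesis by (simp add: w_def)
    next
      case 2
      with assms f(1) g(1) show ?thesis by (simp add: w_def separating_edge_def)
    next
      case 3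
      then have "nat (- t) = Suc (nat (- (t + 1)))" by simp
      with 3 g(2)[of "nat (- (t + 1))"] show ?thesis by (simp add: w_def)
    qed
  qed
  moreover have "w 0 = i" "w (0 + 1) = j" using f g by (simp_all add: w_def)
  ultimately show False using assms unfolding separating_edge_def by blast
qed

lemma separating_comax:
  assumes v: "valid N S (x, B)" and sep: "separating_edge (quiver_edges S B) i j"
  shows "comax (calg N S (x, B)) (x i) (x j)"
proof -
  let ?A = "calg N S (x, B)"
  define y where "y k = epoly N B k x / x k" for k
  have xA: "x i \<in> ?A" if "i < N" for i using calg_var[OF seeds.initial[of "(x, B)"] that] by simp
  have frozen: "x i \<noteq> 0 \<and> inverse (x i) \<in> ?A" if "i < N" "i \<notin> S" for i
    using calg_frozen[OF that, of "(x, B)"] valid_simps(8)[OF v that(1)] by simp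
  have SN: "S \<subseteq> {..<N}" by (rule valid_simps(1)[OF v])
  have y: "y k \<in> ?A \<and> x k * y k = epoly N B k x" if "k \<in> S" for k
  proof -
    have kN: "k < N" using that SN by auto
    from calg_var[OF seeds.mutate[OF seeds.initial[of "(x, B)"] that] kN]
    have "y k \<in> ?A" by (simp add: y_def mutate_seed_def mutate_cluster_eq)
    then show ?thesis using valid_simps(8)[OF v kN] by (simp add: y_def)
  qed
  have ij: "(i, j) \<in> quiver_edges S B" using sep by (simp add: separating_edge_def)
  from separating_edge_acc[OF sep] show ?thesis
  proof
    assume acc: "j \<in> Wellfounded.acc {(l, j). (j, l) \<in> quiver_edges S B}"
    show ?thesis
      by (rule comax_forward[OF sring_calg xA frozen y SN valid_simps(7)[OF v] acc ij])
  next
    assume acc: "i \<in> Wellfounded.acc (quiver_edges S B)"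
    \<comment> \<open>If no infinite path ends in \<open>i\<close>, all arrows are reversed:
      exchange polynomials are unchanged, and the edge now leads from \<open>j\<close> to
      \<open>i\<close>.\<close>
    let ?B = "\<lambda>i j. - B i j"
    note vs' = valid_simps(7)[OF valid_uminus[OF v]]
    have flip: "(a, b) \<in> quiver_edges S ?B \<longleftrightarrow> (b, a) \<in> quiver_edges S B" for a b
    proof (cases "a \<in> S \<and> b \<in> S")
      case True
      then have "B a b = - B b a" using valid_simps(7)[OF v] by blast
      with True show ?thesis unfolding quiver_edges_def by auto
    qed (auto simp: quiver_edges_def)
    have "comax ?A (x j) (x i)"
    proof (rule comax_forward[where B = ?B and x = x and N = N and S = S and y = y, OF sring_calg xA frozen _ SN vs'])
      show "y k \<in> ?A \<and> x k * y k = epoly N ?B k x" if "k \<in> S" for k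
        using y[OF that] by (simp add: epoly_uminus)
      have "{(l, j). (j, l) \<in> quiver_edges S ?B} = quiver_edges S B" by (auto simp: flip)
      with acc show "i \<in> Wellfounded.acc {(l, j). (j, l) \<in> quiver_edges S ?B}" by simp
      show "(j, i) \<in> quiver_edges S ?B" using ij by (simp add: flip)
    qed
    then show ?thesis by (rule comax_sym)
  qed
qed

lemma valid_subset:
  assumes v: "valid N S (x, B)" and T: "T \<subseteq> S"
  shows "valid N T (x, B)"
proof -
  note vs = valid_simps[OF v]
  have "ext_exchange_matrix N T B"
    unfolding ext_exchange_matrix_def
  proof (intro conjI ballI)
    show "T \<subseteq> {..<N}" using vs(1) T by blast
    show "B i j = - B j i" if "i \<in> T" "j \<in> T" for i j using valid_simps(7)[OF v] that T by blast
  qed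
  with vs(3) colindep_subset[OF vs(4) T vs(2)] show ?thesis by (simp add: valid_def)
qed

lemma ubound_mono: "T \<subseteq> S \<Longrightarrow> ubound N S s \<subseteq> ubound N T s"
  by (auto simp: ubound_def)

text \<open>Mutations within \<open>T\<close> produce seeds that also belong to \<open>S\<close>;
  freezing adds only the inverses of the variables in \<open>S - T\<close>.\<close>

lemma calg_subset_loc:
  assumes v: "valid N S (x, B)" and T: "T \<subseteq> S" and w: "w \<in> calg N S (x, B)"
    and inv: "\<And>i. i \<in> S \<Longrightarrow> i \<notin> T \<Longrightarrow> inverse (x i) \<in> loc (calg N S (x, B)) w"
  shows "calg N T (x, B) \<subseteq> loc (calg N S (x, B)) w"
proof (rule calg_least[OF sring_loc[OF sring_calg w]])
  fix s' i assume "s' \<in> seeds N T (x, B)" "i < N"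
  then show "fst s' i \<in> loc (calg N S (x, B)) w"
    using seeds_mono[OF T, of N "(x, B)"] calg_var[of s' N S "(x, B)" i] subset_loc[of _ w] by blast
next
  fix i assume i: "i < N" "i \<notin> T"
  then show "inverse (fst (x, B) i) \<in> loc (calg N S (x, B)) w"
    using inv[of i] calg_frozen[of i N S "(x, B)"] subset_loc[of _ w] by (cases "i \<in> S") auto
qed

text \<open>An element of the upper bound stays in it when \<open>i\<close> or \<open>j\<close> is
  frozen, so by hypothesis it lies in the localizations of the algebra at \<open>x i\<close> and at
  \<open>x j\<close>. As these two are comaximal, no denominator is left.\<close>

lemma separating_ubound:
  assumes v: "valid N S (x, B)" and sep: "separating_edge (quiver_edges S B) i j"
    and IH: "calg N (S - {i}) (x, B) = ubound N (S - {i}) (x, B)"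
      "calg N (S - {j}) (x, B) = ubound N (S - {j}) (x, B)"
  shows "calg N S (x, B) = ubound N S (x, B)"
proof
  let ?A = "calg N S (x, B)"
  have ij: "i \<in> S" "j \<in> S" using sep by (auto simp: separating_edge_def quiver_edges_def)
  have xA: "x k \<in> ?A" "x k \<noteq> 0" if "k \<in> S" for k
    using calg_var[OF seeds.initial[of "(x, B)"], of k N S] valid_simps(1,8)[OF v] that by auto
  have sub: "ubound N S (x, B) \<subseteq> loc ?A (x k)"
    if k: "k \<in> S" and eq: "calg N (S - {k}) (x, B) = ubound N (S - {k}) (x, B)" for k
  proof -
    have "ubound N S (x, B) \<subseteq> ubound N (S - {k}) (x, B)" by (rule ubound_mono) auto
    also have "\<dots> = calg N (S - {k}) (x, B)" using eq by simp
    also have "\<dots> \<subseteq> loc ?A (x k)"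
    proof (rule calg_subset_loc[OF v _ xA(1)[OF k]])
      fix l assume "l \<in> S" "l \<notin> S - {k}"
      then have "l = k" by blast
      then show "inverse (x l) \<in> loc ?A (x k)" using inverse_in_loc[OF sring_calg xA(2)[OF k]] by simp
    qed auto
    finally show ?thesis .
  qed
  from separating_comax[OF v sep] obtain a b where
    "a \<in> ?A" "b \<in> ?A" "a * x i + b * x j = 1" unfolding comax_def by blast
  from coprimal_comaximal[OF sring_calg this]
  have "coprimal ?A (x i) (x j)" .
  from coprimal_loc[OF sring_calg xA(1)[OF ij(1)] xA(1)[OF ij(2)] this]
  show "ubound N S (x, B) \<subseteq> ?A" using sub[OF ij(1) IH(1)] sub[OF ij(2) IH(2)] by blast
  show "?A \<subseteq> ubound N S (x, B)" by (rule calg_subset_ubound[OF v])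
qed

lemma no_edges_entries:
  assumes v: "valid N S (x, B)" and "quiver_edges S B = {}" "i \<in> S" "k \<in> S"
  shows "B i k = 0"
proof -
  have "B i k \<le> 0" "B k i \<le> 0" using assms(2-) by (auto simp: quiver_edges_def not_less)
  with valid_simps(7)[OF v assms(3,4)] show ?thesis by simp
qed

text \<open>Since upper bounds grow when an index is frozen, so do the algebras that satisfy this
  equality; the point count relies on that inclusion.\<close>

theorem louise_calg_eq_ubound:
  assumes "louise N S s" "valid N S s"
  shows "calg N S s = ubound N S s"
  using assms
proof (induction rule: louise.induct)
  case (no_edges x B S s)
  have v: "valid N S (x, B)" by (rule seeds_valid[OF no_edges.prems no_edges.hyps(1)])
  have "calg N S (x, B) = ubound N S (x, B)"
    by (rule no_edges_calg(1)[OF v no_edges_entries[OF v no_edges.hyps(2)]])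
  then show ?case
    using calg_seeds[OF no_edges.prems no_edges.hyps(1)] seeds_ubound[OF no_edges.prems no_edges.hyps(1)]
    by simp
next
  case (separating x B S s i j)
  have v: "valid N S (x, B)" by (rule seeds_valid[OF separating.prems separating.hyps(1)])
  have "calg N S (x, B) = ubound N S (x, B)"
    by (rule separating_ubound[OF v separating.hyps(2)]; rule separating.IH; rule valid_subset[OF v]; blast)
  then show ?case
    using calg_seeds[OF separating.prems separating.hyps(1)]
      seeds_ubound[OF separating.prems separating.hyps(1)]
    by simp
qed

subsection \<open>Ring homomorphisms\<close>

text \<open>Homomorphisms without the extensionality required by \<open>ring_points\<close>, so that
  restricting and extending them needs no bookkeeping outside of \<open>A\<close>.\<close>

definition hom_on :: "'f::field set \<Rightarrow> ('c, 'd) ring_scheme \<Rightarrow> ('f \<Rightarrow> 'c) \<Rightarrow> bool" where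
  "hom_on A R \<phi> \<longleftrightarrow> \<phi> \<in> Ring.ring_hom ((ring_of_type_algebra :: 'f ring)\<lparr>carrier := A\<rparr>) R"

lemma hom_on_iff:
  "hom_on A R \<phi> \<longleftrightarrow> (\<forall>a\<in>A. \<phi> a \<in> carrier R) \<and>
     (\<forall>a\<in>A. \<forall>b\<in>A. \<phi> (a * b) = \<phi> a \<otimes>\<^bsub>R\<^esub> \<phi> b \<and> \<phi> (a + b) = \<phi> a \<oplus>\<^bsub>R\<^esub> \<phi> b) \<and> \<phi> 1 = \<one>\<^bsub>R\<^esub>"
  unfolding hom_on_def Ring.ring_hom_def by (auto simp: ring_of_type_algebra_def Pi_def)

lemma ring_points_iff: "\<phi> \<in> ring_points A R \<longleftrightarrow> hom_on A R \<phi> \<and> \<phi> \<in> extensional A"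
  by (simp add: ring_points_def hom_on_def)

lemma hom_onD:
  assumes "hom_on A R \<phi>"
  shows "a \<in> A \<Longrightarrow> \<phi> a \<in> carrier R"
    and "a \<in> A \<Longrightarrow> b \<in> A \<Longrightarrow> \<phi> (a * b) = \<phi> a \<otimes>\<^bsub>R\<^esub> \<phi> b"
    and "a \<in> A \<Longrightarrow> b \<in> A \<Longrightarrow> \<phi> (a + b) = \<phi> a \<oplus>\<^bsub>R\<^esub> \<phi> b"
    and "\<phi> 1 = \<one>\<^bsub>R\<^esub>"
  using assms unfolding hom_on_iff by blast+

lemma hom_on_subset: "hom_on A R \<phi> \<Longrightarrow> B \<subseteq> A \<Longrightarrow> hom_on B R \<phi>"
  unfolding hom_on_iff by (meson subsetD)

lemma hom_on_cong:
  assumes "hom_on A R \<phi>" "sring A" "\<And>a. a \<in> A \<Longrightarrow> \<phi> a = \<psi> a"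
  shows "hom_on A R \<psi>"
  unfolding hom_on_iff
proof (intro conjI ballI)
  note h = hom_onD[OF assms(1)]
  show "\<psi> a \<in> carrier R" if "a \<in> A" for a using h(1)[OF that] assms(3)[OF that] by simp
  show "\<psi> (a * b) = \<psi> a \<otimes>\<^bsub>R\<^esub> \<psi> b" if "a \<in> A" "b \<in> A" for a b
    using h(2)[OF that] assms(3)[OF that(1)] assms(3)[OF that(2)] assms(3)[OF sring_mult[OF assms(2) that]] by simp
  show "\<psi> (a + b) = \<psi> a \<oplus>\<^bsub>R\<^esub> \<psi> b" if "a \<in> A" "b \<in> A" for a b
    using h(3)[OF that] assms(3)[OF that(1)] assms(3)[OF that(2)] assms(3)[OF sring_add[OF assms(2) that]] by simp
  show "\<psi> 1 = \<one>\<^bsub>R\<^esub>" using h(4) assms(3)[OF sring_one[OF assms(2)]] by simp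
qed

lemma hom_on_restrict: "hom_on A R \<phi> \<Longrightarrow> sring A \<Longrightarrow> hom_on A R (restrict \<phi> A)"
  by (rule hom_on_cong) auto

context cring
begin

lemma hom_on_zero:
  assumes "hom_on A R \<phi>" "sring A"
  shows "\<phi> 0 = \<zero>"
proof -
  note z = sring_zero[OF assms(2)]
  have "\<phi> 0 \<oplus> \<phi> 0 = \<phi> 0" using hom_onD(3)[OF assms(1) z z] by simp
  then show ?thesis using hom_onD(1)[OF assms(1) z] by (metis add.l_cancel_one')
qed

lemma hom_on_uminus:
  assumes "hom_on A R \<phi>" "sring A" "a \<in> A"
  shows "\<phi> (- a) = \<ominus> \<phi> a"
proof -
  note ma = sring_uminus[OF assms(2,3)]
  have "\<phi> (- a) \<oplus> \<phi> a = \<zero>"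
    using hom_onD(3)[OF assms(1) ma assms(3)] hom_on_zero[OF assms(1,2)] by simp
  then show ?thesis
    using minus_equality hom_onD(1)[OF assms(1) ma] hom_onD(1)[OF assms(1,3)] by simp
qed

lemma hom_on_power:
  assumes "hom_on A R \<phi>" "sring A" "a \<in> A"
  shows "\<phi> (a ^ n) = \<phi> a [^] n"
proof (induction n)
  case 0
  then show ?case using hom_onD(4)[OF assms(1)] by simp
next
  case (Suc n)
  have "\<phi> (a ^ Suc n) = \<phi> (a ^ n * a)" by (simp only: power_Suc2)
  also have "\<dots> = \<phi> (a ^ n) \<otimes> \<phi> a"
    by (rule hom_onD(2)[OF assms(1) sring_power[OF assms(2,3)] assms(3)])
  finally show ?case using Suc by simp
qed

lemma hom_on_prod:
  assumes "hom_on A R \<phi>" "sring A" "finite I" "\<And>i. i \<in> I \<Longrightarrow> f i \<in> A"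
  shows "\<phi> (\<Prod>i\<in>I. f i) = (\<Otimes>i\<in>I. \<phi> (f i))"
  using assms(3,4)
proof (induction I rule: finite_induct)
  case empty
  then show ?case using hom_onD(4)[OF assms(1)] by simp
next
  case (insert i I)
  have mem: "f i \<in> A" "(\<Prod>i\<in>I. f i) \<in> A" using insert.prems by (auto intro: sring_prod[OF assms(2)])
  have "\<phi> (\<Prod>i\<in>insert i I. f i) = \<phi> (f i) \<otimes> \<phi> (\<Prod>i\<in>I. f i)"
    using insert.hyps hom_onD(2)[OF assms(1) mem] by simp
  also have "\<phi> (\<Prod>i\<in>I. f i) = (\<Otimes>i\<in>I. \<phi> (f i))" by (rule insert.IH) (use insert.prems in auto)
  also have "\<phi> (f i) \<otimes> (\<Otimes>i\<in>I. \<phi> (f i)) = (\<Otimes>i\<in>insert i I. \<phi> (f i))"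
    by (rule finprod_insert[symmetric]) (use insert hom_onD(1)[OF assms(1)] in auto)
  finally show ?case .
qed

lemma hom_on_gen_unique:
  assumes \<phi>: "hom_on (gen G) R \<phi>" and \<psi>: "hom_on (gen G) R \<psi>"
    and eq: "\<And>a. a \<in> G \<Longrightarrow> \<phi> a = \<psi> a" and a: "a \<in> gen G"
  shows "\<phi> a = \<psi> a"
  using a
proof (induction rule: gen.induct)
  case gen_one
  then show ?case using hom_onD(4)[OF \<phi>] hom_onD(4)[OF \<psi>] by simp
next
  case (gen_diff a b)
  have mb: "- b \<in> gen G" using gen_diff.hyps by (simp add: sring_uminus)
  have "\<phi> (a - b) = \<phi> a \<oplus> \<ominus> \<phi> b" "\<psi> (a - b) = \<psi> a \<oplus> \<ominus> \<psi> b"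
    using hom_onD(3)[OF \<phi> gen_diff.hyps(1) mb] hom_onD(3)[OF \<psi> gen_diff.hyps(1) mb]
      hom_on_uminus[OF \<phi> _ gen_diff.hyps(2)] hom_on_uminus[OF \<psi> _ gen_diff.hyps(2)] by simp_all
  with gen_diff.IH show ?case by simp
next
  case (gen_mult a b)
  then show ?case using hom_onD(2)[OF \<phi>] hom_onD(2)[OF \<psi>] by simp
qed (rule eq)

text \<open>The graph of the extension is generated as a subring of the product; it is functional since
  \<open>t\<close> satisfies no relation over \<open>A\<close>.\<close>

context
  fixes A :: "'f::field set" and t P :: 'f and \<phi> :: "'f \<Rightarrow> 'a" and a b :: 'a
  assumes A: "sring A" and t: "transc A t" and P: "P \<in> A" "P \<noteq> 0"
    and \<phi>: "hom_on A R \<phi>" and ab: "a \<in> carrier R" "b \<in> carrier R" "a \<otimes> b = \<phi> P"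
begin

text \<open>The elements \<open>g n\<close> form a basis of \<open>A[t, P / t]\<close> over
  \<open>A\<close>: a factor \<open>t\<close> and a factor \<open>P / t\<close> cancel to
  \<open>P\<close>, so one kind suffices in each term. \<open>h n\<close> is the intended image of
  \<open>g n\<close>.\<close>

private definition g :: "int \<Rightarrow> 'f" where
  "g n = (if n \<ge> 0 then t ^ nat n else (P / t) ^ nat (- n))"

private definition h :: "int \<Rightarrow> 'a" where
  "h n = (if n \<ge> 0 then a [^] nat n else b [^] nat (- n))"

private inductive graph :: "'f \<Rightarrow> 'a \<Rightarrow> bool" where
  graph_zero: "graph 0 \<zero>"
| graph_add: "graph u w \<Longrightarrow> c \<in> A \<Longrightarrow> graph (u + c * g n) (w \<oplus> \<phi> c \<otimes> h n)"

private lemma g_nat: "g (int m) = t ^ m" "g (- int m) = (P / t) ^ m"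
  by (auto simp: g_def)

private lemma h_nat: "h (int m) = a [^] m" "h (- int m) = b [^] m"
  by (cases "m = 0"; simp add: h_def del: pow_nat)+

private lemma h_closed [simp]: "h n \<in> carrier R"
  using ab by (cases n rule: int_cases2) (simp_all add: h_nat)

private lemma \<phi>_closed: "c \<in> A \<Longrightarrow> \<phi> c \<in> carrier R"
  by (rule hom_onD(1)[OF \<phi>])

private lemma t_nonzero: "t \<noteq> 0"
  by (rule transc_nonzero[OF t A])

private lemma graph_closed: "graph u w \<Longrightarrow> w \<in> carrier R"
  by (induction rule: graph.induct) (auto simp: \<phi>_closed)

private lemma graph_plus: "graph u w \<Longrightarrow> graph u' w' \<Longrightarrow> graph (u + u') (w \<oplus> w')"
proof (rotate_tac, induction rule: graph.induct)
  case graph_zero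
  then show ?case using graph_closed[of u w] by simp
next
  case (graph_add u' w' c n)
  then have "graph (u + u' + c * g n) (w \<oplus> w' \<oplus> \<phi> c \<otimes> h n)" by (intro graph.graph_add)
  then show ?case
    using graph_add graph_closed by (simp add: add.assoc a_assoc \<phi>_closed)
qed

private lemma graph_term: "c \<in> A \<Longrightarrow> graph (c * g n) (\<phi> c \<otimes> h n)"
  using graph_add[OF graph_zero, of c n] by (simp add: \<phi>_closed)

private lemma graph_scale:
  assumes "graph u w" "c \<in> A"
  shows "graph (c * u) (\<phi> c \<otimes> w)"
  using assms(1)
proof (induction rule: graph.induct)
  case graph_zero
  then show ?case using graph.graph_zero assms(2) by (simp add: \<phi>_closed)
next
  case (graph_add u w d n)
  have cd: "c * d \<in> A" by (rule sring_mult[OF A assms(2) graph_add.hyps(2)])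
  have "graph (c * u + (c * d) * g n) (\<phi> c \<otimes> w \<oplus> \<phi> (c * d) \<otimes> h n)"
    by (rule graph.graph_add[OF graph_add.IH cd])
  moreover have "\<phi> (c * d) = \<phi> c \<otimes> \<phi> d" by (rule hom_onD(2)[OF \<phi> assms(2) graph_add.hyps(2)])
  ultimately show ?case
    using graph_closed[OF graph_add.hyps(1)] graph_add.hyps(2) assms(2)
    by (simp add: algebra_simps r_distr m_assoc \<phi>_closed)
qed

text \<open>A step away from exponent 0 is free; a step towards 0 cancels a factor \<open>t\<close>
  against a factor \<open>P / t\<close> and leaves \<open>P\<close>.\<close>

private lemma g_Suc:
  "t * g n = (if n \<ge> 0 then g (n + 1) else P * g (n + 1))"
  "P / t * g n = (if n \<le> 0 then g (n - 1) else P * g (n - 1))"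
proof -
  show "t * g n = (if n \<ge> 0 then g (n + 1) else P * g (n + 1))"
  proof (cases n rule: int_cases)
    case (nonneg m)
    then show ?thesis using g_nat(1)[of m] g_nat(1)[of "Suc m"] by (simp add: add.commute)
  next
    case (neg m)
    then show ?thesis using g_nat(2)[of m] g_nat(2)[of "Suc m"] t_nonzero by simp
  qed
  show "P / t * g n = (if n \<le> 0 then g (n - 1) else P * g (n - 1))"
  proof (cases "- n" rule: int_cases)
    case (nonneg m)
    then have n: "n = - int m" by simp
    have e: "- int m - 1 = - int (Suc m)" by simp
    show ?thesis unfolding n e g_nat by simp
  next
    case (neg m)
    then have n: "n = int (Suc m)" by simp
    show ?thesis using g_nat(1)[of m] g_nat(1)[of "Suc m"] t_nonzero unfolding n by simp
  qed
qed

private lemma h_Suc: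
  "a \<otimes> h n = (if n \<ge> 0 then h (n + 1) else \<phi> P \<otimes> h (n + 1))"
  "b \<otimes> h n = (if n \<le> 0 then h (n - 1) else \<phi> P \<otimes> h (n - 1))"
proof -
  show "a \<otimes> h n = (if n \<ge> 0 then h (n + 1) else \<phi> P \<otimes> h (n + 1))"
  proof (cases n rule: int_cases)
    case (nonneg m)
    then show ?thesis using h_nat(1)[of m] h_nat(1)[of "Suc m"] ab
      by (simp add: add.commute m_comm del: pow_nat)
  next
    case (neg m)
    have "a \<otimes> (b [^] m \<otimes> b) = (a \<otimes> b) \<otimes> b [^] m" using ab(1,2) by (simp add: m_ac)
    with neg show ?thesis using h_nat(2)[of m] h_nat(2)[of "Suc m"] ab by simp
  qed
  show "b \<otimes> h n = (if n \<le> 0 then h (n - 1) else \<phi> P \<otimes> h (n - 1))"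
  proof (cases "- n" rule: int_cases)
    case (nonneg m)
    then have n: "n = - int m" by simp
    have e: "- int m - 1 = - int (Suc m)" by simp
    show ?thesis unfolding n e h_nat using ab by (simp add: m_comm)
  next
    case (neg m)
    then have n: "n = int (Suc m)" by simp
    have "b \<otimes> (a [^] m \<otimes> a) = (a \<otimes> b) \<otimes> a [^] m" using ab(1,2) by (simp add: m_ac)
    then show ?thesis using h_nat(1)[of m] h_nat(1)[of "Suc m"] ab unfolding n by simp
  qed
qed

private lemma graph_Suc:
  assumes "graph u w"
  shows "graph (t * u) (a \<otimes> w)" "graph (P / t * u) (b \<otimes> w)"
proof -
  \<comment> \<open>\<open>sd\<close> states that multiplication by \<open>s\<close> on the elements
    \<open>g n\<close> is matched by multiplication by \<open>d\<close> on the \<open>h n\<close>,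
    with the same coefficient \<open>e\<close> on both sides.\<close>
  have step: "graph (s * u) (d \<otimes> w)"
    if d: "d \<in> carrier R" and sd: "\<And>n. \<exists>e\<in>A. \<exists>m. s * g n = e * g m \<and> d \<otimes> h n = \<phi> e \<otimes> h m" for s d
    using assms
  proof (induction rule: graph.induct)
    case graph_zero
    then show ?case using graph.graph_zero d by simp
  next
    case (graph_add u w c n)
    from sd[of n] obtain e m where e: "e \<in> A" "s * g n = e * g m" "d \<otimes> h n = \<phi> e \<otimes> h m" by blast
    have ce: "c * e \<in> A" by (rule sring_mult[OF A graph_add.hyps(2) e(1)])
    have "graph (s * u + (c * e) * g m) (d \<otimes> w \<oplus> \<phi> (c * e) \<otimes> h m)"
      by (rule graph.graph_add[OF graph_add.IH ce])
    moreover have "s * u + (c * e) * g m = s * (u + c * g n)"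
      using e(2) by (simp add: algebra_simps)
    moreover have "d \<otimes> w \<oplus> \<phi> (c * e) \<otimes> h m = d \<otimes> (w \<oplus> \<phi> c \<otimes> h n)"
    proof -
      have cl: "\<phi> c \<in> carrier R" "\<phi> e \<in> carrier R" "w \<in> carrier R"
        using graph_add.hyps e(1) graph_closed by (auto simp: \<phi>_closed)
      have "\<phi> (c * e) \<otimes> h m = \<phi> c \<otimes> (\<phi> e \<otimes> h m)"
        using hom_onD(2)[OF \<phi> graph_add.hyps(2) e(1)] cl by (simp add: m_assoc)
      also have "\<dots> = d \<otimes> (\<phi> c \<otimes> h n)"
        unfolding e(3)[symmetric] by (rule m_lcomm) (use cl d in simp_all)
      finally show ?thesis using cl d by (simp add: r_distr)
    qed
    ultimately show ?case by simp
  qed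
  have one: "\<phi> 1 \<otimes> h n = h n" for n using hom_onD(4)[OF \<phi>] by simp
  show "graph (t * u) (a \<otimes> w)"
  proof (rule step[OF ab(1)])
    fix n
    show "\<exists>e\<in>A. \<exists>m. t * g n = e * g m \<and> a \<otimes> h n = \<phi> e \<otimes> h m"
      by (rule bexI[of _ "if n \<ge> 0 then 1 else P"], rule exI[of _ "n + 1"])
         (use g_Suc(1)[of n] h_Suc(1)[of n] P sring_one[OF A] in \<open>simp_all add: one\<close>)
  qed
  show "graph (P / t * u) (b \<otimes> w)"
  proof (rule step[OF ab(2)])
    fix n
    show "\<exists>e\<in>A. \<exists>m. P / t * g n = e * g m \<and> b \<otimes> h n = \<phi> e \<otimes> h m"
      by (rule bexI[of _ "if n \<le> 0 then 1 else P"], rule exI[of _ "n - 1"])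
         (use g_Suc(2)[of n] h_Suc(2)[of n] P sring_one[OF A] in \<open>simp_all add: one\<close>)
  qed
qed

private lemma graph_power:
  assumes "graph u w"
  shows "graph (g n * u) (h n \<otimes> w)"
proof -
  have w: "w \<in> carrier R" by (rule graph_closed[OF assms])
  have "graph (t ^ m * u) (a [^] m \<otimes> w)" for m :: nat
  proof (induction m)
    case (Suc m)
    from graph_Suc(1)[OF Suc] show ?case using ab w by (simp add: mult.assoc m_ac)
  qed (use assms w in simp)
  moreover have "graph ((P / t) ^ m * u) (b [^] m \<otimes> w)" for m :: nat
  proof (induction m)
    case (Suc m)
    from graph_Suc(2)[OF Suc] show ?case using ab w by (simp add: mult.assoc m_ac)
  qed (use assms w in simp)
  ultimately show ?thesis by (cases n rule: int_cases2) (simp_all add: g_nat h_nat)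
qed

private lemma graph_mult:
  assumes "graph u w" "graph u' w'"
  shows "graph (u * u') (w \<otimes> w')"
  using assms(1)
proof (induction rule: graph.induct)
  case graph_zero
  then show ?case using graph.graph_zero graph_closed[OF assms(2)] by simp
next
  case (graph_add u w c n)
  have cl: "\<phi> c \<in> carrier R" "w \<in> carrier R" "w' \<in> carrier R"
    using graph_add.hyps graph_closed assms(2) by (auto simp: \<phi>_closed)
  have "graph (u * u' + c * (g n * u')) (w \<otimes> w' \<oplus> \<phi> c \<otimes> (h n \<otimes> w'))"
    by (intro graph_plus graph_add.IH graph_scale graph_power assms(2) graph_add.hyps)
  then show ?case using cl by (simp add: algebra_simps l_distr m_assoc)
qed

text \<open>Terms with equal exponent are collected, simultaneously on both sides, so that the
  transcendence of \<open>t\<close> becomes applicable.\<close>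

private lemma graph_normal_form:
  assumes "graph u w"
  shows "\<exists>F c. finite F \<and> (\<forall>n. c n \<in> A) \<and> u = (\<Sum>n\<in>F. c n * g n) \<and> w = (\<Oplus>n\<in>F. \<phi> (c n) \<otimes> h n)"
  using assms
proof (induction rule: graph.induct)
  case graph_zero
  then show ?case using sring_zero[OF A] by (intro exI[of _ "{}"] exI[of _ "\<lambda>_. 0"]) simp
next
  case (graph_add u w d m)
  then obtain F c where F: "finite F" "\<forall>n. c n \<in> A" "u = (\<Sum>n\<in>F. c n * g n)"
    "w = (\<Oplus>n\<in>F. \<phi> (c n) \<otimes> h n)" by blast
  define c0 where "c0 = (\<lambda>n. if n \<in> F then c n else 0)"
  have c0: "c0 n \<in> A" for n using F(2) sring_zero[OF A] by (simp add: c0_def)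
  have \<phi>0: "\<phi> 0 = \<zero>" by (rule hom_on_zero[OF \<phi> A])
  have u: "u = (\<Sum>n\<in>insert m F. c0 n * g n)"
    unfolding F(3) by (rule sum.mono_neutral_cong_left) (use F(1) in \<open>auto simp: c0_def\<close>)
  have w: "w = (\<Oplus>n\<in>insert m F. \<phi> (c0 n) \<otimes> h n)"
    unfolding F(4)
    by (rule add.finprod_mono_neutral_cong_left) (use F \<phi>0 \<phi>_closed c0 in \<open>auto simp: c0_def\<close>)
  define c' where "c' = (\<lambda>n. c0 n + (if m = n then d else 0))"
  have dn: "(if m = n then d else 0) \<in> A" for n using graph_add.hyps(2) sring_zero[OF A] by simp
  show ?case
  proof (intro exI conjI allI)
    show "finite (insert m F)" using F by simp
    show "c' n \<in> A" for n unfolding c'_def by (intro sring_add[OF A] c0 dn)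
    have "(\<Sum>n\<in>insert m F. c' n * g n) = u + (\<Sum>n\<in>insert m F. (if m = n then d else 0) * g n)"
      unfolding u c'_def by (simp only: distrib_right sum.distrib)
    also have "(\<Sum>n\<in>insert m F. (if m = n then d else 0) * g n) = d * g m"
      using F(1) by (simp add: if_distrib[of "\<lambda>x. x * _"] cong: if_cong)
    finally show "u + d * g m = (\<Sum>n\<in>insert m F. c' n * g n)" by simp
    have "(\<Oplus>n\<in>insert m F. \<phi> (c' n) \<otimes> h n)
        = (\<Oplus>n\<in>insert m F. \<phi> (c0 n) \<otimes> h n \<oplus> (if m = n then \<phi> d \<otimes> h n else \<zero>))"
      by (rule finsum_cong')
        (use c0 dn graph_add.hyps(2) in \<open>auto simp: c'_def hom_onD(3)[OF \<phi> c0] \<phi>_closed l_distr \<phi>0\<close>)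
    also have "\<dots> = w \<oplus> (\<Oplus>n\<in>insert m F. if m = n then \<phi> d \<otimes> h n else \<zero>)"
      unfolding w by (rule finsum_addf) (use c0 graph_add.hyps(2) in \<open>auto simp: \<phi>_closed\<close>)
    also have "(\<Oplus>n\<in>insert m F. if m = n then \<phi> d \<otimes> h n else \<zero>) = \<phi> d \<otimes> h m"
      by (rule finsum_singleton) (use F(1) graph_add.hyps(2) in \<open>auto simp: \<phi>_closed\<close>)
    finally show "w \<oplus> \<phi> d \<otimes> h m = (\<Oplus>n\<in>insert m F. \<phi> (c' n) \<otimes> h n)" by simp
  qed
qed

private lemma graph_zero_unique:
  assumes "graph 0 w"
  shows "w = \<zero>"
proof -
  from graph_normal_form[OF assms] obtain F c where F: "finite F" "\<forall>n. c n \<in> A"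
    "0 = (\<Sum>n\<in>F. c n * g n)" "w = (\<Oplus>n\<in>F. \<phi> (c n) \<otimes> h n)" by blast
  \<comment> \<open>Written in powers of \<open>t\<close>, the coefficient at \<open>n\<close> gains
    the factor \<open>P ^ nat (- n)\<close>, which is 1 for nonnegative \<open>n\<close>; as
    \<open>P\<close> is nonzero, \<open>c n\<close> vanishes together with
    \<open>e n\<close>.\<close>
  define e where "e n = c n * P ^ nat (- n)" for n
  have "c n * g n = e n * t powi n" for n
    using t_nonzero by (auto simp: g_def e_def power_int_def field_simps)
  then have eq: "(\<Sum>n\<in>F. e n * t powi n) = 0" using F(3) by simp
  have eA: "e n \<in> A" for n unfolding e_def using F(2) P by (intro sring_mult[OF A] sring_power[OF A]) auto
  have "c n = 0" if "n \<in> F" for n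
    using transcD[OF t F(1) eA eq that] P(2) by (simp add: e_def)
  then have "w = (\<Oplus>n\<in>F. \<zero>)" unfolding F(4)
    by (intro finsum_cong') (auto simp: hom_on_zero[OF \<phi> A])
  then show ?thesis by simp
qed

private lemma graph_unique:
  assumes "graph u w" "graph u w'"
  shows "w = w'"
proof -
  have m1: "- 1 \<in> A" by (rule sring_uminus[OF A sring_one[OF A]])
  have "graph (u + (- 1) * u) (w \<oplus> \<phi> (- 1) \<otimes> w')"
    by (intro graph_plus graph_scale assms m1)
  then have "w \<oplus> \<phi> (- 1) \<otimes> w' = \<zero>" using graph_zero_unique by simp
  moreover have "\<phi> (- 1) = \<ominus> \<one>" using hom_on_uminus[OF \<phi> A sring_one[OF A]] hom_onD(4)[OF \<phi>] by simp
  ultimately have "w \<oplus> \<ominus> w' = \<zero>" using graph_closed[OF assms(2)] by (simp add: l_minus)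
  then show ?thesis using graph_closed[OF assms(1)] graph_closed[OF assms(2)]
    by (metis a_minus_def r_right_minus_eq)
qed

text \<open>\<open>A[t, P / t]\<close> is the quotient of the polynomial ring \<open>A[Y, Z]\<close>
  by \<open>Y * Z - P\<close>, so any two images whose product is the image of \<open>P\<close> are
  admissible.\<close>

lemma hom_on_extend:
  "\<exists>\<psi>. hom_on (gen (A \<union> {t, P / t})) R \<psi> \<and> (\<forall>c\<in>A. \<psi> c = \<phi> c) \<and> \<psi> t = a \<and> \<psi> (P / t) = b"
proof -
  define \<psi> where "\<psi> u = (THE w. graph u w)" for u
  have \<psi>: "\<psi> u = w" if "graph u w" for u w
    unfolding \<psi>_def using that graph_unique by blast
  have A_graph: "graph c (\<phi> c)" if "c \<in> A" for c
    using graph_term[OF that, of 0] that by (simp add: g_def h_def \<phi>_closed)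
  have one: "graph 1 \<one>" using A_graph[OF sring_one[OF A]] hom_onD(4)[OF \<phi>] by simp
  have t_graph: "graph t a" "graph (P / t) b"
    using graph_Suc[OF one] ab by simp_all
  have sr: "sring {u. \<exists>w. graph u w}"
    unfolding sring_def
  proof (intro conjI ballI)
    show "1 \<in> {u. \<exists>w. graph u w}" using one by blast
    fix u u' assume "u \<in> {u. \<exists>w. graph u w}" "u' \<in> {u. \<exists>w. graph u w}"
    then obtain w w' where w: "graph u w" "graph u' w'" by blast
    have m1: "- 1 \<in> A" by (rule sring_uminus[OF A sring_one[OF A]])
    from graph_plus[OF w(1) graph_scale[OF w(2) m1]] show "u - u' \<in> {u. \<exists>w. graph u w}" by auto
    from graph_mult[OF w] show "u * u' \<in> {u. \<exists>w. graph u w}" by blast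
  qed
  have "gen (A \<union> {t, P / t}) \<subseteq> {u. \<exists>w. graph u w}"
    by (rule gen_least[OF sr]) (use A_graph t_graph in blast)
  then have ex: "graph u (\<psi> u)" if "u \<in> gen (A \<union> {t, P / t})" for u
    using that \<psi> by blast
  have "hom_on (gen (A \<union> {t, P / t})) R \<psi>"
    unfolding hom_on_iff
  proof (intro conjI ballI)
    show "\<psi> u \<in> carrier R" if "u \<in> gen (A \<union> {t, P / t})" for u by (rule graph_closed[OF ex[OF that]])
    show "\<psi> (u * u') = \<psi> u \<otimes> \<psi> u'" "\<psi> (u + u') = \<psi> u \<oplus> \<psi> u'"
      if "u \<in> gen (A \<union> {t, P / t})" "u' \<in> gen (A \<union> {t, P / t})" for u u'
      by (rule \<psi>, rule graph_mult graph_plus; rule ex[OF that(1)] ex[OF that(2)])+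
    show "\<psi> 1 = \<one>" by (rule \<psi>[OF one])
  qed
  then show ?thesis using \<psi> A_graph t_graph by blast
qed

end

end

text \<open>In characteristic 0 the prime ring is a copy of the integers. This is the start of the
  construction of points, one variable at a time.\<close>

lemma (in ring) hom_on_Ints:
  "\<exists>\<phi>. hom_on (gen ({} :: 'f::field_char_0 set)) R \<phi>"
proof -
  define \<phi> :: "'f \<Rightarrow> 'a" where "\<phi> x = [(THE n. x = of_int n)] \<cdot> \<one>" for x
  have \<phi>: "\<phi> (of_int n) = [n] \<cdot> \<one>" for n by (simp add: \<phi>_def)
  have "sring (range (of_int :: int \<Rightarrow> 'f))"
    unfolding sring_def by (auto intro: range_eqI[of _ _ 1] simp flip: of_int_diff of_int_mult)
  then have sub: "gen ({} :: 'f set) \<subseteq> range of_int" by (rule gen_least) simp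
  have cl: "[n] \<cdot> \<one> \<in> carrier R" for n :: int by simp
  have "hom_on (range (of_int :: int \<Rightarrow> 'f)) R \<phi>"
    unfolding hom_on_iff
  proof (intro conjI ballI)
    fix x y :: 'f assume "x \<in> range of_int" "y \<in> range of_int"
    then obtain m n where mn: "x = of_int m" "y = of_int n" by blast
    have "add_pow R m \<one> \<otimes> add_pow R n \<one> = add_pow R m (add_pow R n \<one>)"
      by (simp add: add_pow_ldistr_int)
    also have "\<dots> = [(m * n)] \<cdot> \<one>" by (simp add: add.int_pow_pow mult.commute)
    finally show "\<phi> (x * y) = \<phi> x \<otimes> \<phi> y" by (simp only: mn \<phi> of_int_mult[symmetric])
    show "\<phi> (x + y) = \<phi> x \<oplus> \<phi> y"
      using add.int_pow_mult[of \<one> m n] by (simp only: mn \<phi> of_int_add[symmetric] one_closed)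
  next
    show "\<phi> 1 = \<one>" using \<phi>[of 1] by simp
  qed (auto simp: \<phi>)
  then show ?thesis using hom_on_subset[OF _ sub] by blast
qed

subsection \<open>Points of localizations\<close>

context
  fixes R :: "('c, 'd) ring_scheme" (structure) and A A' :: "'f::field set" and w :: 'f
  assumes R: "Ring.field R" and A: "sring A" and A': "sring A'" and sub: "A \<subseteq> A'" and w: "w \<in> A" "w \<noteq> 0"
    and inv_w: "inverse w \<in> A'" and loc: "A' \<subseteq> loc A w"
begin

interpretation Ring.field R by (rule R)

private lemma w_hom_nonzero:
  assumes "hom_on A' R \<psi>"
  shows "\<psi> w \<noteq> \<zero>"
proof
  assume "\<psi> w = \<zero>"
  moreover have "\<psi> w \<otimes> \<psi> (inverse w) = \<one>"
    using hom_onD(2)[OF assms, of w "inverse w"] hom_onD(4)[OF assms] w inv_w sub by auto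
  ultimately show False using hom_onD(1)[OF assms inv_w] by simp
qed

private lemma loc_points_inj: "inj_on (\<lambda>\<psi>. restrict \<psi> A) (ring_points A' R)"
proof (rule inj_onI)
  fix \<phi> \<psi> assume \<phi>: "\<phi> \<in> ring_points A' R" and \<psi>: "\<psi> \<in> ring_points A' R"
    and eq: "restrict \<phi> A = restrict \<psi> A"
  have h: "hom_on A' R \<phi>" "hom_on A' R \<psi>" using \<phi> \<psi> by (auto simp: ring_points_iff)
  have eqA: "\<phi> a = \<psi> a" if "a \<in> A" for a using fun_cong[OF eq, of a] that by simp
  have "\<phi> f = \<psi> f" if f: "f \<in> A'" for f
  proof -
    obtain n where n: "w ^ n * f \<in> A" using f loc by (auto simp: loc_def)
    have wn: "w ^ n \<in> A" by (rule sring_power[OF A w(1)])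
    have wn': "w ^ n \<in> A'" using wn sub by blast
    have "\<phi> (w ^ n) \<otimes> \<phi> f = \<phi> (w ^ n) \<otimes> \<psi> f"
      using hom_onD(2)[OF h(1) wn' f] hom_onD(2)[OF h(2) wn' f] eqA[OF n] eqA[OF wn] by simp
    moreover have "\<phi> (w ^ n) \<noteq> \<zero>"
    proof -
      have "\<phi> (w ^ n) = \<phi> w [^] n" using hom_on_power[OF h(1) A'] w sub by blast
      moreover have "\<phi> w [^] n \<noteq> \<zero>"
      proof (induction n)
        case (Suc n)
        moreover have "\<phi> w \<in> carrier R" using hom_onD(1)[OF h(1)] w(1) sub by blast
        ultimately show ?case using w_hom_nonzero[OF h(1)] by (simp add: integral_iff)
      qed simp
      ultimately show ?thesis by simp
    qed
    ultimately show ?thesis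
      using hom_onD(1)[OF h(1) wn'] hom_onD(1)[OF h(1) f] hom_onD(1)[OF h(2) f] m_lcancel by blast
  qed
  then show "\<phi> = \<psi>" using \<phi> \<psi> unfolding ring_points_iff by (metis extensionalityI)
qed

private lemma loc_points_surj:
  assumes \<phi>: "hom_on A R \<phi>" and nz: "\<phi> w \<noteq> \<zero>"
  shows "\<exists>\<psi>. hom_on A' R \<psi> \<and> (\<forall>a\<in>A. \<psi> a = \<phi> a)"
proof -
  define c where "c = inv (\<phi> w)"
  have pw: "\<phi> w \<in> carrier R" by (rule hom_onD(1)[OF \<phi> w(1)])
  have c: "c \<in> carrier R" "c \<otimes> \<phi> w = \<one>"
    using pw nz field_Units by (auto simp: c_def)
  \<comment> \<open>Some exponent that clears the denominator of \<open>f\<close>; by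
    \<open>key\<close> the value of \<open>\<psi>\<close> does not depend on the choice.\<close>
  define e where "e f = (SOME n. w ^ n * f \<in> A)" for f
  have e: "w ^ e f * f \<in> A" if "f \<in> A'" for f
    unfolding e_def by (rule someI_ex) (use that loc in \<open>auto simp: loc_def\<close>)
  define \<psi> where "\<psi> f = c [^] e f \<otimes> \<phi> (w ^ e f * f)" for f
  have cw: "c [^] n \<otimes> \<phi> w [^] n = \<one>" for n :: nat
    using c pw nat_pow_distrib[of c "\<phi> w" n] by simp
  have key: "\<psi> f = c [^] m \<otimes> \<phi> (w ^ m * f)" if f: "f \<in> A'" and m: "w ^ m * f \<in> A" for f m
  proof -
    have pm: "\<phi> (w ^ m * f) \<in> carrier R" and pe: "\<phi> (w ^ e f * f) \<in> carrier R"
      using hom_onD(1)[OF \<phi>] m e[OF f] by auto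
    have pow: "\<phi> (w ^ n * a) = \<phi> w [^] n \<otimes> \<phi> a" if "a \<in> A" for n a
      using hom_onD(2)[OF \<phi> sring_power[OF A w(1)] that] hom_on_power[OF \<phi> A w(1)] by simp
    have eq: "\<phi> w [^] m \<otimes> \<phi> (w ^ e f * f) = \<phi> w [^] e f \<otimes> \<phi> (w ^ m * f)"
      unfolding pow[OF e[OF f], symmetric] pow[OF m, symmetric] by (simp add: mult.left_commute)
    have "\<psi> f = (c [^] m \<otimes> \<phi> w [^] m) \<otimes> (c [^] e f \<otimes> \<phi> (w ^ e f * f))"
      using cw[of m] c pe by (simp add: \<psi>_def)
    also have "\<dots> = c [^] m \<otimes> c [^] e f \<otimes> (\<phi> w [^] m \<otimes> \<phi> (w ^ e f * f))"
      using c pw pe by (simp add: m_ac)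
    also have "\<dots> = (c [^] e f \<otimes> \<phi> w [^] e f) \<otimes> (c [^] m \<otimes> \<phi> (w ^ m * f))"
      unfolding eq using c pw pm by (simp add: m_ac)
    also have "\<dots> = c [^] m \<otimes> \<phi> (w ^ m * f)" using cw[of "e f"] c pm by simp
    finally show ?thesis .
  qed
  have common: "\<exists>m. w ^ m * f \<in> A \<and> w ^ m * f' \<in> A" if "f \<in> A'" "f' \<in> A'" for f f'
  proof (intro exI conjI)
    have "w ^ e f' * (w ^ e f * f) \<in> A" "w ^ e f * (w ^ e f' * f') \<in> A"
      by (intro sring_mult[OF A] sring_power[OF A] w e that)+
    then show "w ^ (e f + e f') * f \<in> A" "w ^ (e f + e f') * f' \<in> A"
      by (simp_all add: power_add mult_ac)
  qed
  have "hom_on A' R \<psi>"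
    unfolding hom_on_iff
  proof (intro conjI ballI)
    show "\<psi> f \<in> carrier R" if "f \<in> A'" for f
      unfolding \<psi>_def using c hom_onD(1)[OF \<phi> e[OF that]] by simp
    show "\<psi> 1 = \<one>"
      using key[of 1 0] sring_one[OF A] sring_one[OF A'] hom_onD(4)[OF \<phi>] by simp
  next
    fix f f' assume f: "f \<in> A'" and f': "f' \<in> A'"
    obtain m where m: "w ^ m * f \<in> A" "w ^ m * f' \<in> A" using common[OF f f'] by blast
    note cl = hom_onD(1)[OF \<phi> m(1)] hom_onD(1)[OF \<phi> m(2)]
    have "w ^ m * (f + f') = w ^ m * f + w ^ m * f'" by (simp add: algebra_simps)
    with key[of "f + f'" m] sring_add[OF A m] sring_add[OF A' f f'] hom_onD(3)[OF \<phi> m]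
    show "\<psi> (f + f') = \<psi> f \<oplus> \<psi> f'"
      using c cl by (simp add: key[OF f m(1)] key[OF f' m(2)] r_distr)
    have "w ^ (m + m) * (f * f') = (w ^ m * f) * (w ^ m * f')" by (simp add: power_add mult_ac)
    with key[of "f * f'" "m + m"] sring_mult[OF A m] sring_mult[OF A' f f'] hom_onD(2)[OF \<phi> m]
    have "\<psi> (f * f') = c [^] (m + m) \<otimes> (\<phi> (w ^ m * f) \<otimes> \<phi> (w ^ m * f'))" by simp
    also have "c [^] (m + m) = c [^] m \<otimes> c [^] m" using c by (simp add: nat_pow_mult)
    finally show "\<psi> (f * f') = \<psi> f \<otimes> \<psi> f'"
      using c cl by (simp add: key[OF f m(1)] key[OF f' m(2)] m_ac)
  qed
  moreover have "\<psi> a = \<phi> a" if "a \<in> A" for a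
    using key[of a 0] that sub hom_onD(1)[OF \<phi> that] by auto
  ultimately show ?thesis by blast
qed

text \<open>The hypotheses make \<open>A'\<close> the ring \<open>A\<close> with \<open>w\<close>
  inverted, and a homomorphism to a field extends to it, uniquely, as soon as the image of
  \<open>w\<close> is nonzero.\<close>

lemma loc_points:
  "bij_betw (\<lambda>\<psi>. restrict \<psi> A) (ring_points A' R) {\<phi> \<in> ring_points A R. \<phi> w \<noteq> \<zero>}"
  unfolding bij_betw_def
proof (intro conjI loc_points_inj equalityI subsetI)
  fix \<phi> assume "\<phi> \<in> (\<lambda>\<psi>. restrict \<psi> A) ` ring_points A' R"
  then obtain \<psi> where \<psi>: "hom_on A' R \<psi>" "\<phi> = restrict \<psi> A" by (auto simp: ring_points_iff)
  then show "\<phi> \<in> {\<phi> \<in> ring_points A R. \<phi> w \<noteq> \<zero>}"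
    using w_hom_nonzero[OF \<psi>(1)] w hom_on_restrict[OF hom_on_subset[OF \<psi>(1) sub] A]
    by (simp add: ring_points_iff)
next
  fix \<phi> assume \<phi>: "\<phi> \<in> {\<phi> \<in> ring_points A R. \<phi> w \<noteq> \<zero>}"
  then obtain \<psi> where \<psi>: "hom_on A' R \<psi>" "\<forall>a\<in>A. \<psi> a = \<phi> a"
    using loc_points_surj[of \<phi>] by (auto simp: ring_points_iff)
  have "\<phi> = restrict (restrict \<psi> A') A"
    using \<phi> \<psi>(2) sub by (intro extensionalityI[of \<phi> A]) (auto simp: ring_points_iff)
  moreover have "restrict \<psi> A' \<in> ring_points A' R"
    using hom_on_restrict[OF \<psi>(1) A'] by (simp add: ring_points_iff)
  ultimately show "\<phi> \<in> (\<lambda>\<psi>. restrict \<psi> A) ` ring_points A' R" by blast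
qed

end

text \<open>No point sends both \<open>x i\<close> and \<open>x j\<close> to 0, because they are
  comaximal. Points with nonzero \<open>x i\<close> are the points with \<open>i\<close> frozen, and
  similarly for \<open>j\<close> and for the product, so the cardinality of the union gives the
  formula.\<close>

lemma separating_points:
  fixes R :: "('c, 'd) ring_scheme" and x :: "nat \<Rightarrow> 'f::field" and N B
  defines "p \<equiv> \<lambda>T. ring_points (calg N T (x, B)) R"
  assumes R: "Ring.field R" and v: "valid N S (x, B)" and sep: "separating_edge (quiver_edges S B) i j"
    and eq: "calg N (S - {i}) (x, B) = ubound N (S - {i}) (x, B)"
      "calg N (S - {j}) (x, B) = ubound N (S - {j}) (x, B)"
      "calg N (S - {i, j}) (x, B) = ubound N (S - {i, j}) (x, B)"
    and fin: "finite (p (S - {i}))" "finite (p (S - {j}))"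
  shows "finite (p S)" "card (p S) + card (p (S - {i, j})) = card (p (S - {i})) + card (p (S - {j}))"
proof -
  interpret Ring.field R by (rule R)
  let ?A = "calg N S (x, B)"
  have ij: "i \<in> S" "j \<in> S" using sep by (auto simp: separating_edge_def quiver_edges_def)
  have xA: "x k \<in> ?A" "x k \<noteq> 0" if "k \<in> S" for k
    using calg_var[OF seeds.initial[of "(x, B)"], of k N S] valid_simps(1,8)[OF v] that by auto
  have bij: "bij_betw (\<lambda>\<psi>. restrict \<psi> ?A) (p (S - J)) {\<phi> \<in> p S. \<phi> w \<noteq> \<zero>\<^bsub>R\<^esub>}"
    if J: "calg N (S - J) (x, B) = ubound N (S - J) (x, B)" and w: "w \<in> ?A" "w \<noteq> 0"
      and inv: "inverse w \<in> calg N (S - J) (x, B)" "\<And>k. k \<in> S \<Longrightarrow> k \<in> J \<Longrightarrow> inverse (x k) \<in> loc ?A w"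
    for J w
    unfolding p_def
  proof (rule loc_points[OF R sring_calg sring_calg _ w inv(1)])
    have "?A \<subseteq> ubound N S (x, B)" by (rule calg_subset_ubound[OF v])
    also have "\<dots> \<subseteq> ubound N (S - J) (x, B)" by (rule ubound_mono) auto
    finally show "?A \<subseteq> calg N (S - J) (x, B)" using J by simp
    show "calg N (S - J) (x, B) \<subseteq> loc ?A w"
      by (rule calg_subset_loc[OF v _ w(1)]) (use inv(2) in auto)
  qed
  have inv: "inverse (x k) \<in> calg N (S - J) (x, B)" if "k \<in> S" "k \<in> J" for k J
    using calg_frozen[of k N "S - J" "(x, B)"] that valid_simps(1)[OF v] by auto
  have bi: "bij_betw (\<lambda>\<psi>. restrict \<psi> ?A) (p (S - {k})) {\<phi> \<in> p S. \<phi> (x k) \<noteq> \<zero>\<^bsub>R\<^esub>}"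
    if k: "k \<in> S" "calg N (S - {k}) (x, B) = ubound N (S - {k}) (x, B)" for k
  proof (rule bij[OF k(2) xA[OF k(1)] inv[OF k(1)]])
    fix l assume "l \<in> {k}"
    then show "inverse (x l) \<in> loc ?A (x k)" using inverse_in_loc[OF sring_calg xA(2)[OF k(1)]] by simp
  qed simp
  have bij2: "bij_betw (\<lambda>\<psi>. restrict \<psi> ?A) (p (S - {i, j})) {\<phi> \<in> p S. \<phi> (x i * x j) \<noteq> \<zero>\<^bsub>R\<^esub>}"
  proof (rule bij[OF eq(3)])
    show "x i * x j \<in> ?A" "x i * x j \<noteq> 0" using xA ij by (auto intro: sring_mult)
    show "inverse (x i * x j) \<in> calg N (S - {i, j}) (x, B)"
      unfolding inverse_mult_distrib by (intro sring_mult sring_calg inv ij) auto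
    fix k assume "k \<in> {i, j}"
    then consider "k = i" | "k = j" by blast
    then show "inverse (x k) \<in> loc ?A (x i * x j)"
    proof cases
      case 1
      have "(x i * x j) ^ 1 * inverse (x i) = x j" using xA(2)[OF ij(1)] by simp
      with xA(1)[OF ij(2)] 1 show ?thesis by (intro locI[of _ 1]) (simp only:)
    next
      case 2
      have "(x i * x j) ^ 1 * inverse (x j) = x i" using xA(2)[OF ij(2)] by simp
      with xA(1)[OF ij(1)] 2 show ?thesis by (intro locI[of _ 1]) (simp only:)
    qed
  qed
  define U where "U k = {\<phi> \<in> p S. \<phi> (x k) \<noteq> \<zero>\<^bsub>R\<^esub>}" for k
  have hom: "hom_on ?A R \<phi>" if "\<phi> \<in> p S" for \<phi> using that by (simp add: p_def ring_points_iff)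
  have fU: "finite (U i)" "finite (U j)" "card (U i) = card (p (S - {i}))" "card (U j) = card (p (S - {j}))"
    using bi[OF ij(1) eq(1)] bi[OF ij(2) eq(2)] fin
      bij_betw_finite[OF bi[OF ij(1) eq(1)]] bij_betw_finite[OF bi[OF ij(2) eq(2)]]
    by (auto simp: U_def dest: bij_betw_same_card)
  have mult: "\<phi> (x i * x j) = \<phi> (x i) \<otimes>\<^bsub>R\<^esub> \<phi> (x j)" "\<phi> (x i) \<in> carrier R" "\<phi> (x j) \<in> carrier R"
    if "\<phi> \<in> p S" for \<phi>
    using hom_onD[OF hom[OF that]] xA(1) ij by auto
  have "U i \<inter> U j = {\<phi> \<in> p S. \<phi> (x i * x j) \<noteq> \<zero>\<^bsub>R\<^esub>}"
  proof -
    have "\<phi> (x i * x j) \<noteq> \<zero>\<^bsub>R\<^esub> \<longleftrightarrow> \<phi> (x i) \<noteq> \<zero>\<^bsub>R\<^esub> \<and> \<phi> (x j) \<noteq> \<zero>\<^bsub>R\<^esub>" if "\<phi> \<in> p S" for \<phi>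
      unfolding mult(1)[OF that] using integral_iff[OF mult(2,3)[OF that]] by blast
    then show ?thesis unfolding U_def by blast
  qed
  then have cI: "card (U i \<inter> U j) = card (p (S - {i, j}))"
    using bij_betw_same_card[OF bij2] by simp
  have "\<phi> (x i) \<noteq> \<zero>\<^bsub>R\<^esub> \<or> \<phi> (x j) \<noteq> \<zero>\<^bsub>R\<^esub>" if \<phi>: "\<phi> \<in> p S" for \<phi>
  proof (rule ccontr)
    assume neg: "\<not> ?thesis"
    from separating_comax[OF v sep] obtain a b where
      ab: "a \<in> ?A" "b \<in> ?A" "a * x i + b * x j = 1" unfolding comax_def by blast
    note h = hom_onD[OF hom[OF \<phi>]]
    have m: "a * x i \<in> ?A" "b * x j \<in> ?A" using ab xA ij by (auto intro: sring_mult)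
    have "\<phi> (a * x i + b * x j) = \<phi> a \<otimes>\<^bsub>R\<^esub> \<phi> (x i) \<oplus>\<^bsub>R\<^esub> \<phi> b \<otimes>\<^bsub>R\<^esub> \<phi> (x j)"
      using h(3)[OF m] h(2)[OF ab(1) xA(1)[OF ij(1)]] h(2)[OF ab(2) xA(1)[OF ij(2)]] by simp
    also have "\<dots> = \<zero>\<^bsub>R\<^esub>" using neg h(1)[OF ab(1)] h(1)[OF ab(2)] by simp
    finally show False using ab(3) h(4) by simp
  qed
  then have un: "p S = U i \<union> U j" by (auto simp: U_def)
  show "finite (p S)" unfolding un using fU by simp
  show "card (p S) + card (p (S - {i, j})) = card (p (S - {i})) + card (p (S - {j}))"
    using card_Un_Int[OF fU(1,2)] fU cI un by simp
qed

subsection \<open>Points for a quiver without edges\<close>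

definition epoly_in :: "('c, 'd) ring_scheme \<Rightarrow> nat \<Rightarrow> exchange_matrix \<Rightarrow> nat \<Rightarrow> (nat \<Rightarrow> 'c) \<Rightarrow> 'c" where
  "epoly_in R N B k y = (\<Otimes>\<^bsub>R\<^esub>i\<in>{..<N}. y i [^]\<^bsub>R\<^esub> nat (max (B i k) 0)) \<oplus>\<^bsub>R\<^esub>
                        (\<Otimes>\<^bsub>R\<^esub>i\<in>{..<N}. y i [^]\<^bsub>R\<^esub> nat (max (- B i k) 0))"

text \<open>\<open>y\<close> holds the values of the variables and \<open>z\<close> those of their
  companions; a frozen index is treated like a mutable one with right-hand side 1.\<close>

definition tuples :: "('c, 'd) ring_scheme \<Rightarrow> nat \<Rightarrow> nat set \<Rightarrow> exchange_matrix \<Rightarrow> ((nat \<Rightarrow> 'c) \<times> (nat \<Rightarrow> 'c)) set" where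
  "tuples R N S B = {(y, z). y \<in> {..<N} \<rightarrow>\<^sub>E carrier R \<and> z \<in> {..<N} \<rightarrow>\<^sub>E carrier R \<and>
     (\<forall>i<N. y i \<otimes>\<^bsub>R\<^esub> z i = (if i \<in> S then epoly_in R N B i y else \<one>\<^bsub>R\<^esub>))}"

lemma (in cring) hom_on_epoly:
  assumes \<phi>: "hom_on A R \<phi>" and A: "sring A" and x: "\<And>i. i < N \<Longrightarrow> B i k \<noteq> 0 \<Longrightarrow> x i \<in> A"
    and y: "\<And>i. i < N \<Longrightarrow> B i k \<noteq> 0 \<Longrightarrow> \<phi> (x i) = y i" and yc: "\<And>i. i < N \<Longrightarrow> y i \<in> carrier R"
  shows "\<phi> (epoly N B k x) = epoly_in R N B k y"
proof -
  \<comment> \<open>The sign \<open>c\<close> is 1 or -1 in the end, which serves both monomials of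
    the exchange polynomial.\<close>
  have mem: "x i ^ nat (max (c * B i k) 0) \<in> A"
    and val: "\<phi> (x i ^ nat (max (c * B i k) 0)) = y i [^] nat (max (c * B i k) 0)" if "i < N" for i c
    using x[OF that] y[OF that] hom_on_power[OF \<phi> A] hom_onD(4)[OF \<phi>] A
    by (cases "B i k = 0"; simp add: sring_one sring_power)+
  have pr: "\<phi> (\<Prod>i<N. x i ^ nat (max (c * B i k) 0)) = (\<Otimes>i\<in>{..<N}. y i [^] nat (max (c * B i k) 0))" for c
  proof -
    have "\<phi> (\<Prod>i<N. x i ^ nat (max (c * B i k) 0)) = (\<Otimes>i\<in>{..<N}. \<phi> (x i ^ nat (max (c * B i k) 0)))"
      by (rule hom_on_prod[OF \<phi> A]) (use mem in auto)
    also have "\<dots> = (\<Otimes>i\<in>{..<N}. y i [^] nat (max (c * B i k) 0))"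
      by (rule finprod_cong') (use val yc in \<open>auto simp del: pow_nat\<close>)
    finally show ?thesis .
  qed
  have memp: "(\<Prod>i<N. x i ^ nat (max (c * B i k) 0)) \<in> A" for c
    by (rule sring_prod[OF A]) (use mem in auto)
  show ?thesis
    using hom_onD(3)[OF \<phi> memp[of 1] memp[of "- 1"]] pr[of 1] pr[of "- 1"]
    by (simp add: epoly_def epoly_in_def)
qed

context
  fixes N S B and x :: "nat \<Rightarrow> 'f::field_char_0" and R :: "('c, 'd) ring_scheme" (structure)
  assumes v: "valid N S (x, B)" and no_edges: "\<And>i k. i \<in> S \<Longrightarrow> k \<in> S \<Longrightarrow> B i k = 0"
    and R: "cring R"
begin

interpretation cring R by (rule R)

text \<open>With the value 1 at frozen indices the companion is \<open>Q i / x i\<close> throughout,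
  and one extension step covers both kinds of variables.\<close>

private definition Q where "Q i = (if i \<in> S then epoly N B i x else 1)"
private definition xx where "xx i = Q i / x i"
private definition G where "G I = gen (x ` I \<union> xx ` I)"

private lemma nz: "i < N \<Longrightarrow> x i \<noteq> 0"
  by (rule valid_simps(8)[OF v])

private lemma Q_nz: "Q i \<noteq> 0"
  using valid_epoly(2)[OF v] by (simp add: Q_def)

private lemma G_base: "i \<in> I \<Longrightarrow> x i \<in> G I" "i \<in> I \<Longrightarrow> xx i \<in> G I"
  by (auto simp: G_def intro: gen_base)

text \<open>\<open>cond\<close> adjoins frozen variables before mutable ones. Then
  \<open>Q j\<close> is in the domain of \<open>\<phi>\<close> when \<open>j\<close> is adjoined,
  and no earlier companion involves \<open>x j\<close>, so \<open>x j\<close> is transcendental over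
  what has been built.\<close>

private lemma extend_step:
  assumes I: "finite I" "I \<subseteq> {..<N}" and j: "j < N" "j \<notin> I"
    and cond: "if j \<in> S then {..<N} - S \<subseteq> I else I \<inter> S = {}"
    and yz: "(y, z) \<in> tuples R N S B"
    and \<phi>: "hom_on (G I) R \<phi>" "\<And>i. i \<in> I \<Longrightarrow> \<phi> (x i) = y i" "\<And>i. i \<in> I \<Longrightarrow> \<phi> (xx i) = z i"
  shows "\<exists>\<psi>. hom_on (G (insert j I)) R \<psi> \<and> (\<forall>i\<in>insert j I. \<psi> (x i) = y i \<and> \<psi> (xx i) = z i)"
proof -
  have GI: "sring (G I)" by (simp add: G_def)
  have yc: "y i \<in> carrier R" "z i \<in> carrier R" "y i \<otimes> z i = (if i \<in> S then epoly_in R N B i y else \<one>)"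
    if "i < N" for i using yz that by (auto simp: tuples_def PiE_iff)
  have frz: "i \<in> I" if "j \<in> S" "i < N" "B i j \<noteq> 0" for i
    using cond no_edges[of i j] that by auto
  have G_sub: "G I \<subseteq> laur ({..<N} - {j}) x"
    unfolding G_def
  proof (rule gen_least[OF sring_laur], rule Un_least; rule image_subsetI)
    fix i assume i: "i \<in> I"
    then have i': "i \<in> {..<N} - {j}" using I j by auto
    then show "x i \<in> laur ({..<N} - {j}) x" by (rule laur_base)
    have "Q i \<in> laur ({..<N} - {j}) x"
    proof (cases "i \<in> S")
      case True
      with cond i have jS: "j \<in> S" by (auto split: if_splits)
      have "epoly N B i x \<in> laur ({..<N} - {j}) x"
        by (rule epoly_mem[OF sring_laur]) (use no_edges[OF jS True] in \<open>auto intro!: laur_base\<close>)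
      with True show ?thesis by (simp add: Q_def)
    qed (simp add: Q_def sring_one)
    from sring_mult[OF sring_laur this laur_inverse[OF i']]
    show "xx i \<in> laur ({..<N} - {j}) x" by (simp add: xx_def divide_inverse)
  qed
  have tr: "transc (G I) (x j)"
    by (rule transc_mono[OF indepD[OF valid_simps(3)[OF v]] G_sub]) (use j in simp)
  have QG: "Q j \<in> G I" and Qy: "\<phi> (Q j) = (if j \<in> S then epoly_in R N B j y else \<one>)"
  proof -
    show "Q j \<in> G I"
    proof (cases "j \<in> S")
      case True
      have "epoly N B j x \<in> G I" by (rule epoly_mem[OF GI]) (rule G_base(1), rule frz[OF True])
      with True show ?thesis by (simp add: Q_def)
    qed (simp add: Q_def sring_one[OF GI])
    show "\<phi> (Q j) = (if j \<in> S then epoly_in R N B j y else \<one>)"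
    proof (cases "j \<in> S")
      case True
      have "\<phi> (epoly N B j x) = epoly_in R N B j y"
      proof (rule hom_on_epoly[OF \<phi>(1) GI])
        fix i assume i: "i < N"
        show "y i \<in> carrier R" by (rule yc(1)[OF i])
        assume "B i j \<noteq> 0"
        then have "i \<in> I" by (rule frz[OF True i])
        then show "x i \<in> G I" "\<phi> (x i) = y i" using G_base(1) \<phi>(2) by blast+
      qed
      with True show ?thesis by (simp add: Q_def)
    qed (use hom_onD(4)[OF \<phi>(1)] in \<open>simp add: Q_def\<close>)
  qed
  obtain \<psi> where \<psi>: "hom_on (gen (G I \<union> {x j, Q j / x j})) R \<psi>" "\<forall>c\<in>G I. \<psi> c = \<phi> c"
    "\<psi> (x j) = y j" "\<psi> (Q j / x j) = z j"
    using hom_on_extend[OF GI tr QG Q_nz \<phi>(1) yc(1)[OF j(1)] yc(2)[OF j(1)]] yc(3)[OF j(1)] Qy by auto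
  have "G (insert j I) \<subseteq> gen (G I \<union> {x j, Q j / x j})"
    unfolding G_def[of "insert j I"]
  proof (rule gen_least[OF sring_gen], rule Un_least; rule image_subsetI; rule gen_base)
    fix i assume "i \<in> insert j I"
    with G_base[of i I] show "x i \<in> G I \<union> {x j, Q j / x j}" "xx i \<in> G I \<union> {x j, Q j / x j}"
      by (auto simp: xx_def)
  qed
  from hom_on_subset[OF \<psi>(1) this] have 1: "hom_on (G (insert j I)) R \<psi>" .
  have "\<psi> (x i) = y i \<and> \<psi> (xx i) = z i" if "i \<in> insert j I" for i
  proof (cases "i = j")
    case True
    with \<psi>(3,4) show ?thesis by (simp add: xx_def)
  next
    case False
    with that have i: "i \<in> I" by blast
    from \<psi>(2) G_base[OF i] \<phi>(2,3)[OF i] show ?thesis by simp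
  qed
  with 1 show ?thesis by blast
qed

private lemma extend_all:
  assumes yz: "(y, z) \<in> tuples R N S B"
  shows "\<exists>\<psi>. hom_on (G {..<N}) R \<psi> \<and> (\<forall>i\<in>{..<N}. \<psi> (x i) = y i \<and> \<psi> (xx i) = z i)"
proof -
  have SN: "S \<subseteq> {..<N}" and fS: "finite S" using valid_simps(1,2)[OF v] .
  have 1: "F \<subseteq> {..<N} - S \<Longrightarrow> \<exists>\<psi>. hom_on (G F) R \<psi> \<and> (\<forall>i\<in>F. \<psi> (x i) = y i \<and> \<psi> (xx i) = z i)"
    if "finite F" for F
    using that
  proof (induction F rule: finite_induct)
    case empty
    then show ?case using hom_on_Ints by (simp add: G_def)
  next
    case (insert j F)
    then obtain \<psi> where "hom_on (G F) R \<psi>" "\<forall>i\<in>F. \<psi> (x i) = y i \<and> \<psi> (xx i) = z i" by auto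
    then show ?case using insert by (intro extend_step[OF _ _ _ _ _ yz, of F j \<psi>]) auto
  qed
  have 2: "T \<subseteq> S \<Longrightarrow> \<exists>\<psi>. hom_on (G ({..<N} - S \<union> T)) R \<psi> \<and>
      (\<forall>i\<in>{..<N} - S \<union> T. \<psi> (x i) = y i \<and> \<psi> (xx i) = z i)"
    if "finite T" for T
    using that
  proof (induction T rule: finite_induct)
    case empty
    then show ?case using 1[of "{..<N} - S"] by simp
  next
    case (insert j T)
    then obtain \<psi> where \<psi>: "hom_on (G ({..<N} - S \<union> T)) R \<psi>"
      "\<forall>i\<in>{..<N} - S \<union> T. \<psi> (x i) = y i \<and> \<psi> (xx i) = z i" by auto
    have "\<exists>\<psi>. hom_on (G (insert j ({..<N} - S \<union> T))) R \<psi> \<and>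
      (\<forall>i\<in>insert j ({..<N} - S \<union> T). \<psi> (x i) = y i \<and> \<psi> (xx i) = z i)"
      by (rule extend_step[OF _ _ _ _ _ yz \<psi>(1)]) (use \<psi>(2) insert SN in auto)
    then show ?case by simp
  qed
  have "{..<N} - S \<union> S = {..<N}" using SN by auto
  with 2[OF fS] show ?thesis by simp
qed

lemma no_edges_points:
  "bij_betw (\<lambda>\<phi>. (\<lambda>i\<in>{..<N}. \<phi> (x i), \<lambda>i\<in>{..<N}. \<phi> (if i \<in> S then epoly N B i x / x i else inverse (x i))))
     (ring_points (calg N S (x, B)) R) (tuples R N S B)"
proof -
  have xx: "(if i \<in> S then epoly N B i x / x i else inverse (x i)) = xx i" for i
    by (simp add: xx_def Q_def divide_inverse)
  have "calg N S (x, B) = gen (x ` {..<N} \<union>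
      (\<lambda>i. if i \<in> S then epoly N B i x / x i else inverse (x i)) ` {..<N})"
    by (rule no_edges_calg(2)[OF v no_edges])
  then have calg: "calg N S (x, B) = G {..<N}"
    unfolding G_def xx .
  have sG: "sring (G {..<N})" by (simp add: G_def)
  let ?f = "\<lambda>\<phi>. (\<lambda>i\<in>{..<N}. \<phi> (x i), \<lambda>i\<in>{..<N}. \<phi> (xx i))"
  have "bij_betw ?f (ring_points (G {..<N}) R) (tuples R N S B)"
    unfolding bij_betw_def
  proof (intro conjI equalityI subsetI inj_onI)
    fix \<phi> \<psi> assume \<phi>: "\<phi> \<in> ring_points (G {..<N}) R" and \<psi>: "\<psi> \<in> ring_points (G {..<N}) R"
      and eq: "?f \<phi> = ?f \<psi>"
    have "\<phi> (x i) = \<psi> (x i)" "\<phi> (xx i) = \<psi> (xx i)" if "i < N" for i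
      using eq that by (auto dest: fun_cong[of _ _ i])
    then have "\<phi> a = \<psi> a" if "a \<in> G {..<N}" for a
      using hom_on_gen_unique[of "x ` {..<N} \<union> xx ` {..<N}" \<phi> \<psi> a] \<phi> \<psi> that
      by (auto simp: ring_points_iff G_def)
    then show "\<phi> = \<psi>" using \<phi> \<psi> unfolding ring_points_iff by (metis extensionalityI)
  next
    fix p assume "p \<in> ?f ` ring_points (G {..<N}) R"
    then obtain \<phi> where \<phi>: "hom_on (G {..<N}) R \<phi>" and p: "p = ?f \<phi>" by (auto simp: ring_points_iff)
    note cl = hom_onD(1)[OF \<phi>]
    have "\<phi> (x i) \<otimes> \<phi> (xx i) = (if i \<in> S then epoly_in R N B i (\<lambda>i\<in>{..<N}. \<phi> (x i)) else \<one>)"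
      if i: "i < N" for i
    proof -
      have iI: "i \<in> {..<N}" using i by simp
      have "\<phi> (x i) \<otimes> \<phi> (xx i) = \<phi> (Q i)"
        using hom_onD(2)[OF \<phi> G_base[OF iI]] nz[OF i] by (simp add: xx_def)
      also have "\<dots> = (if i \<in> S then epoly_in R N B i (\<lambda>i\<in>{..<N}. \<phi> (x i)) else \<one>)"
        using hom_on_epoly[OF \<phi> sG, of N B i x "\<lambda>i\<in>{..<N}. \<phi> (x i)"] hom_onD(4)[OF \<phi>] G_base(1) cl
        by (simp add: Q_def)
      finally show ?thesis .
    qed
    then show "p \<in> tuples R N S B"
      unfolding p tuples_def using cl G_base by auto
  next
    fix p assume p: "p \<in> tuples R N S B"
    obtain y z where yz: "p = (y, z)" by (cases p)
    obtain \<psi> where \<psi>: "hom_on (G {..<N}) R \<psi>" "\<forall>i\<in>{..<N}. \<psi> (x i) = y i \<and> \<psi> (xx i) = z i"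
      using extend_all[of y z] p yz by blast
    have ext: "y \<in> extensional {..<N}" "z \<in> extensional {..<N}"
      using p yz by (auto simp: tuples_def PiE_def)
    have "restrict \<psi> (G {..<N}) \<in> ring_points (G {..<N}) R"
      using hom_on_restrict[OF \<psi>(1) sG] by (simp add: ring_points_iff)
    moreover have "p = ?f (restrict \<psi> (G {..<N}))"
      unfolding yz using \<psi>(2) ext G_base[of _ "{..<N}"]
      by (auto intro!: extensionalityI[of _ "{..<N}"])
    ultimately show "p \<in> ?f ` ring_points (G {..<N}) R" by blast
  qed
  then show ?thesis unfolding calg xx .
qed

end

subsection \<open>Counting points for a quiver without edges\<close>

text \<open>The discrete logarithm of \<open>-1\<close> in a cyclic group of order \<open>M = q - 1\<close>; for odd \<open>M\<close> the
  field has characteristic 2 and \<open>-1 = 1\<close>.\<close>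
definition half :: "nat \<Rightarrow> int" where
  "half M = (if even M then int M div 2 else 0)"

definition sols :: "nat \<Rightarrow> nat set \<Rightarrow> nat set \<Rightarrow> (nat \<Rightarrow> nat \<Rightarrow> int) \<Rightarrow> (nat \<Rightarrow> int) \<Rightarrow> (nat \<Rightarrow> int) set" where
  "sols M F T C e = {t \<in> F \<rightarrow>\<^sub>E {0..<int M}. \<forall>k\<in>T. [(\<Sum>i\<in>F. C i k * t i) = e k * half M] (mod int M)}"

context
  fixes R :: "('c, 'd) ring_scheme" (structure) and q :: nat
  assumes R: "Ring.field R" and fin: "finite (carrier R)" and q: "card (carrier R) = q"
begin

interpretation Ring.field R by (rule R)

declare pow_nat [simp del]

private definition M where "M = q - 1"

private lemma card_units: "card (carrier R - {\<zero>}) = M"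
  unfolding M_def using q fin by (simp add: card_Diff_singleton)

private lemma M_pos: "M > 0"
proof -
  have "\<one> \<in> carrier R - {\<zero>}" by simp
  then have "card (carrier R - {\<zero>}) > 0" using fin by (metis card_gt_0_iff empty_iff finite_Diff)
  then show ?thesis by (simp add: card_units)
qed

private lemma q_eq: "q = M + 1"
  using M_pos by (simp add: M_def)

text \<open>Each nonzero \<open>a\<close> determines \<open>b\<close>, which gives \<open>M\<close>
  solutions; for \<open>a\<close> zero, all \<open>q\<close> values of \<open>b\<close> are
  solutions if \<open>c\<close> is zero, and none otherwise.\<close>

private lemma card_product_eq:
  assumes c: "c \<in> carrier R"
  shows "card {(a, b). a \<in> carrier R \<and> b \<in> carrier R \<and> a \<otimes> b = c} = M + (if c = \<zero> then q else 0)"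
proof -
  let ?U = "carrier R - {\<zero>}"
  have eq: "{(a, b). a \<in> carrier R \<and> b \<in> carrier R \<and> a \<otimes> b = c}
      = (\<lambda>a. (a, inv a \<otimes> c)) ` ?U \<union> (if c = \<zero> then {\<zero>} \<times> carrier R else {})" (is "?L = ?R")
  proof (intro equalityI subsetI)
    fix p assume "p \<in> ?L"
    then obtain a b where p: "p = (a, b)" "a \<in> carrier R" "b \<in> carrier R" "a \<otimes> b = c" by auto
    show "p \<in> ?R"
    proof (cases "a = \<zero>")
      case False
      then have "inv a \<otimes> c = b" using p field_Units by (simp add: m_assoc[symmetric] flip: p(4))
      then show ?thesis using False p by auto
    qed (use p in auto)
  next
    fix p assume "p \<in> ?R"
    then show "p \<in> ?L"
    proof
      assume "p \<in> (\<lambda>a. (a, inv a \<otimes> c)) ` ?U"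
      then obtain a where a: "a \<in> ?U" "p = (a, inv a \<otimes> c)" by blast
      then have "inv a \<in> carrier R" "a \<otimes> inv a = \<one>" using field_Units by auto
      then show ?thesis using a c by (auto simp: m_assoc[symmetric])
    next
      assume "p \<in> (if c = \<zero> then {\<zero>} \<times> carrier R else {})"
      then show ?thesis by (auto split: if_splits)
    qed
  qed
  have "card ((\<lambda>a. (a, inv a \<otimes> c)) ` ?U) = M"
    by (subst card_image) (auto simp: inj_on_def card_units)
  moreover have "card (if c = \<zero> then {\<zero>} \<times> carrier R else {}) = (if c = \<zero> then q else 0)"
    using q by (auto simp: card_cartesian_product)
  ultimately show ?thesis
    unfolding eq by (subst card_Un_disjoint) (use fin in auto)
qed

private lemma generator:
  obtains \<gamma> where "\<gamma> \<in> carrier R - {\<zero>}" "bij_betw (\<lambda>t. \<gamma> [^] nat t) {0..<int M} (carrier R - {\<zero>})"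
    "\<forall>a b :: nat. \<gamma> [^] a = \<gamma> [^] b \<longleftrightarrow> [int a = int b] (mod int M)"
proof -
  let ?U = "carrier R - {\<zero>}"
  obtain \<gamma> where \<gamma>: "\<gamma> \<in> carrier (Multiplicative_Group.mult_of R)" "carrier (Multiplicative_Group.mult_of R) = {\<gamma> [^] i | i :: nat. i \<in> UNIV}"
    using finite_field_mult_group_has_gen[OF fin] by blast
  interpret G: group "Multiplicative_Group.mult_of R" by (rule field_mult_group)
  have \<gamma>c: "\<gamma> \<in> carrier R" using \<gamma>(1) by simp
  have ord: "Coset.order (Multiplicative_Group.mult_of R) = M" using card_units by (simp add: Coset.order_def)
  have \<gamma>M: "\<gamma> [^] M = \<one>" using G.pow_order_eq_1[OF \<gamma>(1)] by (simp add: ord Multiplicative_Group.nat_pow_mult_of)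
  have red: "\<gamma> [^] a = \<gamma> [^] (a mod M)" for a :: nat
  proof -
    have "\<gamma> [^] a = \<gamma> [^] (M * (a div M) + a mod M)" by simp
    also have "\<dots> = (\<gamma> [^] M) [^] (a div M) \<otimes> \<gamma> [^] (a mod M)"
      using \<gamma>c by (simp only: nat_pow_mult[symmetric] nat_pow_pow)
    finally show ?thesis using \<gamma>M \<gamma>c by simp
  qed
  have img: "(\<lambda>i. \<gamma> [^] i) ` {..<M} = ?U"
  proof -
    have "?U = range (\<lambda>i :: nat. \<gamma> [^] i)" using \<gamma>(2) by auto
    also have "\<dots> = (\<lambda>i. \<gamma> [^] i) ` {..<M}"
    proof (intro equalityI subsetI)
      fix z assume "z \<in> range (\<lambda>i :: nat. \<gamma> [^] i)"
      then obtain i :: nat where "z = \<gamma> [^] i" by blast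
      then have "z = \<gamma> [^] (i mod M)" using red[of i] by simp
      then show "z \<in> (\<lambda>i. \<gamma> [^] i) ` {..<M}" using M_pos by (intro image_eqI[of _ _ "i mod M"]) auto
    qed auto
    finally show ?thesis by simp
  qed
  have inj: "inj_on (\<lambda>i. \<gamma> [^] i) {..<M}"
    by (rule eq_card_imp_inj_on) (simp_all add: img card_units)
  show thesis
  proof
    show "\<gamma> \<in> ?U" using \<gamma>(1) by simp
    have "bij_betw nat {0..<int M} {..<M}"
      by (rule bij_betwI[where g = int]) auto
    moreover have "bij_betw (\<lambda>i. \<gamma> [^] i) {..<M} ?U" using inj img by (simp add: bij_betw_def)
    ultimately have "bij_betw ((\<lambda>i. \<gamma> [^] i) \<circ> nat) {0..<int M} ?U" by (rule bij_betw_trans)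
    then show "bij_betw (\<lambda>t. \<gamma> [^] nat t) {0..<int M} ?U" unfolding comp_def .
    have "\<gamma> [^] a = \<gamma> [^] b \<longleftrightarrow> [int a = int b] (mod int M)" for a b :: nat
    proof -
    have "\<gamma> [^] a = \<gamma> [^] b \<longleftrightarrow> \<gamma> [^] (a mod M) = \<gamma> [^] (b mod M)" using red[of a] red[of b] by simp
    also have "\<dots> \<longleftrightarrow> a mod M = b mod M" using inj M_pos by (auto simp: inj_on_def)
    also have "\<dots> \<longleftrightarrow> [int a = int b] (mod int M)" by (simp add: cong_int_iff cong_def[of a])
    finally show ?thesis .
    qed
    then show "\<forall>a b :: nat. \<gamma> [^] a = \<gamma> [^] b \<longleftrightarrow> [int a = int b] (mod int M)" by blast
  qed
qed

text \<open>The candidate has square 1, so it is 1 or -1. It can be 1 only if \<open>M\<close> is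
  odd, and in a cyclic group of odd order -1, whose square is 1, is itself 1.\<close>

private lemma minus_one_power:
  assumes \<gamma>: "\<gamma> \<in> carrier R - {\<zero>}" "\<And>a b :: nat. \<gamma> [^] a = \<gamma> [^] b \<longleftrightarrow> [int a = int b] (mod int M)"
    and surj: "bij_betw (\<lambda>t. \<gamma> [^] nat t) {0..<int M} (carrier R - {\<zero>})"
  shows "\<ominus> \<one> = \<gamma> [^] nat (half M)"
proof -
  have \<gamma>c: "\<gamma> \<in> carrier R" using \<gamma>(1) by simp
  have h0: "half M \<ge> 0" by (simp add: half_def)
  let ?w = "\<gamma> [^] nat (half M)"
  have sq: "?w \<otimes> ?w = \<one>"
  proof -
    have "?w \<otimes> ?w = \<gamma> [^] (nat (half M) + nat (half M))" using \<gamma>c by (simp add: nat_pow_mult)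
    also have "\<dots> = \<gamma> [^] (0::nat)"
      unfolding \<gamma>(2) by (auto simp: half_def cong_def)
    finally show ?thesis by simp
  qed
  have "(?w \<oplus> \<one>) \<otimes> (?w \<ominus> \<one>) = ?w \<otimes> ?w \<ominus> \<one>"
    using \<gamma>c by (simp add: a_minus_def l_distr r_distr l_minus r_minus a_ac r_neg r_neg1 r_neg2 minus_add)
  also have "\<dots> = \<zero>" using sq by (simp add: a_minus_def r_neg)
  finally have "?w \<oplus> \<one> = \<zero> \<or> ?w \<ominus> \<one> = \<zero>" using \<gamma>c integral by (simp add: integral_iff)
  then show ?thesis
  proof
    assume "?w \<oplus> \<one> = \<zero>"
    then show ?thesis using \<gamma>c minus_equality by simp
  next
    assume "?w \<ominus> \<one> = \<zero>"
    then have w1: "?w = \<gamma> [^] (0::nat)" using \<gamma>c by simp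
    then have "[half M = 0] (mod int M)" using \<gamma>(2)[of "nat (half M)" 0] h0 by simp
    then have odd: "odd M"
    proof (rule contrapos_pn)
      assume ev: "even M"
      then have "half M > 0" "half M < int M" using M_pos by (auto simp: half_def elim!: evenE)
      then show "\<not> [half M = 0] (mod int M)" by (simp add: cong_def)
    qed
    have m1: "\<ominus> \<one> \<in> carrier R - {\<zero>}" by auto
    then obtain t where t: "t \<in> {0..<int M}" "\<ominus> \<one> = \<gamma> [^] nat t"
      using bij_betw_imp_surj_on[OF surj] by blast
    have "\<gamma> [^] (nat t + nat t) = \<gamma> [^] (0::nat)"
    proof -
      have "\<gamma> [^] (nat t + nat t) = \<ominus> \<one> \<otimes> \<ominus> \<one>" unfolding t(2) using \<gamma>c by (simp add: nat_pow_mult)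
      also have "\<dots> = \<one>" by (simp add: l_minus)
      finally show ?thesis by simp
    qed
    then have "[2 * t = 0] (mod int M)" using \<gamma>(2)[of "nat t + nat t" 0] t(1) by simp
    then have "int M dvd 2 * t" by (simp add: cong_0_iff)
    moreover have "coprime (int M) 2" using odd by simp
    ultimately have "int M dvd t" using coprime_dvd_mult_right_iff by blast
    then have "t = 0" using t(1) zdvd_imp_le[of "int M" t] by (cases "t = 0") auto
    with t(2) have "\<ominus> \<one> = \<gamma> [^] (0::nat)" by simp
    with w1 show ?thesis by simp
  qed
qed

text \<open>Where the exponent \<open>u i\<close> is 0, \<open>y i\<close> may be 0 and have no
  logarithm, since the factor is 1 anyway.\<close>

private lemma finprod_gamma:
  assumes \<gamma>: "\<gamma> \<in> carrier R" and I: "finite I" and y: "\<And>i. i \<in> I \<Longrightarrow> u i \<noteq> 0 \<Longrightarrow> y i = \<gamma> [^] t i"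
    and yc: "\<And>i. i \<in> I \<Longrightarrow> y i \<in> carrier R"
  shows "(\<Otimes>i\<in>I. y i [^] (u i :: nat)) = \<gamma> [^] (\<Sum>i\<in>I. u i * (t i :: nat))"
  using I y yc
proof (induction I rule: finite_induct)
  case (insert i I)
  have "y i [^] u i = \<gamma> [^] (u i * t i)"
  proof (cases "u i = 0")
    case False
    then show ?thesis using insert.prems(1)[of i] \<gamma> by (simp add: nat_pow_pow mult.commute)
  qed simp
  then show ?case using insert \<gamma> by (simp add: nat_pow_mult Pi_def)
qed simp

text \<open>Two powers of \<open>\<gamma>\<close> have sum 0 iff their exponents differ by the
  logarithm of -1.\<close>

private lemma epoly_zero_iff:
  assumes \<gamma>: "\<gamma> \<in> carrier R - {\<zero>}" "\<And>a b :: nat. \<gamma> [^] a = \<gamma> [^] b \<longleftrightarrow> [int a = int b] (mod int M)"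
    and surj: "bij_betw (\<lambda>t. \<gamma> [^] nat t) {0..<int M} (carrier R - {\<zero>})"
    and F: "F \<subseteq> {..<N}" "\<And>i. i < N \<Longrightarrow> B i k \<noteq> 0 \<Longrightarrow> i \<in> F"
    and y: "\<And>i. i \<in> F \<Longrightarrow> y i = \<gamma> [^] nat (t i)" "\<And>i. i < N \<Longrightarrow> y i \<in> carrier R"
    and t: "\<And>i. i \<in> F \<Longrightarrow> t i \<ge> 0"
  shows "epoly_in R N B k y = \<zero> \<longleftrightarrow> [(\<Sum>i\<in>F. B i k * t i) = half M] (mod int M)"
proof -
  have \<gamma>c: "\<gamma> \<in> carrier R" using \<gamma>(1) by simp
  define s where "s c = (\<Sum>i<N. nat (max (c * B i k) 0) * nat (t i))" for c
  have pr: "(\<Otimes>i\<in>{..<N}. y i [^] nat (max (c * B i k) 0)) = \<gamma> [^] s c" for c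
    unfolding s_def
  proof (rule finprod_gamma[OF \<gamma>c])
    fix i assume i: "i \<in> {..<N}" "nat (max (c * B i k) 0) \<noteq> 0"
    then have "B i k \<noteq> 0" by auto
    with i show "y i = \<gamma> [^] nat (t i)" using F(2) y(1) by simp
  qed (use y(2) in simp_all)
  have s: "int (s c) = (\<Sum>i\<in>F. max (c * B i k) 0 * t i)" for c
  proof -
    have "int (s c) = (\<Sum>i<N. max (c * B i k) 0 * int (nat (t i)))" by (simp add: s_def)
    also have "\<dots> = (\<Sum>i\<in>F. max (c * B i k) 0 * t i)"
    proof (rule sum.mono_neutral_cong_right)
      show "\<forall>i\<in>{..<N} - F. max (c * B i k) 0 * int (nat (t i)) = 0"
      proof
        fix i assume "i \<in> {..<N} - F"
        then have "B i k = 0" using F(2)[of i] by blast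
        then show "max (c * B i k) 0 * int (nat (t i)) = 0" by simp
      qed
    qed (use F(1) t in auto)
    finally show ?thesis .
  qed
  have "epoly_in R N B k y = \<gamma> [^] s 1 \<oplus> \<gamma> [^] s (- 1)"
    using pr[of 1] pr[of "- 1"] by (simp add: epoly_in_def)
  also have "\<dots> = \<zero> \<longleftrightarrow> \<gamma> [^] s 1 = \<ominus> (\<gamma> [^] s (- 1))"
    using minus_equality[of "\<gamma> [^] s 1" "\<gamma> [^] s (- 1)"] \<gamma>c by (auto simp: l_neg)
  also have "\<ominus> (\<gamma> [^] s (- 1)) = \<ominus> \<one> \<otimes> \<gamma> [^] s (- 1)" using \<gamma>c by (simp add: l_minus)
  also have "\<ominus> \<one> \<otimes> \<gamma> [^] s (- 1) = \<gamma> [^] (nat (half M) + s (- 1))"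
    unfolding minus_one_power[OF \<gamma> surj] using \<gamma>c by (simp add: nat_pow_mult)
  also have "\<gamma> [^] s 1 = \<dots> \<longleftrightarrow> [int (s 1) = int (nat (half M) + s (- 1))] (mod int M)" by (rule \<gamma>(2))
  also have "\<dots> \<longleftrightarrow> [int (s 1) - int (s (- 1)) = half M] (mod int M)"
    by (simp add: half_def cong_iff_dvd_diff algebra_simps)
  also have "int (s 1) - int (s (- 1)) = (\<Sum>i\<in>F. B i k * t i)"
    unfolding s sum_subtractf[symmetric] by (rule sum.cong) (auto simp: max_def)
  finally show ?thesis .
qed

text \<open>\<open>extd\<close> supplies coordinates outside \<open>F\<close>, on which the exchange
  polynomials with index in \<open>T\<close> do not depend; the bijection is the discrete
  logarithm.\<close>

private lemma card_zero_locus: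
  assumes F: "F \<subseteq> {..<N}" "\<And>i k. k \<in> T \<Longrightarrow> i < N \<Longrightarrow> B i k \<noteq> 0 \<Longrightarrow> i \<in> F"
    and ext: "\<And>i y. i < N \<Longrightarrow> i \<notin> F \<Longrightarrow> extd y i \<in> carrier R" "\<And>i y. i \<in> F \<Longrightarrow> extd y i = y i"
  shows "card {y \<in> F \<rightarrow>\<^sub>E (carrier R - {\<zero>}). \<forall>k\<in>T. epoly_in R N B k (extd y) = \<zero>}
      = card (sols M F T B (\<lambda>_. 1))"
proof -
  obtain \<gamma> where \<gamma>1: "\<gamma> \<in> carrier R - {\<zero>}"
    and surj: "bij_betw (\<lambda>t. \<gamma> [^] nat t) {0..<int M} (carrier R - {\<zero>})"
    and \<gamma>2: "\<forall>a b :: nat. \<gamma> [^] a = \<gamma> [^] b \<longleftrightarrow> [int a = int b] (mod int M)"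
    by (rule generator)
  note \<gamma> = \<gamma>1 \<gamma>2[rule_format]
  let ?U = "carrier R - {\<zero>}" and ?I = "{0..<int M}"
  let ?g = "\<lambda>t. \<lambda>i\<in>F. \<gamma> [^] nat (t i)"
  have gU: "\<gamma> [^] nat m \<in> ?U" if "m \<in> ?I" for m using bij_betwE[OF surj] that by blast
  have gi: "m = m'" if "m \<in> ?I" "m' \<in> ?I" "\<gamma> [^] nat m = \<gamma> [^] nat m'" for m m'
    using bij_betw_imp_inj_on[OF surj] that by (auto dest: inj_onD)
  have gs: "\<exists>m\<in>?I. u = \<gamma> [^] nat m" if "u \<in> ?U" for u
    using bij_betw_imp_surj_on[OF surj] that by blast
  have iff: "(\<forall>k\<in>T. epoly_in R N B k (extd (?g t)) = \<zero>) \<longleftrightarrow> t \<in> sols M F T B (\<lambda>_. 1)"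
    if t: "t \<in> F \<rightarrow>\<^sub>E ?I" for t
  proof -
    have "epoly_in R N B k (extd (?g t)) = \<zero> \<longleftrightarrow> [(\<Sum>i\<in>F. B i k * t i) = half M] (mod int M)"
      if k: "k \<in> T" for k
    proof (rule epoly_zero_iff[OF \<gamma> surj F(1) F(2)[OF k]])
      show "extd (?g t) i = \<gamma> [^] nat (t i)" if "i \<in> F" for i using ext(2)[OF that] that by simp
      show "extd (?g t) i \<in> carrier R" if "i < N" for i
        using ext(1)[OF that, of "?g t"] ext(2)[of i "?g t"] \<gamma>(1) by (cases "i \<in> F") auto
      show "t i \<ge> 0" if "i \<in> F" for i using PiE_mem[OF t that] by simp
    qed
    with t show ?thesis by (auto simp: sols_def)
  qed
  have "bij_betw ?g (sols M F T B (\<lambda>_. 1))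
      {y \<in> F \<rightarrow>\<^sub>E ?U. \<forall>k\<in>T. epoly_in R N B k (extd y) = \<zero>}"
    unfolding bij_betw_def
  proof (intro conjI inj_onI equalityI subsetI)
    fix t t' assume t: "t \<in> sols M F T B (\<lambda>_. 1)" "t' \<in> sols M F T B (\<lambda>_. 1)" and eq: "?g t = ?g t'"
    then have tE: "t \<in> F \<rightarrow>\<^sub>E ?I" "t' \<in> F \<rightarrow>\<^sub>E ?I" by (simp_all add: sols_def)
    have "t i = t' i" if "i \<in> F" for i
      by (rule gi[OF PiE_mem[OF tE(1) that] PiE_mem[OF tE(2) that]]) (use fun_cong[OF eq, of i] that in simp)
    with tE show "t = t'" by (rule PiE_ext)
  next
    fix y assume "y \<in> ?g ` sols M F T B (\<lambda>_. 1)"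
    then obtain t where t: "t \<in> sols M F T B (\<lambda>_. 1)" "y = ?g t" by blast
    then have tE: "t \<in> F \<rightarrow>\<^sub>E ?I" by (simp add: sols_def)
    have "y \<in> F \<rightarrow>\<^sub>E ?U" unfolding t(2) using gU PiE_mem[OF tE] by (simp add: PiE_iff)
    moreover have "\<forall>k\<in>T. epoly_in R N B k (extd y) = \<zero>"
      unfolding t(2) using iff[OF tE] t(1) by blast
    ultimately show "y \<in> {y \<in> F \<rightarrow>\<^sub>E ?U. \<forall>k\<in>T. epoly_in R N B k (extd y) = \<zero>}" by blast
  next
    fix y assume y: "y \<in> {y \<in> F \<rightarrow>\<^sub>E ?U. \<forall>k\<in>T. epoly_in R N B k (extd y) = \<zero>}"
    then have "\<forall>i\<in>F. \<exists>m\<in>?I. y i = \<gamma> [^] nat m" using gs by blast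
    from bchoice[OF this[unfolded Bex_def]] obtain t0 where t0: "\<forall>i\<in>F. t0 i \<in> ?I \<and> y i = \<gamma> [^] nat (t0 i)" by blast
    define t where "t = (\<lambda>i\<in>F. t0 i)"
    have tE: "t \<in> F \<rightarrow>\<^sub>E ?I" using t0 by (auto simp: t_def)
    have yt: "y = ?g t"
      using t0 y by (intro PiE_ext[of y F "\<lambda>_. ?U"]) (auto simp: t_def PiE_iff)
    with iff[OF tE] y have "t \<in> sols M F T B (\<lambda>_. 1)" by blast
    with yt show "y \<in> ?g ` sols M F T B (\<lambda>_. 1)" by blast
  qed
  from bij_betw_same_card[OF this] show ?thesis by simp
qed

lemma card_tuples:
  assumes S: "S \<subseteq> {..<N}" and no_edges: "\<And>i k. i \<in> S \<Longrightarrow> k \<in> S \<Longrightarrow> B i k = 0"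
  shows "finite (tuples R N S B)"
    and "card (tuples R N S B) =
      (\<Sum>T\<in>Pow S. q ^ card T * (q - 1) ^ card (S - T) * card (sols (q - 1) ({..<N} - S) T B (\<lambda>_. 1)))"
proof -
  let ?F = "{..<N} - S" and ?U = "carrier R - {\<zero>}"
  have fS: "finite S" using S by (rule finite_subset) simp
  \<comment> \<open>Mutable coordinates are filled with 0; without edges the exchange polynomials do
    not see them.\<close>
  define extd where "extd y = (\<lambda>i. if i \<in> ?F then y i else \<zero>)" for y :: "nat \<Rightarrow> 'c"
  define E where "E k y = epoly_in R N B k (extd y)" for k y
  have E_closed: "E k y \<in> carrier R" if "y \<in> ?F \<rightarrow>\<^sub>E ?U" for k y
  proof -
    have "extd y i \<in> carrier R" for i using PiE_mem[OF that, of i] by (simp add: extd_def)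
    then show ?thesis unfolding E_def epoly_in_def by (intro add.m_closed finprod_closed) auto
  qed
  have E_cong: "epoly_in R N B k y = E k (restrict y ?F)"
    if k: "k \<in> S" and y: "\<And>i. i < N \<Longrightarrow> y i \<in> carrier R" for k y
  proof -
    have "y i [^] nat (max (c * B i k) 0) = extd (restrict y ?F) i [^] nat (max (c * B i k) 0)"
      if "i < N" for i c
      using no_edges[OF _ k, of i] that by (cases "i \<in> S") (auto simp: extd_def)
    then have "(\<Otimes>i\<in>{..<N}. y i [^] nat (max (c * B i k) 0))
        = (\<Otimes>i\<in>{..<N}. extd (restrict y ?F) i [^] nat (max (c * B i k) 0))" for c
      by (intro finprod_cong') (use y in \<open>auto simp: extd_def\<close>)
    from this[of 1] this[of "- 1"] show ?thesis by (simp add: E_def epoly_in_def)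
  qed
  define V where "V c = {(a, b). a \<in> carrier R \<and> b \<in> carrier R \<and> a \<otimes> b = c}" for c
  have fV: "finite (V c)" for c
    by (rule finite_subset[of _ "carrier R \<times> carrier R"]) (use fin in \<open>auto simp: V_def\<close>)
  define W where "W = (SIGMA \<eta>:?F \<rightarrow>\<^sub>E ?U. \<Pi>\<^sub>E k\<in>S. V (E k \<eta>))"
  define f where "f = (\<lambda>(y, z). (restrict y ?F, \<lambda>k\<in>S. (y k :: 'c, z k :: 'c)))"
  define g where "g = (\<lambda>(\<eta>, \<theta>). (\<lambda>i\<in>{..<N}. if i \<in> S then fst (\<theta> i) else \<eta> i,
      \<lambda>i\<in>{..<N}. if i \<in> S then snd (\<theta> i) else inv (\<eta> i :: 'c)))"
  have bij: "bij_betw f (tuples R N S B) W"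
  proof (rule bij_betwI[where g = g])
    show "f \<in> tuples R N S B \<rightarrow> W"
    proof
      fix p assume p: "p \<in> tuples R N S B"
      obtain y z where yz: "p = (y, z)" by (cases p)
      have c: "y i \<in> carrier R" "z i \<in> carrier R" "y i \<otimes> z i = (if i \<in> S then epoly_in R N B i y else \<one>)"
        if "i < N" for i using p that by (auto simp: yz tuples_def PiE_iff)
      have "y i \<in> ?U" if "i \<in> ?F" for i
      proof -
        have "y i \<otimes> z i = \<one>" "z i \<in> carrier R" "y i \<in> carrier R" using c[of i] that by auto
        then show ?thesis by auto
      qed
      moreover have "(y k, z k) \<in> V (E k (restrict y ?F))" if k: "k \<in> S" for k
        using c[of k] S k E_cong[OF k c(1)] by (auto simp: V_def)
      ultimately show "f p \<in> W" by (auto simp: f_def yz W_def)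
    qed
    show "g \<in> W \<rightarrow> tuples R N S B"
    proof
      fix w assume w: "w \<in> W"
      obtain \<eta> \<theta> where ht: "w = (\<eta>, \<theta>)" by (cases w)
      have \<eta>: "\<eta> \<in> ?F \<rightarrow>\<^sub>E ?U" and \<theta>: "\<And>k. k \<in> S \<Longrightarrow> \<theta> k \<in> V (E k \<eta>)"
        using w by (auto simp: ht W_def PiE_iff)
      define y where "y = (\<lambda>i\<in>{..<N}. if i \<in> S then fst (\<theta> i) else \<eta> i)"
      define z where "z = (\<lambda>i\<in>{..<N}. if i \<in> S then snd (\<theta> i) else inv (\<eta> i))"
      have \<theta>': "fst (\<theta> k) \<in> carrier R" "snd (\<theta> k) \<in> carrier R" "fst (\<theta> k) \<otimes> snd (\<theta> k) = E k \<eta>"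
        if "k \<in> S" for k using \<theta>[OF that] by (auto simp: V_def)
      have \<eta>': "\<eta> i \<in> carrier R" "inv (\<eta> i) \<in> carrier R" "\<eta> i \<otimes> inv (\<eta> i) = \<one>" if "i < N" "i \<notin> S" for i
        using PiE_mem[OF \<eta>, of i] that field_Units by auto
      have yc: "y i \<in> carrier R" and zc: "z i \<in> carrier R" if "i < N" for i
        using that \<theta>'[of i] \<eta>'[of i] by (auto simp: y_def z_def)
      have "restrict y ?F = \<eta>"
        using \<eta> by (intro PiE_ext[of _ ?F "\<lambda>_. carrier R"]) (auto simp: y_def PiE_iff)
      then have "epoly_in R N B k y = E k \<eta>" if "k \<in> S" for k using E_cong[OF that yc] by simp
      then have "y i \<otimes> z i = (if i \<in> S then epoly_in R N B i y else \<one>)" if "i < N" for i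
        using that \<theta>'(3)[of i] \<eta>'(3)[of i] by (simp add: y_def z_def)
      then have "(y, z) \<in> tuples R N S B"
        using yc zc by (simp add: tuples_def PiE_iff) (simp add: y_def z_def)
      then show "g w \<in> tuples R N S B" by (simp add: g_def ht y_def z_def)
    qed
  next
    fix p assume p: "p \<in> tuples R N S B"
    obtain y z where yz: "p = (y, z)" by (cases p)
    have E: "y \<in> {..<N} \<rightarrow>\<^sub>E carrier R" "z \<in> {..<N} \<rightarrow>\<^sub>E carrier R"
      and c: "y i \<otimes> z i = (if i \<in> S then epoly_in R N B i y else \<one>)" if "i < N" for i
      using p that by (auto simp: yz tuples_def)
    have E: "y \<in> {..<N} \<rightarrow>\<^sub>E carrier R" "z \<in> {..<N} \<rightarrow>\<^sub>E carrier R"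
      using p by (auto simp: yz tuples_def)
    have inv: "inv (y i) = z i" if "i < N" "i \<notin> S" for i
      by (rule comm_inv_char) (use c[OF that(1)] that PiE_mem[OF E(1)] PiE_mem[OF E(2)] in auto)
    have "(\<lambda>i\<in>{..<N}. if i \<in> S then y i else y i) = y" "(\<lambda>i\<in>{..<N}. if i \<in> S then z i else inv (y i)) = z"
      using E inv by (auto simp: fun_eq_iff PiE_iff extensional_def)
    moreover have "g (f p) = (\<lambda>i\<in>{..<N}. if i \<in> S then y i else y i, \<lambda>i\<in>{..<N}. if i \<in> S then z i else inv (y i))"
      unfolding f_def g_def yz by (auto simp: fun_eq_iff restrict_def)
    ultimately show "g (f p) = p" by (simp add: yz)
  next
    fix w assume w: "w \<in> W"
    obtain \<eta> \<theta> where ht: "w = (\<eta>, \<theta>)" by (cases w)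
    have \<eta>: "\<eta> \<in> extensional ?F" and \<theta>: "\<theta> \<in> extensional S"
      using w by (auto simp: ht W_def PiE_iff)
    show "f (g w) = w"
      unfolding f_def g_def ht using \<eta> \<theta> S
      by (auto simp: fun_eq_iff restrict_def extensional_def)
  qed
  have fW: "finite W" unfolding W_def
    by (intro finite_SigmaI finite_PiE fS fV) (use fin in auto)
  show "finite (tuples R N S B)" using bij_betw_finite[OF bij] fW by simp
  have "card (tuples R N S B) = card W" by (rule bij_betw_same_card[OF bij])
  also have "\<dots> = (\<Sum>\<eta>\<in>?F \<rightarrow>\<^sub>E ?U. card (\<Pi>\<^sub>E k\<in>S. V (E k \<eta>)))"
    unfolding W_def by (rule card_SigmaI) (use fin fS fV in \<open>auto intro!: finite_PiE\<close>)
  also have "\<dots> = (\<Sum>\<eta>\<in>?F \<rightarrow>\<^sub>E ?U. \<Prod>k\<in>S. (if E k \<eta> = \<zero> then q else 0) + M)"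
  proof (rule sum.cong[OF refl])
    fix \<eta> assume "\<eta> \<in> ?F \<rightarrow>\<^sub>E ?U"
    then have "card (V (E k \<eta>)) = (if E k \<eta> = \<zero> then q else 0) + M" for k
      unfolding V_def using card_product_eq[OF E_closed[of \<eta> k]] by simp
    then show "card (\<Pi>\<^sub>E k\<in>S. V (E k \<eta>)) = (\<Prod>k\<in>S. (if E k \<eta> = \<zero> then q else 0) + M)"
      by (simp add: card_PiE[OF fS])
  qed
  also have "\<dots> = (\<Sum>\<eta>\<in>?F \<rightarrow>\<^sub>E ?U. \<Sum>T\<in>Pow S. (\<Prod>k\<in>T. if E k \<eta> = \<zero> then q else 0) * (\<Prod>k\<in>S - T. M))"
    by (simp only: prod_add[OF fS])
  also have "\<dots> = (\<Sum>T\<in>Pow S. \<Sum>\<eta>\<in>?F \<rightarrow>\<^sub>E ?U. (\<Prod>k\<in>T. if E k \<eta> = \<zero> then q else 0) * (\<Prod>k\<in>S - T. M))"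
    by (rule sum.swap)
  also have "\<dots> = (\<Sum>T\<in>Pow S. q ^ card T * M ^ card (S - T) * card (sols M ?F T B (\<lambda>_. 1)))"
  proof (rule sum.cong[OF refl])
    fix T assume "T \<in> Pow S"
    then have T: "T \<subseteq> S" and fT: "finite T" using fS by (auto intro: finite_subset)
    have pr: "(\<Prod>k\<in>T. if E k \<eta> = \<zero> then q else 0) = (if \<forall>k\<in>T. E k \<eta> = \<zero> then q ^ card T else 0)" for \<eta>
      using fT by (auto intro: prod_zero)
    have "(\<Sum>\<eta>\<in>?F \<rightarrow>\<^sub>E ?U. (\<Prod>k\<in>T. if E k \<eta> = \<zero> then q else 0) * (\<Prod>k\<in>S - T. M))
        = (\<Sum>\<eta>\<in>?F \<rightarrow>\<^sub>E ?U. if \<forall>k\<in>T. E k \<eta> = \<zero> then q ^ card T * M ^ card (S - T) else 0)"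
      by (rule sum.cong) (auto simp: pr)
    also have "\<dots> = (\<Sum>\<eta>\<in>{\<eta> \<in> ?F \<rightarrow>\<^sub>E ?U. \<forall>k\<in>T. E k \<eta> = \<zero>}. q ^ card T * M ^ card (S - T))"
      by (rule sum.inter_filter[symmetric]) (use fin in \<open>auto intro!: finite_PiE\<close>)
    also have "\<dots> = q ^ card T * M ^ card (S - T) * card {\<eta> \<in> ?F \<rightarrow>\<^sub>E ?U. \<forall>k\<in>T. E k \<eta> = \<zero>}"
      by simp
    also have "card {\<eta> \<in> ?F \<rightarrow>\<^sub>E ?U. \<forall>k\<in>T. E k \<eta> = \<zero>} = card (sols M ?F T B (\<lambda>_. 1))"
      unfolding E_def
    proof (rule card_zero_locus)
      fix i k assume "k \<in> T" "i < N" "B i k \<noteq> 0"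
      then show "i \<in> ?F" using no_edges[of i k] T by auto
    qed (auto simp: extd_def)
    finally show "(\<Sum>\<eta>\<in>?F \<rightarrow>\<^sub>E ?U. (\<Prod>k\<in>T. if E k \<eta> = \<zero> then q else 0) * (\<Prod>k\<in>S - T. M))
        = q ^ card T * M ^ card (S - T) * card (sols M ?F T B (\<lambda>_. 1))" .
  qed
  finally show "card (tuples R N S B) =
      (\<Sum>T\<in>Pow S. q ^ card T * (q - 1) ^ card (S - T) * card (sols (q - 1) ?F T B (\<lambda>_. 1)))"
    by (simp add: M_def)
qed

end

subsection \<open>Diagonalization of systems of congruences\<close>

definition single :: "nat \<Rightarrow> int \<Rightarrow> int \<Rightarrow> int set" where
  "single M d e = {z \<in> {0..<int M}. [d * z = e * half M] (mod int M)}"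

text \<open>Rows belong to unknowns and columns to equations: the rows indexed by \<open>F\<close>
  span the integer vectors on \<open>T\<close>.\<close>

definition row_surj :: "nat set \<Rightarrow> nat set \<Rightarrow> (nat \<Rightarrow> nat \<Rightarrow> int) \<Rightarrow> bool" where
  "row_surj F T C \<longleftrightarrow> (\<forall>v. \<exists>c. \<forall>k\<in>T. v k = (\<Sum>i\<in>F. c i * C i k))"

text \<open>The pairs in \<open>D\<close> describe the pivots, the elements of \<open>zs\<close> the right-hand sides of rows
  that have become zero, and \<open>r\<close> counts the free variables.\<close>
definition diag_count :: "nat set \<Rightarrow> nat set \<Rightarrow> (nat \<Rightarrow> nat \<Rightarrow> int) \<Rightarrow> (nat \<Rightarrow> int) \<Rightarrow> bool" where
  "diag_count F T C e \<longleftrightarrow> (\<exists>D zs r.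
     (\<forall>M>0. card (sols M F T C e) = M ^ r * (\<Prod>(d, c)\<leftarrow>D. card (single M d c)) *
        (\<Prod>c\<leftarrow>zs. if [c * half M = 0] (mod int M) then 1 else 0)) \<and>
     (\<forall>(d, c)\<in>set D. d \<noteq> 0) \<and>
     (row_surj F T C \<longrightarrow> zs = [] \<and> (\<forall>(d, c)\<in>set D. \<bar>d\<bar> = 1) \<and> r + card T = card F))"

lemma diag_count_transfer:
  assumes "diag_count F T C' e'"
    and "\<And>M. M > 0 \<Longrightarrow> card (sols M F T C e) = card (sols M F T C' e')"
    and "row_surj F T C \<Longrightarrow> row_surj F T C'"
  shows "diag_count F T C e"
proof -
  from assms(1) obtain D zs r where D:
    "\<forall>M>0. card (sols M F T C' e') = M ^ r * (\<Prod>(d, c)\<leftarrow>D. card (single M d c)) *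
        (\<Prod>c\<leftarrow>zs. if [c * half M = 0] (mod int M) then 1 else 0)"
    "\<forall>(d, c)\<in>set D. d \<noteq> 0"
    "row_surj F T C' \<longrightarrow> zs = [] \<and> (\<forall>(d, c)\<in>set D. \<bar>d\<bar> = 1) \<and> r + card T = card F"
    unfolding diag_count_def by blast
  show ?thesis
    unfolding diag_count_def
    by (rule exI[of _ D], rule exI[of _ zs], rule exI[of _ r]) (use D assms(2,3) in simp)
qed

text \<open>Subtracting multiples of equation \<open>k\<close> from the others is invertible over
  the integers, so the solutions do not change for any modulus.\<close>

lemma diag_count_equation_op:
  assumes k: "k \<in> T"
    and C': "\<And>i l. C' i l = (if l = k then C i k else C i l - m l * C i k)"
    and e': "\<And>l. e' l = (if l = k then e k else e l - m l * e k)"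
    and D: "diag_count F T C' e'"
  shows "diag_count F T C e"
proof (rule diag_count_transfer[OF D])
  fix M :: nat assume "M > 0"
  have iff: "(\<forall>l\<in>T. [(\<Sum>i\<in>F. C i l * t i) = e l * half M] (mod int M)) \<longleftrightarrow>
        (\<forall>l\<in>T. [(\<Sum>i\<in>F. C' i l * t i) = e' l * half M] (mod int M))" (is "?A \<longleftrightarrow> ?B") for t
  proof -
    define s where "s l = (\<Sum>i\<in>F. C i l * t i) - e l * half M" for l
    have s': "(\<Sum>i\<in>F. C' i l * t i) - e' l * half M = (if l = k then s k else s l - m l * s k)" for l
    proof -
      have "(\<Sum>i\<in>F. C' i l * t i) = (\<Sum>i\<in>F. C i l * t i) - m l * (\<Sum>i\<in>F. C i k * t i)" if "l \<noteq> k"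
        using that by (simp add: C' algebra_simps sum_subtractf sum_distrib_left)
      then show ?thesis by (auto simp: s_def C' e' algebra_simps)
    qed
    have A: "?A \<longleftrightarrow> (\<forall>l\<in>T. int M dvd s l)" by (simp add: cong_iff_dvd_diff s_def)
    have B: "?B \<longleftrightarrow> (\<forall>l\<in>T. int M dvd (if l = k then s k else s l - m l * s k))"
      by (simp only: cong_iff_dvd_diff s')
    have red: "int M dvd s l - m l * s k \<longleftrightarrow> int M dvd s l" if "int M dvd s k" for l
      using that by (simp add: dvd_diff_left_iff)
    show ?thesis unfolding A B
    proof (intro iffI ballI)
      fix l assume all: "\<forall>l\<in>T. int M dvd s l" and l: "l \<in> T"
      then show "int M dvd (if l = k then s k else s l - m l * s k)"
        using k red[of l] by simp
    next
      fix l assume all: "\<forall>l\<in>T. int M dvd (if l = k then s k else s l - m l * s k)" and l: "l \<in> T"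
      then have sk: "int M dvd s k" using k by force
      show "int M dvd s l"
      proof (cases "l = k")
        case False
        with all l have "int M dvd s l - m l * s k" by force
        with red[OF sk] show ?thesis by blast
      qed (use sk in simp)
    qed
  qed
  show "card (sols M F T C e) = card (sols M F T C' e')" unfolding sols_def iff ..
next
  assume surj: "row_surj F T C"
  show "row_surj F T C'"
    unfolding row_surj_def
  proof
    fix v
    obtain c where c: "\<forall>l\<in>T. (if l = k then v k else v l + m l * v k) = (\<Sum>i\<in>F. c i * C i l)"
      using surj[unfolded row_surj_def, rule_format, of "\<lambda>l. if l = k then v k else v l + m l * v k"] by blast
    have ck: "v k = (\<Sum>i\<in>F. c i * C i k)" using c k by force
    have "v l = (\<Sum>i\<in>F. c i * C' i l)" if l: "l \<in> T" for l
    proof (cases "l = k")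
      case False
      then have "v l + m l * v k = (\<Sum>i\<in>F. c i * C i l)" using c l by force
      then have "v l = (\<Sum>i\<in>F. c i * C i l) - m l * (\<Sum>i\<in>F. c i * C i k)" using ck by simp
      also have "\<dots> = (\<Sum>i\<in>F. c i * C' i l)"
        using False by (simp add: C' right_diff_distrib sum_subtractf sum_distrib_left mult_ac)
      finally show ?thesis .
    qed (use ck in \<open>simp add: C'\<close>)
    then show "\<exists>c. \<forall>l\<in>T. v l = (\<Sum>i\<in>F. c i * C' i l)" by blast
  qed
qed

text \<open>A unimodular substitution that alters only the unknown \<open>j\<close>; reduced modulo
  \<open>M\<close> it is a bijection, whose inverse is obtained by reversing the sign
  \<open>sg\<close>.\<close>

lemma diag_count_variable_op:
  assumes F: "finite F" and j: "j \<in> F"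
    and C': "\<And>i l. C' i l = (if i = j then C j l else C i l - m i * C j l)"
    and D: "diag_count F T C' e"
  shows "diag_count F T C e"
proof (rule diag_count_transfer[OF D])
  let ?G = "F - {j}"
  have split: "sum f F = f j + sum f ?G" for f :: "nat \<Rightarrow> int" by (rule sum.remove[OF F j])
  have CG: "(\<Sum>i\<in>?G. C' i l * t i) = (\<Sum>i\<in>?G. C i l * t i) - C j l * (\<Sum>i\<in>?G. m i * t i)" for l t
    by (simp add: C' algebra_simps sum_subtractf sum_distrib_left)
  fix M :: nat assume M: "M > 0"
  define f where "f sg t = t(j := (t j + sg * (\<Sum>i\<in>?G. m i * t i)) mod int M)" for sg and t :: "nat \<Rightarrow> int"
  have f_G: "(\<Sum>i\<in>?G. g i * f sg t i) = (\<Sum>i\<in>?G. g i * t i)" for sg t g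
    by (rule sum.cong) (auto simp: f_def)
  have f_mem: "f sg t \<in> F \<rightarrow>\<^sub>E {0..<int M}" if "t \<in> F \<rightarrow>\<^sub>E {0..<int M}" for sg t
    using that M j by (auto simp: f_def PiE_iff extensional_def)
  have f_inv: "f (- sg) (f sg t) = t" if t: "t \<in> F \<rightarrow>\<^sub>E {0..<int M}" for sg t
  proof -
    have "f (- sg) (f sg t) j = ((t j + sg * (\<Sum>i\<in>?G. m i * t i)) mod int M - sg * (\<Sum>i\<in>?G. m i * t i)) mod int M"
      unfolding f_def[of "- sg"] f_G by (simp add: f_def)
    also have "\<dots> = t j mod int M" by (simp add: mod_diff_left_eq)
    also have "\<dots> = t j" using PiE_mem[OF t j] by simp
    finally have "f (- sg) (f sg t) j = t j" .
    moreover have "f (- sg) (f sg t) i = t i" if "i \<noteq> j" for i using that by (simp add: f_def)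
    ultimately have "f (- sg) (f sg t) i = t i" for i by (cases "i = j") simp_all
    then show ?thesis by (rule ext)
  qed
  have cong: "[(\<Sum>i\<in>F. C i l * f (- 1) t i) = (\<Sum>i\<in>F. C' i l * t i)] (mod int M)" for l t
  proof -
    let ?s = "\<Sum>i\<in>?G. m i * t i"
    have "(\<Sum>i\<in>F. C i l * f (- 1) t i) = C j l * ((t j - ?s) mod int M) + (\<Sum>i\<in>?G. C i l * t i)"
      unfolding split f_G by (simp add: f_def)
    also have "[\<dots> = C j l * (t j - ?s) + (\<Sum>i\<in>?G. C i l * t i)] (mod int M)"
      by (intro cong_add cong_mult cong_refl) (simp add: cong_def)
    also have "C j l * (t j - ?s) + (\<Sum>i\<in>?G. C i l * t i) = (\<Sum>i\<in>F. C' i l * t i)"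
      unfolding split CG by (simp add: C' algebra_simps)
    finally show ?thesis .
  qed
  have cong': "[(\<Sum>i\<in>F. C i l * t i) = (\<Sum>i\<in>F. C' i l * f 1 t i)] (mod int M)"
    if "t \<in> F \<rightarrow>\<^sub>E {0..<int M}" for l t
    using cong[of l "f 1 t"] f_inv[OF that, of 1] by simp
  have "bij_betw (f 1) (sols M F T C e) (sols M F T C' e)"
  proof (rule bij_betwI[where g = "f (- 1)"])
    show "f 1 \<in> sols M F T C e \<rightarrow> sols M F T C' e"
      using f_mem cong' by (auto simp: sols_def) (meson cong_sym cong_trans)
    show "f (- 1) \<in> sols M F T C' e \<rightarrow> sols M F T C e"
      using f_mem cong by (auto simp: sols_def) (meson cong_trans)
    show "f (- 1) (f 1 t) = t" if "t \<in> sols M F T C e" for t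
      using f_inv[of t 1] that by (simp add: sols_def)
    show "f 1 (f (- 1) t) = t" if "t \<in> sols M F T C' e" for t
      using f_inv[of t "- 1"] that by (simp add: sols_def)
  qed
  then show "card (sols M F T C e) = card (sols M F T C' e)" by (rule bij_betw_same_card)
next
  let ?G = "F - {j}"
  have split: "sum f F = f j + sum f ?G" for f :: "nat \<Rightarrow> int" by (rule sum.remove[OF F j])
  assume surj: "row_surj F T C"
  show "row_surj F T C'"
    unfolding row_surj_def
  proof
    fix v
    obtain c where c: "\<forall>l\<in>T. v l = (\<Sum>i\<in>F. c i * C i l)"
      using surj unfolding row_surj_def by blast
    define c' where "c' = c(j := c j + (\<Sum>i\<in>?G. m i * c i))"
    have "(\<Sum>i\<in>F. c' i * C' i l) = (\<Sum>i\<in>F. c i * C i l)" for l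
    proof -
      have "(\<Sum>i\<in>?G. c' i * C' i l) = (\<Sum>i\<in>?G. c i * C i l) - (\<Sum>i\<in>?G. m i * c i) * C j l"
        unfolding sum_distrib_right sum_subtractf[symmetric]
        by (rule sum.cong) (auto simp: c'_def C' algebra_simps)
      then show ?thesis unfolding split by (simp add: c'_def C' algebra_simps)
    qed
    with c show "\<exists>c. \<forall>l\<in>T. v l = (\<Sum>i\<in>F. c i * C' i l)" by (intro exI[of _ c']) simp
  qed
qed

text \<open>A pivot that is alone in its row and column splits off a congruence in one unknown. If
  the rows span, some multiple of the pivot is 1, so the pivot is a unit.\<close>

lemma diag_count_pivot:
  assumes F: "finite F" and T: "finite T" and j: "j \<in> F" and k: "k \<in> T" and nz: "C j k \<noteq> 0"
    and row: "\<And>i. i \<in> F \<Longrightarrow> i \<noteq> j \<Longrightarrow> C i k = 0" and col: "\<And>l. l \<in> T \<Longrightarrow> l \<noteq> k \<Longrightarrow> C j l = 0"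
    and D: "diag_count (F - {j}) (T - {k}) C e"
  shows "diag_count F T C e"
proof -
  let ?G = "F - {j}" and ?U = "T - {k}"
  have split: "sum f F = f j + sum f ?G" for f :: "nat \<Rightarrow> int" by (rule sum.remove[OF F j])
  have sum_k: "(\<Sum>i\<in>F. g i * C i k) = g j * C j k" for g
    unfolding split by (simp add: row)
  have sum_l: "(\<Sum>i\<in>F. g i * C i l) = (\<Sum>i\<in>?G. g i * C i l)" if "l \<in> ?U" for g l
    unfolding split using col that by simp
  from D obtain D zs r where D:
    "\<forall>M>0. card (sols M ?G ?U C e) = M ^ r * (\<Prod>(d, c)\<leftarrow>D. card (single M d c)) *
        (\<Prod>c\<leftarrow>zs. if [c * half M = 0] (mod int M) then 1 else 0)"
    "\<forall>(d, c)\<in>set D. d \<noteq> 0"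
    "row_surj ?G ?U C \<longrightarrow> zs = [] \<and> (\<forall>(d, c)\<in>set D. \<bar>d\<bar> = 1) \<and> r + card ?U = card ?G"
    unfolding diag_count_def by blast
  have "card (sols M F T C e) = card (single M (C j k) (e k)) * card (sols M ?G ?U C e)" for M
  proof -
    have "bij_betw (\<lambda>t. (t j, restrict t ?G)) (sols M F T C e) (single M (C j k) (e k) \<times> sols M ?G ?U C e)"
    proof (rule bij_betwI[where g = "\<lambda>(z, t). t(j := z)"])
      have eq_k: "(\<Sum>i\<in>F. C i k * t i) = C j k * t j" for t using sum_k[of t] by (simp add: mult.commute)
      have eq_l: "(\<Sum>i\<in>F. C i l * t i) = (\<Sum>i\<in>?G. C i l * t i)" if "l \<in> ?U" for t l
        using sum_l[OF that, of t] by (simp add: mult.commute)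
      show "(\<lambda>t. (t j, restrict t ?G)) \<in> sols M F T C e \<rightarrow> single M (C j k) (e k) \<times> sols M ?G ?U C e"
      proof
        fix t assume t: "t \<in> sols M F T C e"
        have "t j \<in> single M (C j k) (e k)"
          using t j k eq_k[of t] by (auto simp: sols_def single_def)
        moreover have "restrict t ?G \<in> sols M ?G ?U C e"
          unfolding sols_def
        proof (intro CollectI conjI ballI)
          show "restrict t ?G \<in> ?G \<rightarrow>\<^sub>E {0..<int M}" using t by (auto simp: sols_def)
          fix l assume l: "l \<in> ?U"
          have "[(\<Sum>i\<in>F. C i l * t i) = e l * half M] (mod int M)" using t l by (simp add: sols_def)
          then show "[(\<Sum>i\<in>?G. C i l * restrict t ?G i) = e l * half M] (mod int M)"
            unfolding eq_l[OF l] by simp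
        qed
        ultimately show "(t j, restrict t ?G) \<in> single M (C j k) (e k) \<times> sols M ?G ?U C e" by blast
      qed
      show "(\<lambda>(z, t). t(j := z)) \<in> single M (C j k) (e k) \<times> sols M ?G ?U C e \<rightarrow> sols M F T C e"
      proof
        fix p assume p: "p \<in> single M (C j k) (e k) \<times> sols M ?G ?U C e"
        obtain z t where zt: "p = (z, t)" by (cases p)
        have z: "z \<in> {0..<int M}" "[C j k * z = e k * half M] (mod int M)"
          and t: "t \<in> ?G \<rightarrow>\<^sub>E {0..<int M}" "\<And>l. l \<in> ?U \<Longrightarrow> [(\<Sum>i\<in>?G. C i l * t i) = e l * half M] (mod int M)"
          using p by (auto simp: zt single_def sols_def)
        have "t(j := z) \<in> F \<rightarrow>\<^sub>E {0..<int M}"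
          using z(1) t(1) j by (auto simp: PiE_iff extensional_def)
        moreover have "[(\<Sum>i\<in>F. C i l * (t(j := z)) i) = e l * half M] (mod int M)" if l: "l \<in> T" for l
        proof (cases "l = k")
          case True
          then show ?thesis using eq_k[of "t(j := z)"] z(2) by simp
        next
          case False
          then have lU: "l \<in> ?U" using l by simp
          have "(\<Sum>i\<in>?G. C i l * (t(j := z)) i) = (\<Sum>i\<in>?G. C i l * t i)" by (rule sum.cong) auto
          then show ?thesis using eq_l[OF lU, of "t(j := z)"] t(2)[OF lU] by simp
        qed
        ultimately have "t(j := z) \<in> sols M F T C e" unfolding sols_def by blast
        then show "(case p of (z, t) \<Rightarrow> t(j := z)) \<in> sols M F T C e" by (simp add: zt)
      qed
      show "(case (t j, restrict t ?G) of (z, t) \<Rightarrow> t(j := z)) = t" if "t \<in> sols M F T C e" for t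
        using that by (auto simp: sols_def fun_eq_iff PiE_iff extensional_def)
      show "((case p of (z, t) \<Rightarrow> t(j := z)) j, restrict (case p of (z, t) \<Rightarrow> t(j := z)) ?G) = p"
        if "p \<in> single M (C j k) (e k) \<times> sols M ?G ?U C e" for p
        using that by (auto simp: sols_def fun_eq_iff PiE_iff extensional_def)
    qed
    from bij_betw_same_card[OF this] show ?thesis by (simp only: card_cartesian_product)
  qed
  moreover have "zs = [] \<and> (\<forall>(d, c)\<in>set ((C j k, e k) # D). \<bar>d\<bar> = 1) \<and> r + card T = card F"
    if surj: "row_surj F T C"
  proof -
    have "row_surj ?G ?U C"
      unfolding row_surj_def
    proof
      fix v
      obtain c where "\<forall>l\<in>T. v l = (\<Sum>i\<in>F. c i * C i l)" using surj unfolding row_surj_def by blast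
      then have "\<forall>l\<in>?U. v l = (\<Sum>i\<in>?G. c i * C i l)" using sum_l by simp
      then show "\<exists>c. \<forall>l\<in>?U. v l = (\<Sum>i\<in>?G. c i * C i l)" by blast
    qed
    with D(3) have D3: "zs = []" "\<forall>(d, c)\<in>set D. \<bar>d\<bar> = 1" "r + card ?U = card ?G" by auto
    obtain c where "\<forall>l\<in>T. (if l = k then 1 else 0) = (\<Sum>i\<in>F. c i * C i l)"
      using surj[unfolded row_surj_def, rule_format, of "\<lambda>l. if l = k then 1 else 0"] by blast
    with k have "(\<Sum>i\<in>F. c i * C i k) = 1" by force
    then have "C j k dvd 1" unfolding sum_k by (metis dvd_triv_right)
    then have "\<bar>C j k\<bar> = 1" by (simp add: zdvd1_eq)
    moreover have "card F > 0" "card T > 0" using F T j k by (auto simp: card_gt_0_iff)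
    then have "r + card T = card F" using D3(3) j k by (simp add: card_Diff_singleton)
    ultimately show ?thesis using D3 by auto
  qed
  ultimately show ?thesis
    unfolding diag_count_def
    by (intro exI[of _ "(C j k, e k) # D"] exI[of _ zs] exI[of _ r]) (use D nz in \<open>simp add: mult_ac\<close>)
qed

text \<open>With zero coefficients all unknowns are free and each right-hand side must vanish by
  itself; spanning rows leave no equation at all.\<close>

lemma diag_count_zero:
  assumes F: "finite F" and T: "finite T" and 0: "\<And>i k. i \<in> F \<Longrightarrow> k \<in> T \<Longrightarrow> C i k = 0"
  shows "diag_count F T C e"
proof -
  obtain ks where ks: "set ks = T" using finite_list[OF T] by blast
  have s0: "(\<Sum>i\<in>F. C i k * t i) = 0" if "k \<in> T" for k t using 0 that by simp
  have "card (sols M F T C e) = M ^ card F * (\<Prod>c\<leftarrow>map e ks. if [c * half M = 0] (mod int M) then 1 else 0)" for M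
  proof (cases "\<forall>k\<in>T. [e k * half M = 0] (mod int M)")
    case True
    then have "sols M F T C e = F \<rightarrow>\<^sub>E {0..<int M}" using s0 by (auto simp: sols_def cong_sym_eq)
    moreover have "map (\<lambda>c. if [c * half M = 0] (mod int M) then 1 else 0) (map e ks) = map (\<lambda>_. 1 :: nat) ks"
      using True ks by auto
    ultimately show ?thesis using F by (simp only: card_PiE) (simp add: map_replicate_const)
  next
    case False
    then obtain k where k: "k \<in> T" "\<not> [e k * half M = 0] (mod int M)" by blast
    then have "sols M F T C e = {}" using s0 by (auto simp: sols_def cong_sym_eq)
    moreover have "(0::nat) \<in> set (map (\<lambda>c. if [c * half M = 0] (mod int M) then 1 else 0) (map e ks))"
      using k ks by force
    then have "(\<Prod>c\<leftarrow>map e ks. if [c * half M = 0] (mod int M) then 1 else 0) = (0::nat)"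
      by (simp only: prod_list_zero_iff)
    ultimately show ?thesis by simp
  qed
  moreover have "T = {}" if surj: "row_surj F T C"
  proof (rule ccontr)
    assume "T \<noteq> {}"
    then obtain k where k: "k \<in> T" by blast
    obtain c where "\<forall>l\<in>T. (1::int) = (\<Sum>i\<in>F. c i * C i l)"
      using surj[unfolded row_surj_def, rule_format, of "\<lambda>_. 1"] by blast
    with k 0 show False by force
  qed
  ultimately show ?thesis
    unfolding diag_count_def using ks
    by (intro exI[of _ "[]"] exI[of _ "map e ks"] exI[of _ "card F"]) auto
qed

text \<open>Euclid's algorithm on the absolute value of the pivot: a nonzero remainder in its row or
  column is a smaller pivot, and once all remainders vanish the pivot splits off and the number of
  equations drops.\<close>

lemma diag_count_step:
  assumes F: "finite F" and T: "finite T"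
    and IH: "\<And>F' T' C' e'. finite F' \<Longrightarrow> finite T' \<Longrightarrow> card T' < card T \<Longrightarrow> diag_count F' T' C' e'"
  shows "j \<in> F \<Longrightarrow> k \<in> T \<Longrightarrow> C j k \<noteq> 0 \<Longrightarrow> nat \<bar>C j k\<bar> = n \<Longrightarrow> diag_count F T C e"
proof (induction n arbitrary: C e j k rule: less_induct)
  case (less n)
  note j = \<open>j \<in> F\<close> and k = \<open>k \<in> T\<close> and nz = \<open>C j k \<noteq> 0\<close> and n = \<open>nat \<bar>C j k\<bar> = n\<close>
  define C1 where "C1 i l = (if i = j then C j l else C i l - (C i k div C j k) * C j l)" for i l
  have C1_k: "C1 i k = C i k mod C j k" if "i \<noteq> j" for i
    using that by (simp add: C1_def minus_div_mult_eq_mod)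
  have C1_j: "C1 j l = C j l" for l by (simp add: C1_def)
  have smaller: "nat \<bar>a mod C j k\<bar> < n" for a
    using nz abs_mod_less[of "C j k" a] by (simp flip: n)
  have "diag_count F T C1 e"
  proof (cases "\<exists>i\<in>F. i \<noteq> j \<and> C1 i k \<noteq> 0")
    case True
    then obtain i where i: "i \<in> F" "i \<noteq> j" "C1 i k \<noteq> 0" by blast
    show ?thesis
      using less.IH[of "nat \<bar>C1 i k\<bar>" i k C1 e] i k C1_k[OF i(2)] smaller by simp
  next
    case False
    then have C1_0: "C1 i k = 0" if "i \<in> F" "i \<noteq> j" for i using that by blast
    define m where "m l = C1 j l div C1 j k" for l
    define C2 where "C2 i l = (if l = k then C1 i k else C1 i l - m l * C1 i k)" for i l
    define e2 where "e2 l = (if l = k then e k else e l - m l * e k)" for l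
    have C2_j: "C2 j l = C j l mod C j k" if "l \<noteq> k" for l
      using that by (simp add: C2_def m_def C1_j minus_div_mult_eq_mod)
    have "diag_count F T C2 e2"
    proof (cases "\<exists>l\<in>T. l \<noteq> k \<and> C2 j l \<noteq> 0")
      case True
      then obtain l where l: "l \<in> T" "l \<noteq> k" "C2 j l \<noteq> 0" by blast
      show ?thesis
        using less.IH[of "nat \<bar>C2 j l\<bar>" j l C2 e2] l j C2_j[OF l(2)] smaller by simp
    next
      case False
      show ?thesis
      proof (rule diag_count_pivot[OF F T j k])
        show "C2 j k \<noteq> 0" using nz by (simp add: C2_def C1_j)
        show "C2 i k = 0" if "i \<in> F" "i \<noteq> j" for i using C1_0[OF that] by (simp add: C2_def)
        show "C2 j l = 0" if "l \<in> T" "l \<noteq> k" for l using False that by blast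
        show "diag_count (F - {j}) (T - {k}) C2 e2"
          by (rule IH[OF _ _ card_Diff1_less[OF T k]]) (use F T in simp_all)
      qed
    qed
    then show ?thesis
      by (rule diag_count_equation_op[where C' = C2 and e' = e2 and m = m, OF k, rotated -1])
         (simp_all add: C2_def e2_def)
  qed
  then show ?case
    by (rule diag_count_variable_op[where C' = C1 and m = "\<lambda>i. C i k div C j k", OF F j, rotated -1])
       (simp add: C1_def)
qed

theorem diag_count:
  assumes "finite F" "finite T"
  shows "diag_count F T C e"
  using assms
proof (induction "card T" arbitrary: F T C e rule: less_induct)
  case less
  show ?case
  proof (cases "\<exists>j\<in>F. \<exists>k\<in>T. C j k \<noteq> 0")
    case True
    then obtain j k where jk: "j \<in> F" "k \<in> T" "C j k \<noteq> 0" by blast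
    show ?thesis
      by (rule diag_count_step[of F T j k C, OF less.prems less.hyps jk refl])
  next
    case False
    then show ?thesis by (intro diag_count_zero less.prems) blast
  qed
qed

section \<open>Congruences in one unknown\<close>

lemma card_cong_zero:
  assumes M: "M > 0"
  shows "card {z \<in> {0..<int M}. [d * z = 0] (mod int M)} = gcd (nat \<bar>d\<bar>) M"
proof -
  define g where "g = gcd d (int M)"
  have g: "g > 0" using M by (simp add: g_def)
  have "g \<noteq> 0" using g by simp
  then obtain d' M' where dM': "d = d' * g" "int M = M' * g" and cop: "coprime d' M'"
    using gcd_coprime_exists[of d "int M"] unfolding g_def by blast
  have dM: "d = g * d'" "int M = g * M'" "coprime d' M'"
    by (rule trans[OF dM'(1) mult.commute], rule trans[OF dM'(2) mult.commute], rule cop)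
  have "g * M' > 0" using M unfolding dM(2)[symmetric] by simp
  then have M': "M' > 0" using g by (simp add: zero_less_mult_iff)
  \<comment> \<open>After division by the gcd, \<open>d'\<close> is invertible modulo
    \<open>M'\<close>: the solutions are the multiples of \<open>M'\<close>, and \<open>g\<close> of
    them lie below \<open>M\<close>.\<close>
  have iff: "[d * z = 0] (mod int M) \<longleftrightarrow> M' dvd z" for z
  proof -
    have "[d * z = 0] (mod int M) \<longleftrightarrow> g * M' dvd g * (d' * z)"
      by (simp only: cong_0_iff dM(2)) (simp add: dM(1) mult.assoc)
    also have "\<dots> \<longleftrightarrow> M' dvd d' * z" using g by simp
    also have "\<dots> \<longleftrightarrow> M' dvd z" using dM(3) by (simp add: coprime_dvd_mult_right_iff coprime_commute)
    finally show ?thesis .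
  qed
  have "{z \<in> {0..<int M}. [d * z = 0] (mod int M)} = (\<lambda>i. M' * i) ` {0..<g}"
  proof (intro equalityI subsetI)
    fix z assume "z \<in> {z \<in> {0..<int M}. [d * z = 0] (mod int M)}"
    then have "M' dvd z" "0 \<le> z" "z < g * M'" using iff dM(2) by auto
    then obtain i where z: "0 \<le> z" "z < g * M'" "z = M' * i" by (auto elim: dvdE)
    then have "i \<in> {0..<g}" using M' by (auto simp: mult.commute zero_le_mult_iff)
    with z show "z \<in> (\<lambda>i. M' * i) ` {0..<g}" by blast
  next
    fix z assume "z \<in> (\<lambda>i. M' * i) ` {0..<g}"
    then obtain i where i: "0 \<le> i" "i < g" "z = M' * i" by auto
    then have "M' * i < M' * g" "0 \<le> M' * i" using M' by simp_all
    then have "0 \<le> z" "z < int M" using i(3) dM(2) by (simp_all add: mult.commute)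
    moreover have "[d * z = 0] (mod int M)" unfolding iff i(3) by simp
    ultimately show "z \<in> {z \<in> {0..<int M}. [d * z = 0] (mod int M)}" by simp
  qed
  then have "card {z \<in> {0..<int M}. [d * z = 0] (mod int M)} = nat g"
    using M' by (simp add: card_image inj_on_def)
  also have "nat g = gcd (nat \<bar>d\<bar>) M" unfolding g_def gcd_int_def by simp
  finally show ?thesis .
qed

text \<open>For odd \<open>e\<close> the right-hand side is congruent to \<open>M / 2\<close>, and
  \<open>d * z\<close> is congruent to it exactly when \<open>2 * d * z\<close> vanishes modulo
  \<open>M\<close> while \<open>d * z\<close> does not. Both conditions are homogeneous and counted
  by gcds.\<close>

lemma card_single:
  assumes M: "M > 0" "even M"
  shows "int (card (single M d e)) =
    (if even e then int (gcd (nat \<bar>d\<bar>) M) else int (gcd (nat \<bar>2 * d\<bar>) M) - int (gcd (nat \<bar>d\<bar>) M))"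
proof -
  obtain h where h: "M = 2 * h" using M(2) by (rule evenE)
  have half: "half M = int h" by (simp add: half_def h)
  let ?I = "{0..<int M}"
  show ?thesis
  proof (cases "even e")
    case True
    then obtain c where c: "e = 2 * c" by (rule evenE)
    have "e * half M = c * int M" unfolding half c by (simp add: h)
    then have "[e * half M = 0] (mod int M)" by (simp add: cong_0_iff)
    then have "single M d e = {z \<in> ?I. [d * z = 0] (mod int M)}"
      unfolding single_def cong_def by simp
    with True card_cong_zero[OF M(1), of d] show ?thesis by simp
  next
    case False
    then obtain c where c: "e = 2 * c + 1" by (rule oddE)
    have "e * half M = c * int M + int h" unfolding half c by (simp add: h algebra_simps)
    then have "[e * half M = int h] (mod int M)" by (simp add: cong_iff_dvd_diff)
    then have s: "single M d e = {z \<in> ?I. [d * z = int h] (mod int M)}"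
      unfolding single_def cong_def by simp
    have h0: "h > 0" using M h by simp
    have dbl: "[2 * a = 0] (mod int M) \<longleftrightarrow> [a = 0] (mod int M) \<or> [a = int h] (mod int M)" for a
    proof
      assume "[2 * a = 0] (mod int M)"
      then have "int h dvd a" by (simp add: cong_0_iff h)
      then obtain b where b: "a = int h * b" by (rule dvdE)
      show "[a = 0] (mod int M) \<or> [a = int h] (mod int M)"
      proof (cases "even b")
        case True
        then show ?thesis unfolding b by (auto simp: cong_0_iff h elim!: evenE)
      next
        case False
        then obtain b' where "b = 2 * b' + 1" by (rule oddE)
        then have "a - int h = int M * b'" by (simp add: b h algebra_simps)
        then show ?thesis by (simp add: cong_iff_dvd_diff)
      qed
    next
      assume "[a = 0] (mod int M) \<or> [a = int h] (mod int M)"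
      then have "int M dvd a \<or> int M dvd a - int h" by (simp add: cong_iff_dvd_diff)
      then have "int M dvd 2 * a"
      proof
        assume "int M dvd a - int h"
        then have "int M dvd 2 * (a - int h) + int M" by (intro dvd_add dvd_mult dvd_refl)
        also have "2 * (a - int h) + int M = 2 * a" by (simp add: h)
        finally show ?thesis .
      qed (rule dvd_mult)
      then show "[2 * a = 0] (mod int M)" by (simp only: cong_0_iff)
    qed
    have split: "{z \<in> ?I. [2 * d * z = 0] (mod int M)} = {z \<in> ?I. [d * z = 0] (mod int M)} \<union> single M d e"
      unfolding s using dbl[of "d * _"] by (auto simp: mult.assoc)
    have "0 mod int M \<noteq> int h mod int M"
      using h0 by (simp add: h)
    then have "{z \<in> ?I. [d * z = 0] (mod int M)} \<inter> single M d e = {}"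
      unfolding s cong_def by auto
    moreover have "finite {z \<in> ?I. [d * z = 0] (mod int M)}" "finite (single M d e)"
      by (rule finite_subset[of _ ?I]; auto simp: single_def)+
    ultimately have "card {z \<in> ?I. [2 * d * z = 0] (mod int M)}
        = card {z \<in> ?I. [d * z = 0] (mod int M)} + card (single M d e)"
      unfolding split by (rule card_Un_disjoint[rotated 2])
    then have g: "gcd (nat \<bar>2 * d\<bar>) M = gcd (nat \<bar>d\<bar>) M + card (single M d e)"
      unfolding card_cong_zero[OF M(1)] .
    show ?thesis unfolding g using False by simp
  qed
qed

text \<open>Multiplication by \<open>d\<close>, which is its own inverse, solves the congruence
  uniquely.\<close>

lemma card_single_unit:
  assumes M: "M > 0" and d: "\<bar>d\<bar> = 1"
  shows "card (single M d e) = 1"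
proof -
  have dd: "d * d = 1" using d by (metis abs_mult_self_eq mult_1)
  have "single M d e = {(d * (e * half M)) mod int M}"
  proof (intro equalityI subsetI)
    fix z assume z: "z \<in> single M d e"
    then have "[d * (d * z) = d * (e * half M)] (mod int M)" by (auto simp: single_def intro: cong_mult)
    then have "[z = d * (e * half M)] (mod int M)" using dd by (simp add: mult.assoc[symmetric])
    with z show "z \<in> {(d * (e * half M)) mod int M}" by (auto simp: single_def cong_def)
  next
    fix z assume "z \<in> {(d * (e * half M)) mod int M}"
    then have z: "z = (d * (e * half M)) mod int M" by simp
    then have "[d * z = d * (d * (e * half M))] (mod int M)" by (intro cong_mult) (auto simp: cong_def)
    then have "[d * z = e * half M] (mod int M)" using dd by (simp add: mult.assoc[symmetric])
    with z M show "z \<in> single M d e" by (simp add: single_def)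
  qed
  then show ?thesis by simp
qed

subsection \<open>Characters of finite abelian groups\<close>

text \<open>A list of the right length with one orthogonality relation takes the place of the dual
  group, so that characters need not be compared with each other. Values outside \<open>H\<close>
  are arbitrary.\<close>

definition char_list :: "('a, 'b) monoid_scheme \<Rightarrow> 'a set \<Rightarrow> ('a \<Rightarrow> complex) list \<Rightarrow> bool" where
  "char_list G H \<chi>s \<longleftrightarrow> length \<chi>s = card H \<and>
     (\<forall>\<chi>\<in>set \<chi>s. \<forall>a\<in>H. \<chi> a \<noteq> 0 \<and> (\<forall>b\<in>H. \<chi> (a \<otimes>\<^bsub>G\<^esub> b) = \<chi> a * \<chi> b)) \<and>
     (\<forall>a\<in>H. (\<Sum>\<chi>\<leftarrow>\<chi>s. \<chi> a) = (if a = \<one>\<^bsub>G\<^esub> then of_nat (card H) else 0))"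

lemma sum_roots_unity:
  assumes "0 < k" "k < d"
  shows "(\<Sum>l<d. (cis (2 * pi / d) ^ l) ^ k) = 0"
proof -
  let ?z = "cis (2 * pi / d) ^ k"
  have z1: "?z \<noteq> 1"
  proof
    assume "?z = 1"
    then have "cis (2 * pi * k / d) = 1" by (simp add: DeMoivre mult_ac)
    then have "cos (2 * pi * k / d) = 1" by (simp add: complex_eq_iff)
    then obtain n :: int where "2 * pi * k / d = of_int n * 2 * pi"
      using cos_one_2pi_int[of "2 * pi * k / d"] by auto
    then have "real k = n * d" using assms by (simp add: field_simps)
    then have "int k = n * int d" by (metis of_int_eq_iff of_int_mult of_int_of_nat_eq)
    then have "int d dvd int k" by simp
    with assms show False using zdvd_imp_le by fastforce
  qed
  have zd: "?z ^ d = 1"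
  proof -
    have "?z ^ d = (cis (2 * pi / d) ^ d) ^ k" by (simp add: power_mult[symmetric] mult.commute)
    also have "cis (2 * pi / d) ^ d = 1" using assms by (simp add: DeMoivre)
    finally show ?thesis by simp
  qed
  have "(\<Sum>l<d. (cis (2 * pi / d) ^ l) ^ k) = (\<Sum>l<d. ?z ^ l)"
    by (simp add: power_mult[symmetric] mult.commute)
  also have "\<dots> = 0" using z1 zd by (simp add: sum_gp_strict)
  finally show ?thesis .
qed

context comm_group
begin

text \<open>A character of \<open>H\<close> extends to the subgroup generated by \<open>H\<close> and \<open>g\<close> in as many ways as
  the number of \<open>d\<close>-th roots of \<open>\<chi> (g ^ d)\<close>, where \<open>d\<close> is the least exponent with \<open>g ^ d \<in> H\<close>.\<close>
context
  fixes H g d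
  assumes H: "subgroup H G" and g: "g \<in> carrier G"
    and d: "d > 0" "g [^] (d::nat) \<in> H" "\<And>k. 0 < k \<Longrightarrow> k < d \<Longrightarrow> g [^] (k::nat) \<notin> H"
begin

private lemma H_carrier: "h \<in> H \<Longrightarrow> h \<in> carrier G"
  using subgroup.mem_carrier[OF H] .

private lemma H_closed: "h \<in> H \<Longrightarrow> h' \<in> H \<Longrightarrow> h \<otimes> h' \<in> H" "\<one> \<in> H"
  using subgroup.m_closed[OF H] subgroup.one_closed[OF H] by auto

private lemma H_pow: "h \<in> H \<Longrightarrow> h [^] (k::nat) \<in> H"
  by (induction k) (auto intro: H_closed)

private definition H' where "H' = {h \<otimes> g [^] (k::nat) | h k. h \<in> H}"

text \<open>Division of \<open>k\<close> by \<open>d\<close>: minimality of \<open>d\<close> forces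
  the remainder to be 0.\<close>

private lemma gpow_mem:
  assumes "g [^] (k::nat) \<in> H"
  shows "d dvd k"
proof -
  have k: "g [^] k = (g [^] d) [^] (k div d) \<otimes> g [^] (k mod d)"
    using g by (simp add: nat_pow_mult nat_pow_pow)
  have c: "(g [^] d) [^] (k div d) \<in> H" by (rule H_pow[OF d(2)])
  have "g [^] (k mod d) = inv ((g [^] d) [^] (k div d)) \<otimes> g [^] k"
    unfolding k using g by (simp add: m_assoc[symmetric])
  also have "\<dots> \<in> H" by (intro H_closed subgroup.m_inv_closed[OF H] c assms)
  finally have "k mod d = 0" using d(1) d(3)[of "k mod d"] by (cases "k mod d = 0") auto
  then show ?thesis by auto
qed

text \<open>Two representations of an element differ by moving a power of \<open>g [^] d\<close>,
  which belongs to \<open>H\<close>, from one factor to the other.\<close>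

private lemma rep_le:
  assumes h: "h \<in> H" "h' \<in> H" and eq: "h \<otimes> g [^] (k::nat) = h' \<otimes> g [^] (k'::nat)" and le: "k \<le> k'"
  shows "\<exists>m. k' = k + d * m \<and> h = h' \<otimes> (g [^] d) [^] m"
proof -
  have "h' \<otimes> g [^] k' = h' \<otimes> g [^] (k' - k) \<otimes> g [^] k"
    using le g h H_carrier by (simp add: nat_pow_mult m_assoc)
  with eq have heq: "h = h' \<otimes> g [^] (k' - k)" using g h H_carrier by (simp add: r_cancel)
  then have "g [^] (k' - k) = inv h' \<otimes> h" using g h H_carrier by (simp add: m_assoc[symmetric])
  also have "\<dots> \<in> H" by (intro H_closed subgroup.m_inv_closed[OF H] h)
  finally obtain m where m: "k' - k = d * m" using gpow_mem by (auto elim: dvdE)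
  then have "k' = k + d * m" using le by simp
  moreover have "h = h' \<otimes> (g [^] d) [^] m" using heq g by (simp add: m nat_pow_pow)
  ultimately show ?thesis by blast
qed

private lemma rep_less:
  assumes "h \<in> H" "h' \<in> H" "h \<otimes> g [^] (k::nat) = h' \<otimes> g [^] (k'::nat)" "k < d" "k' < d"
  shows "h = h' \<and> k = k'"
proof -
  have m0: "m = 0" if "a + d * m < d" for a m using that d(1) by (cases m) auto
  show ?thesis
  proof (cases "k \<le> k'")
    case True
    obtain m where m: "k' = k + d * m" "h = h' \<otimes> (g [^] d) [^] m"
      using rep_le[OF assms(1,2,3) True] by blast
    have "m = 0" using m0[of k m] assms(5) m(1) by simp
    with m show ?thesis using H_carrier[OF assms(2)] by simp
  next
    case False
    then have "k' \<le> k" by simp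
    then obtain m where m: "k = k' + d * m" "h' = h \<otimes> (g [^] d) [^] m"
      using rep_le[OF assms(2,1) assms(3)[symmetric]] by blast
    have "m = 0" using m0[of k' m] assms(4) m(1) by simp
    with m show ?thesis using H_carrier[OF assms(1)] by simp
  qed
qed

private lemma H'_small: "a \<in> H' \<Longrightarrow> \<exists>h\<in>H. \<exists>k<d. a = h \<otimes> g [^] (k::nat)"
proof -
  assume "a \<in> H'"
  then obtain h k where a: "h \<in> H" "a = h \<otimes> g [^] (k::nat)" by (auto simp: H'_def)
  have "g [^] k = (g [^] d) [^] (k div d) \<otimes> g [^] (k mod d)"
    using g by (simp add: nat_pow_mult nat_pow_pow)
  then have "a = (h \<otimes> (g [^] d) [^] (k div d)) \<otimes> g [^] (k mod d)"
    using a g H_carrier by (simp add: m_assoc)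
  moreover have "h \<otimes> (g [^] d) [^] (k div d) \<in> H" by (intro H_closed H_pow d a)
  ultimately show ?thesis using d(1) by (intro bexI exI conjI) auto
qed

private lemma card_H':
  assumes "finite H"
  shows "card H' = card H * d"
proof -
  have "bij_betw (\<lambda>(h, k). h \<otimes> g [^] k) (H \<times> {..<d}) H'"
    unfolding bij_betw_def
  proof
    show "inj_on (\<lambda>(h, k). h \<otimes> g [^] k) (H \<times> {..<d})"
      using rep_less by (auto simp: inj_on_def)
    show "(\<lambda>(h, k). h \<otimes> g [^] k) ` (H \<times> {..<d}) = H'"
    proof
      show "H' \<subseteq> (\<lambda>(h, k). h \<otimes> g [^] k) ` (H \<times> {..<d})" using H'_small by force
    qed (auto simp: H'_def)
  qed
  from bij_betw_same_card[OF this] show ?thesis by (simp add: card_cartesian_product)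
qed

private lemma H'_sub: "H \<subseteq> H'" "g \<in> H'" "H' \<subseteq> carrier G"
proof -
  show "H \<subseteq> H'"
  proof
    fix h assume "h \<in> H"
    then have "h = h \<otimes> g [^] (0::nat)" using H_carrier by simp
    with \<open>h \<in> H\<close> show "h \<in> H'" unfolding H'_def by blast
  qed
  have "g = \<one> \<otimes> g [^] (1::nat)" using g by simp
  then show "g \<in> H'" unfolding H'_def using H_closed(2) by blast
  show "H' \<subseteq> carrier G" using H_carrier g by (auto simp: H'_def)
qed

private lemma H'_mult: "a \<in> H' \<Longrightarrow> b \<in> H' \<Longrightarrow> a \<otimes> b \<in> H'"
proof -
  assume "a \<in> H'" "b \<in> H'"
  then obtain h k h' k' where "h \<in> H" "a = h \<otimes> g [^] (k::nat)" "h' \<in> H" "b = h' \<otimes> g [^] (k'::nat)"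
    by (auto simp: H'_def)
  then have "a \<otimes> b = (h \<otimes> h') \<otimes> g [^] (k + k')" "h \<otimes> h' \<in> H"
    using g H_carrier H_closed by (simp_all add: m_ac flip: nat_pow_mult)
  then show "a \<otimes> b \<in> H'" unfolding H'_def by blast
qed

private lemma H'_subgroup:
  assumes fin: "finite (carrier G)"
  shows "subgroup H' G"
proof
  show "H' \<subseteq> carrier G" by (rule H'_sub(3))
  show "\<one> \<in> H'" using H'_sub(1) H_closed(2) by blast
  show "a \<otimes> b \<in> H'" if "a \<in> H'" "b \<in> H'" for a b using that by (rule H'_mult)
  show "inv a \<in> H'" if a: "a \<in> H'" for a
  proof -
    have ac: "a \<in> carrier G" using a H'_sub by blast
    have pw: "a [^] (n::nat) \<in> H'" for n
      by (induction n) (use \<open>\<one> \<in> H'\<close> a H'_mult in auto)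
    have "Coset.order G > 0" using fin by (simp add: order_gt_0_iff_finite)
    then have "a [^] (Coset.order G - 1) \<otimes> a = a [^] Coset.order G"
      using ac by (metis Suc_pred' nat_pow_Suc)
    also have "\<dots> = \<one>" by (rule pow_order_eq_1[OF ac])
    finally have "inv a = a [^] (Coset.order G - 1)" using ac by (intro inv_equality) auto
    with pw show ?thesis by simp
  qed
qed

text \<open>All relations between \<open>H\<close> and \<open>g\<close> follow from
  \<open>g [^] d \<in> H\<close>, so any \<open>d\<close>-th root of \<open>\<chi> (g [^] d)\<close>
  may serve as the value at \<open>g\<close>.\<close>

private lemma character_extension:
  assumes \<chi>: "\<And>a. a \<in> H \<Longrightarrow> \<chi> a \<noteq> (0::complex)" "\<And>a b. a \<in> H \<Longrightarrow> b \<in> H \<Longrightarrow> \<chi> (a \<otimes> b) = \<chi> a * \<chi> b"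
    and w: "w ^ d = \<chi> (g [^] d)"
  shows "\<exists>\<psi>. (\<forall>a\<in>H'. \<psi> a \<noteq> 0 \<and> (\<forall>b\<in>H'. \<psi> (a \<otimes> b) = \<psi> a * \<psi> b)) \<and>
      (\<forall>h\<in>H. \<forall>k::nat. \<psi> (h \<otimes> g [^] k) = \<chi> h * w ^ k)"
proof -
  have \<chi>1: "\<chi> \<one> = 1" using \<chi>(1)[OF H_closed(2)] \<chi>(2)[OF H_closed(2) H_closed(2)] by simp
  have \<chi>pow: "\<chi> (h [^] (m::nat)) = \<chi> h ^ m" if "h \<in> H" for h m
  proof (induction m)
    case (Suc m)
    then show ?case using \<chi>(2)[OF H_pow[OF that, of m] that] by simp
  qed (simp add: \<chi>1)
  have wd_le: "\<chi> h * w ^ k = \<chi> h' * w ^ k'"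
    if h: "h \<in> H" "h' \<in> H" and eq: "h \<otimes> g [^] (k::nat) = h' \<otimes> g [^] (k'::nat)" and le: "k \<le> k'" for h h' k k'
  proof -
    obtain m where m: "k' = k + d * m" "h = h' \<otimes> (g [^] d) [^] m" using rep_le[OF h eq le] by blast
    have "\<chi> h = \<chi> h' * \<chi> (g [^] d) ^ m"
      unfolding m(2) using \<chi>(2)[OF h(2) H_pow[OF d(2)]] \<chi>pow[OF d(2)] by simp
    then show ?thesis by (simp add: m(1) w[symmetric] power_add power_mult)
  qed
  have wd: "\<chi> h * w ^ k = \<chi> h' * w ^ k'"
    if "h \<in> H" "h' \<in> H" "h \<otimes> g [^] (k::nat) = h' \<otimes> g [^] (k'::nat)" for h h' k k'
    using wd_le[OF that] wd_le[OF that(2,1) that(3)[symmetric]] by (cases "k \<le> k'") auto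
  define \<psi> where "\<psi> a = (THE z. \<exists>h\<in>H. \<exists>k::nat. a = h \<otimes> g [^] k \<and> z = \<chi> h * w ^ k)" for a
  have \<psi>: "\<psi> (h \<otimes> g [^] k) = \<chi> h * w ^ k" if "h \<in> H" for h and k :: nat
    unfolding \<psi>_def
  proof (rule the_equality)
    show "\<exists>h'\<in>H. \<exists>k'::nat. h \<otimes> g [^] k = h' \<otimes> g [^] k' \<and> \<chi> h * w ^ k = \<chi> h' * w ^ k'"
      using that by blast
  next
    fix z assume "\<exists>h'\<in>H. \<exists>k'::nat. h \<otimes> g [^] k = h' \<otimes> g [^] k' \<and> z = \<chi> h' * w ^ k'"
    then show "z = \<chi> h * w ^ k" using wd[OF that] by metis
  qed
  have w0: "w \<noteq> 0"
  proof
    assume "w = 0"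
    then have "w ^ d = 0" using d(1) by simp
    with w \<chi>(1)[OF d(2)] show False by simp
  qed
  show ?thesis
  proof (intro exI conjI ballI allI)
    show "\<psi> (h \<otimes> g [^] k) = \<chi> h * w ^ k" if "h \<in> H" for h and k :: nat by (rule \<psi>[OF that])
    show "\<psi> a \<noteq> 0" if a: "a \<in> H'" for a
    proof -
      obtain h k where "h \<in> H" "a = h \<otimes> g [^] (k::nat)" using a by (auto simp: H'_def)
      then show ?thesis using \<psi> \<chi>(1) w0 by simp
    qed
    show "\<psi> (a \<otimes> b) = \<psi> a * \<psi> b" if a: "a \<in> H'" and b: "b \<in> H'" for a b
    proof -
      obtain h k where a': "h \<in> H" "a = h \<otimes> g [^] (k::nat)" using a by (auto simp: H'_def)
      obtain h' k' where b': "h' \<in> H" "b = h' \<otimes> g [^] (k'::nat)" using b by (auto simp: H'_def)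
      have "a \<otimes> b = (h \<otimes> h') \<otimes> g [^] (k + k')"
        using g H_carrier a' b' by (simp add: m_ac flip: nat_pow_mult)
      then show ?thesis using \<psi>[OF H_closed(1)[OF a'(1) b'(1)]] \<psi>[OF a'(1)] \<psi>[OF b'(1)] \<chi>(2)[OF a'(1) b'(1)]
        by (simp add: a'(2) b'(2) power_add mult_ac)
    qed
  qed
qed

text \<open>The possible values at \<open>g\<close> differ by the \<open>d\<close>-th roots of
  unity, whose \<open>k\<close>-th powers sum to 0 for \<open>0 < k < d\<close>; this carries the
  orthogonality relation over to the larger subgroup.\<close>

private lemma extension_list:
  assumes "\<And>a. a \<in> H \<Longrightarrow> \<chi> a \<noteq> (0::complex)" "\<And>a b. a \<in> H \<Longrightarrow> b \<in> H \<Longrightarrow> \<chi> (a \<otimes> b) = \<chi> a * \<chi> b"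
  shows "\<exists>\<psi>s. length \<psi>s = d \<and> (\<forall>\<psi>\<in>set \<psi>s. \<forall>a\<in>H'. \<psi> a \<noteq> 0 \<and> (\<forall>b\<in>H'. \<psi> (a \<otimes> b) = \<psi> a * \<psi> b)) \<and>
    (\<forall>h\<in>H. \<forall>k<d. (\<Sum>\<psi>\<leftarrow>\<psi>s. \<psi> (h \<otimes> g [^] (k::nat))) = (if k = 0 then of_nat d * \<chi> h else 0))"
proof -
  define c where "c = \<chi> (g [^] d)"
  obtain \<rho> where \<rho>: "\<rho> ^ d = c"
  proof -
    have "rcis (root d (cmod c)) (Arg c / d) ^ d = c"
      using d(1) by (simp add: DeMoivre2 rcis_cmod_Arg)
    then show thesis by (rule that)
  qed
  define w where "w l = \<rho> * cis (2 * pi / d) ^ l" for l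
  have w: "w l ^ d = \<chi> (g [^] d)" for l
  proof -
    have "(cis (2 * pi / d) ^ l) ^ d = (cis (2 * pi / d) ^ d) ^ l" by (simp add: power_mult[symmetric] mult.commute)
    also have "cis (2 * pi / d) ^ d = 1" using d(1) by (simp add: DeMoivre)
    finally show ?thesis by (simp add: w_def power_mult_distrib \<rho> c_def)
  qed
  have "\<forall>l. \<exists>\<psi>. (\<forall>a\<in>H'. \<psi> a \<noteq> 0 \<and> (\<forall>b\<in>H'. \<psi> (a \<otimes> b) = \<psi> a * \<psi> b)) \<and>
      (\<forall>h\<in>H. \<forall>k::nat. \<psi> (h \<otimes> g [^] k) = \<chi> h * w l ^ k)"
    by (intro allI character_extension assms w)
  from choice[OF this] obtain \<psi> where \<psi>:
    "\<forall>l. (\<forall>a\<in>H'. \<psi> l a \<noteq> 0 \<and> (\<forall>b\<in>H'. \<psi> l (a \<otimes> b) = \<psi> l a * \<psi> l b)) \<and>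
      (\<forall>h\<in>H. \<forall>k::nat. \<psi> l (h \<otimes> g [^] k) = \<chi> h * w l ^ k)" by blast
  show ?thesis
  proof (intro exI conjI ballI allI impI)
    let ?L = "map \<psi> [0..<d]"
    show "length ?L = d" by simp
    show "\<psi>' a \<noteq> 0" if "\<psi>' \<in> set ?L" "a \<in> H'" for \<psi>' a
      using that \<psi> by auto
    show "\<psi>' (a \<otimes> b) = \<psi>' a * \<psi>' b" if "\<psi>' \<in> set ?L" "a \<in> H'" "b \<in> H'" for \<psi>' a b
      using that \<psi> by auto
    fix h and k :: nat assume h: "h \<in> H" and k: "k < d"
    have "(\<Sum>\<psi>'\<leftarrow>?L. \<psi>' (h \<otimes> g [^] k)) = (\<Sum>l<d. \<chi> h * w l ^ k)"
      using \<psi> h by (simp add: comp_def interv_sum_list_conv_sum_set_nat atLeast0LessThan)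
    also have "\<dots> = \<chi> h * \<rho> ^ k * (\<Sum>l<d. (cis (2 * pi / d) ^ l) ^ k)"
      by (simp add: w_def power_mult_distrib sum_distrib_left mult_ac)
    also have "\<dots> = (if k = 0 then of_nat d * \<chi> h else 0)"
      using sum_roots_unity[of k d] k by auto
    finally show "(\<Sum>\<psi>'\<leftarrow>?L. \<psi>' (h \<otimes> g [^] k)) = (if k = 0 then of_nat d * \<chi> h else 0)" .
  qed
qed

lemma char_list_extend:
  assumes fin: "finite (carrier G)" and \<chi>s: "char_list G H \<chi>s"
  shows "\<exists>H' \<psi>s. subgroup H' G \<and> H \<subseteq> H' \<and> g \<in> H' \<and> char_list G H' \<psi>s"
proof -
  have fH: "finite H" using fin subgroup.subset[OF H] by (rule finite_subset[rotated])
  have "\<forall>\<chi>\<in>set \<chi>s. \<exists>\<psi>s. length \<psi>s = d \<and>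
    (\<forall>\<psi>\<in>set \<psi>s. \<forall>a\<in>H'. \<psi> a \<noteq> 0 \<and> (\<forall>b\<in>H'. \<psi> (a \<otimes> b) = \<psi> a * \<psi> b)) \<and>
    (\<forall>h\<in>H. \<forall>k<d. (\<Sum>\<psi>\<leftarrow>\<psi>s. \<psi> (h \<otimes> g [^] (k::nat))) = (if k = 0 then of_nat d * \<chi> h else 0))"
    using \<chi>s by (intro ballI extension_list) (auto simp: char_list_def)
  from bchoice[OF this] obtain ext where ext0: "\<forall>\<chi>\<in>set \<chi>s. length (ext \<chi>) = d \<and>
    (\<forall>\<psi>\<in>set (ext \<chi>). \<forall>a\<in>H'. \<psi> a \<noteq> 0 \<and> (\<forall>b\<in>H'. \<psi> (a \<otimes> b) = \<psi> a * \<psi> b)) \<and>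
    (\<forall>h\<in>H. \<forall>k<d. (\<Sum>\<psi>\<leftarrow>ext \<chi>. \<psi> (h \<otimes> g [^] (k::nat))) = (if k = 0 then of_nat d * \<chi> h else 0))"
    by blast
  have ext: "\<And>\<chi>. \<chi> \<in> set \<chi>s \<Longrightarrow> length (ext \<chi>) = d"
    "\<And>\<chi> \<psi> a. \<chi> \<in> set \<chi>s \<Longrightarrow> \<psi> \<in> set (ext \<chi>) \<Longrightarrow> a \<in> H' \<Longrightarrow> \<psi> a \<noteq> 0 \<and> (\<forall>b\<in>H'. \<psi> (a \<otimes> b) = \<psi> a * \<psi> b)"
    "\<And>\<chi> h k. \<chi> \<in> set \<chi>s \<Longrightarrow> h \<in> H \<Longrightarrow> k < d \<Longrightarrow>
      (\<Sum>\<psi>\<leftarrow>ext \<chi>. \<psi> (h \<otimes> g [^] (k::nat))) = (if k = 0 then of_nat d * \<chi> h else 0)"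
    using ext0 by blast+
  define \<psi>s where "\<psi>s = concat (map ext \<chi>s)"
  have sum: "(\<Sum>\<psi>\<leftarrow>\<psi>s. \<psi> a) = (\<Sum>\<chi>\<leftarrow>\<chi>s. \<Sum>\<psi>\<leftarrow>ext \<chi>. \<psi> a)" for a
    unfolding \<psi>s_def by (induction \<chi>s) auto
  have "char_list G H' \<psi>s"
    unfolding char_list_def
  proof (intro conjI ballI)
    have "length \<psi>s = (\<Sum>\<chi>\<leftarrow>\<chi>s. d)"
      unfolding \<psi>s_def length_concat map_map comp_def by (rule arg_cong[of _ _ sum_list], rule map_cong) (use ext(1) in auto)
    also have "\<dots> = card H * d" using \<chi>s by (simp add: sum_list_triv char_list_def)
    finally show "length \<psi>s = card H'" using card_H'[OF fH] by simp
    show "\<psi> a \<noteq> 0" if "\<psi> \<in> set \<psi>s" "a \<in> H'" for \<psi> a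
    proof -
      from that(1) obtain \<chi> where "\<chi> \<in> set \<chi>s" "\<psi> \<in> set (ext \<chi>)" by (auto simp: \<psi>s_def)
      from ext(2)[OF this that(2)] show ?thesis by blast
    qed
    show "\<psi> (a \<otimes> b) = \<psi> a * \<psi> b" if "\<psi> \<in> set \<psi>s" "a \<in> H'" "b \<in> H'" for \<psi> a b
    proof -
      from that(1) obtain \<chi> where "\<chi> \<in> set \<chi>s" "\<psi> \<in> set (ext \<chi>)" by (auto simp: \<psi>s_def)
      from ext(2)[OF this that(2)] that(3) show ?thesis by blast
    qed
    fix a assume "a \<in> H'"
    then obtain h k where a: "h \<in> H" "k < d" "a = h \<otimes> g [^] (k::nat)" using H'_small by blast
    have "(\<Sum>\<psi>\<leftarrow>\<psi>s. \<psi> a) = (\<Sum>\<chi>\<leftarrow>\<chi>s. if k = 0 then of_nat d * \<chi> h else 0)"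
      unfolding sum by (rule arg_cong[of _ _ sum_list], rule map_cong) (use ext(3) a in auto)
    also have "\<dots> = (if k = 0 then of_nat d * (\<Sum>\<chi>\<leftarrow>\<chi>s. \<chi> h) else 0)"
      by (simp add: sum_list_const_mult)
    also have "(\<Sum>\<chi>\<leftarrow>\<chi>s. \<chi> h) = (if h = \<one> then of_nat (card H) else 0)"
      using \<chi>s a(1) by (simp add: char_list_def)
    also have "(if k = 0 then of_nat d * (if h = \<one> then of_nat (card H) else 0) else 0)
        = (if a = \<one> then of_nat (card H') else (0::complex))"
    proof -
      have "a = \<one> \<longleftrightarrow> h = \<one> \<and> k = 0"
        using rep_less[OF a(1) H_closed(2), of k 0] a d(1) by auto
      then show ?thesis using card_H'[OF fH] by auto
    qed
    finally show "(\<Sum>\<psi>\<leftarrow>\<psi>s. \<psi> a) = (if a = \<one> then of_nat (card H') else 0)" .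
  qed
  with H'_subgroup[OF fin] H'_sub show ?thesis by blast
qed

end

text \<open>From the trivial subgroup upwards, one element is adjoined at a time; \<open>d\<close>
  is its least positive exponent that leads into the subgroup, as the extension step
  requires.\<close>

theorem char_list_exists:
  assumes fin: "finite (carrier G)"
  shows "\<exists>\<chi>s. char_list G (carrier G) \<chi>s"
proof -
  have "\<exists>\<chi>s. char_list G (carrier G) \<chi>s" if "subgroup H G" "char_list G H \<chi>s" for H \<chi>s
    using that
  proof (induction "card (carrier G - H)" arbitrary: H \<chi>s rule: less_induct)
    case less
    show ?case
    proof (cases "H = carrier G")
      case False
      then obtain g where g: "g \<in> carrier G" "g \<notin> H" using subgroup.subset[OF less.prems(1)] by blast
      have "g [^] Coset.order G \<in> H" "Coset.order G > 0"
        using pow_order_eq_1[OF g(1)] subgroup.one_closed[OF less.prems(1)] fin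
        by (auto simp: order_gt_0_iff_finite)
      then have ex: "\<exists>d>0. g [^] (d::nat) \<in> H" by blast
      define d where "d = (LEAST d. d > 0 \<and> g [^] (d::nat) \<in> H)"
      have d: "d > 0" "g [^] d \<in> H" using LeastI_ex[OF ex] by (simp_all add: d_def)
      have dm: "g [^] k \<notin> H" if "0 < k" "k < d" for k :: nat
        using not_less_Least[of k "\<lambda>d. d > 0 \<and> g [^] d \<in> H"] that by (auto simp: d_def)
      obtain H' \<psi>s where H': "subgroup H' G" "H \<subseteq> H'" "g \<in> H'" "char_list G H' \<psi>s"
        using char_list_extend[OF less.prems(1) g(1) d dm fin less.prems(2)] by blast
      have "card (carrier G - H') < card (carrier G - H)"
        by (rule psubset_card_mono) (use fin H' g in auto)
      then show ?thesis using less.hyps[OF _ H'(1,4)] by blast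
    qed (use less.prems in blast)
  qed
  moreover have "char_list G {\<one>} [\<lambda>_. 1]" by (simp add: char_list_def)
  ultimately show ?thesis using triv_subgroup by blast
qed

end

subsection \<open>The ring \<open>\<Lambda>\<close>\<close>

text \<open>The characters of the unit group modulo \<open>n\<close>, extended by 0. Modulus 1 is
  treated apart because the locale \<open>residues\<close> asks for a modulus greater than
  1.\<close>

lemma dirichlet_orthogonality:
  assumes n: "n > 0"
  shows "\<exists>\<chi>s. (\<forall>\<chi>\<in>set \<chi>s. dirichlet_character n \<chi>) \<and>
    (\<forall>a. coprime a (int n) \<longrightarrow>
      (\<Sum>\<chi>\<leftarrow>\<chi>s. \<chi> a) = (if [a = 1] (mod int n) then of_nat (totient n) else 0))"
proof (cases "n = 1")
  case True
  have "dirichlet_character 1 (\<lambda>_. 1)" by (simp add: dirichlet_character_def)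
  then show ?thesis using True by (intro exI[of _ "[\<lambda>_. 1]"]) simp
next
  case False
  define Z where "Z = residue_ring (int n)"
  interpret Z: residues "int n" Z
    unfolding Z_def by unfold_locales (use n False in auto)
  let ?G = "units_of Z"
  interpret G: comm_group ?G by (rule Z.units_comm_group)
  have carrier: "carrier ?G = {x. 0 < x \<and> x < int n \<and> coprime x (int n)}"
    by (simp add: units_of_def Z.res_units_eq)
  have fin: "finite (carrier ?G)" by (simp add: units_of_def)
  have cardG: "card (carrier ?G) = totient n"
    using Z.totient_eq n by (simp add: units_of_def)
  have mult: "a \<otimes>\<^bsub>?G\<^esub> b = a * b mod int n" and one: "\<one>\<^bsub>?G\<^esub> = 1" for a b
    by (simp_all add: units_of_def Z.res_mult_eq Z.res_one_eq)
  obtain \<chi>s where \<chi>s: "char_list ?G (carrier ?G) \<chi>s" using G.char_list_exists[OF fin] by blast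
  have modG: "a mod int n \<in> carrier ?G" if "coprime a (int n)" for a
  proof -
    have "a mod int n \<noteq> 0"
    proof
      assume "a mod int n = 0"
      then have "int n dvd a" by auto
      then have "is_unit (int n)" by (rule coprime_common_divisor[OF that]) simp
      then show False using n False by simp
    qed
    moreover have "0 \<le> a mod int n" "a mod int n < int n" using n by simp_all
    moreover have "coprime (a mod int n) (int n)" using that n by (simp add: coprime_iff_gcd_eq_1)
    ultimately show ?thesis unfolding carrier by simp
  qed
  define ext where "ext \<chi> a = (if coprime a (int n) then \<chi> (a mod int n) else 0)"
    for \<chi> :: "int \<Rightarrow> complex" and a
  have dir: "dirichlet_character n (ext \<chi>)" if "\<chi> \<in> set \<chi>s" for \<chi>
    unfolding dirichlet_character_def
  proof (intro conjI allI n)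
    fix a b
    have "\<forall>\<chi>\<in>set \<chi>s. \<forall>u\<in>carrier ?G. \<chi> u \<noteq> 0 \<and>
        (\<forall>v\<in>carrier ?G. \<chi> (u \<otimes>\<^bsub>?G\<^esub> v) = \<chi> u * \<chi> v)"
      by (rule conjunct1[OF conjunct2[OF \<chi>s[unfolded char_list_def]]])
    from bspec[OF this \<open>\<chi> \<in> set \<chi>s\<close>]
    have *: "\<forall>u\<in>carrier ?G. \<chi> u \<noteq> 0 \<and> (\<forall>v\<in>carrier ?G. \<chi> (u * v mod int n) = \<chi> u * \<chi> v)"
      unfolding mult .
    have \<chi>: "\<chi> u \<noteq> 0" "v \<in> carrier ?G \<Longrightarrow> \<chi> (u * v mod int n) = \<chi> u * \<chi> v"
      if "u \<in> carrier ?G" for u v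
      using bspec[OF * that] by blast+
    have "coprime (a + int n) (int n) \<longleftrightarrow> coprime a (int n)"
      by (simp add: coprime_iff_gcd_eq_1)
    then show "ext \<chi> (a + int n) = ext \<chi> a" by (simp add: ext_def)
    show "ext \<chi> (a * b) = ext \<chi> a * ext \<chi> b"
    proof (cases "coprime a (int n) \<and> coprime b (int n)")
      case True
      then have "\<chi> ((a mod int n) * (b mod int n) mod int n) = \<chi> (a mod int n) * \<chi> (b mod int n)"
        by (intro \<chi>(2) modG) auto
      with True show ?thesis by (simp add: ext_def mod_mult_eq)
    qed (auto simp: ext_def)
    show "ext \<chi> a \<noteq> 0 \<longleftrightarrow> gcd a (int n) = 1"
      using \<chi>(1)[OF modG[of a]] by (simp add: ext_def coprime_iff_gcd_eq_1)
  qed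
  have "(\<Sum>\<chi>\<leftarrow>map ext \<chi>s. \<chi> a) = (if [a = 1] (mod int n) then of_nat (totient n) else 0)"
    if a: "coprime a (int n)" for a
  proof -
    have "(\<Sum>\<chi>\<leftarrow>map ext \<chi>s. \<chi> a) = (\<Sum>\<chi>\<leftarrow>\<chi>s. \<chi> (a mod int n))"
      using a by (simp add: comp_def ext_def)
    also have "\<dots> = (if a mod int n = 1 then of_nat (totient n) else 0)"
      using \<chi>s modG[OF a] by (simp add: char_list_def one cardG)
    also have "a mod int n = 1 \<longleftrightarrow> [a = 1] (mod int n)"
      using n False by (simp add: cong_def)
    finally show ?thesis .
  qed
  then show ?thesis using dir by (intro exI[of _ "map ext \<chi>s"]) auto
qed

section \<open>Functions that agree with an element of \<Lambda> at all powers of large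
  primes\<close>

definition lam :: "(nat \<Rightarrow> complex) \<Rightarrow> bool" where
  "lam f \<longleftrightarrow> (\<exists>g\<in>Lambda_ring. \<exists>P. \<forall>p a. Factorial_Ring.prime p \<and> p \<ge> P \<and> a \<ge> 1 \<longrightarrow> f (p ^ a) = g (p ^ a))"

lemma lamI:
  "g \<in> Lambda_ring \<Longrightarrow> (\<And>p a. Factorial_Ring.prime p \<Longrightarrow> p \<ge> P \<Longrightarrow> a \<ge> 1 \<Longrightarrow> f (p ^ a) = g (p ^ a)) \<Longrightarrow> lam f"
  unfolding lam_def by blast

lemma lamE:
  assumes "lam f"
  obtains g P where "g \<in> Lambda_ring"
    "\<forall>p a. Factorial_Ring.prime p \<and> p \<ge> P \<and> a \<ge> 1 \<longrightarrow> f (p ^ a) = g (p ^ a)"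
  using assms unfolding lam_def by blast

lemma primepow_power: "Factorial_Ring.prime p \<Longrightarrow> a \<ge> 1 \<Longrightarrow> primepow (p ^ a :: nat)"
  unfolding primepow_def by (intro exI[of _ p] exI[of _ a]) auto

lemma lam_eventually:
  assumes f: "lam f" and eq: "\<And>p a. Factorial_Ring.prime p \<Longrightarrow> p \<ge> P \<Longrightarrow> a \<ge> 1 \<Longrightarrow> f' (p ^ a) = f (p ^ a)"
  shows "lam f'"
proof -
  from f obtain g P' where g: "g \<in> Lambda_ring"
    "\<forall>p a. Factorial_Ring.prime p \<and> p \<ge> P' \<and> a \<ge> 1 \<longrightarrow> f (p ^ a) = g (p ^ a)" by (rule lamE)
  show ?thesis by (rule lamI[OF g(1), of "max P P'"]) (use g(2) eq in auto)
qed

lemma lam_q: "lam (\<lambda>q. of_nat q)"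
proof (rule lamI[of "\<lambda>q\<in>prime_powers. of_nat q" 0])
  show "(\<lambda>q\<in>prime_powers. of_nat q) \<in> Lambda_ring"
    unfolding Lambda_ring_def by (rule generate_ring.incl) simp
qed (simp add: primepow_power)

lemma lam_character:
  assumes "dirichlet_character N \<chi>"
  shows "lam (\<lambda>q. \<chi> (int q))"
proof (rule lamI[of "\<lambda>q\<in>prime_powers. \<chi> (int q)" 0])
  show "(\<lambda>q\<in>prime_powers. \<chi> (int q)) \<in> Lambda_ring"
    unfolding Lambda_ring_def by (rule generate_ring.incl) (use assms in blast)
qed (simp add: primepow_power)

lemma lam_one: "lam (\<lambda>_. 1)"
proof (rule lamI[of "\<one>\<^bsub>prime_power_functions\<^esub>" 0])
  show "\<one>\<^bsub>prime_power_functions\<^esub> \<in> Lambda_ring"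
    unfolding Lambda_ring_def by (rule generate_ring.one)
qed (simp add: prime_power_functions_def primepow_power)

lemma lam_minus_one: "lam (\<lambda>_. - 1)"
proof (rule lamI[of "\<ominus>\<^bsub>prime_power_functions\<^esub> \<one>\<^bsub>prime_power_functions\<^esub>" 0])
  let ?R = prime_power_functions
  show "\<ominus>\<^bsub>?R\<^esub> \<one>\<^bsub>?R\<^esub> \<in> Lambda_ring"
    unfolding Lambda_ring_def by (intro generate_ring.a_inv generate_ring.one)
  have "\<ominus>\<^bsub>?R\<^esub> \<one>\<^bsub>?R\<^esub> = (\<lambda>q\<in>prime_powers. - 1)"
    unfolding a_inv_def m_inv_def
  \<comment> \<open>The negative is given by a definite description, so existence and uniqueness are
    both verified pointwise.\<close>
  proof (rule the_equality)
    show "(\<lambda>q\<in>prime_powers. - 1) \<in> carrier (add_monoid ?R) \<and>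
        \<one>\<^bsub>?R\<^esub> \<otimes>\<^bsub>add_monoid ?R\<^esub> (\<lambda>q\<in>prime_powers. - 1) = \<one>\<^bsub>add_monoid ?R\<^esub> \<and>
        (\<lambda>q\<in>prime_powers. - 1) \<otimes>\<^bsub>add_monoid ?R\<^esub> \<one>\<^bsub>?R\<^esub> = \<one>\<^bsub>add_monoid ?R\<^esub>"
      by (auto simp: prime_power_functions_def fun_eq_iff)
  next
    fix y assume y: "y \<in> carrier (add_monoid ?R) \<and>
        \<one>\<^bsub>?R\<^esub> \<otimes>\<^bsub>add_monoid ?R\<^esub> y = \<one>\<^bsub>add_monoid ?R\<^esub> \<and> y \<otimes>\<^bsub>add_monoid ?R\<^esub> \<one>\<^bsub>?R\<^esub> = \<one>\<^bsub>add_monoid ?R\<^esub>"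
    show "y = (\<lambda>q\<in>prime_powers. - 1)"
    proof (rule extensionalityI[of _ prime_powers])
      show "y \<in> extensional prime_powers" using y by (simp add: prime_power_functions_def PiE_def)
      fix q assume q: "q \<in> prime_powers"
      have "(\<lambda>q\<in>prime_powers. y q + (\<lambda>q\<in>prime_powers. 1) q) = (\<lambda>q\<in>prime_powers. 0)"
        using y by (simp add: prime_power_functions_def)
      from fun_cong[OF this, of q] q have "y q + 1 = 0" by simp
      then show "y q = (\<lambda>q\<in>prime_powers. - 1) q" using q by (simp add: eq_neg_iff_add_eq_0)
    qed simp
  qed
  then show "(- 1) = (\<ominus>\<^bsub>?R\<^esub> \<one>\<^bsub>?R\<^esub>) (p ^ a)" if "Factorial_Ring.prime p" "a \<ge> 1" for p a :: nat
    using primepow_power[OF that] by simp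
qed

lemma lam_add: assumes "lam f" "lam g" shows "lam (\<lambda>q. f q + g q)"
  and lam_mult: "lam (\<lambda>q. f q * g q)"
proof -
  from assms(1) obtain f' P where f: "f' \<in> Lambda_ring"
    "\<forall>p a. Factorial_Ring.prime p \<and> p \<ge> P \<and> a \<ge> 1 \<longrightarrow> f (p ^ a) = f' (p ^ a)" by (rule lamE)
  from assms(2) obtain g' P' where g: "g' \<in> Lambda_ring"
    "\<forall>p a. Factorial_Ring.prime p \<and> p \<ge> P' \<and> a \<ge> 1 \<longrightarrow> g (p ^ a) = g' (p ^ a)" by (rule lamE)
  show "lam (\<lambda>q. f q + g q)"
  proof (rule lamI[of "f' \<oplus>\<^bsub>prime_power_functions\<^esub> g'" "max P P'"])
    show "f' \<oplus>\<^bsub>prime_power_functions\<^esub> g' \<in> Lambda_ring"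
      using f(1) g(1) unfolding Lambda_ring_def by (rule generate_ring.eng_add)
  qed (use f(2) g(2) in \<open>auto simp: prime_power_functions_def primepow_power\<close>)
  show "lam (\<lambda>q. f q * g q)"
  proof (rule lamI[of "f' \<otimes>\<^bsub>prime_power_functions\<^esub> g'" "max P P'"])
    show "f' \<otimes>\<^bsub>prime_power_functions\<^esub> g' \<in> Lambda_ring"
      using f(1) g(1) unfolding Lambda_ring_def by (rule generate_ring.eng_mult)
  qed (use f(2) g(2) in \<open>auto simp: prime_power_functions_def primepow_power\<close>)
qed

lemma lam_diff: "lam f \<Longrightarrow> lam g \<Longrightarrow> lam (\<lambda>q. f q - g q)"
  using lam_add[of f "\<lambda>q. - 1 * g q"] lam_mult[OF lam_minus_one, of g] by simp

lemma lam_zero: "lam (\<lambda>_. 0)"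
  using lam_diff[OF lam_one lam_one] by simp

lemma lam_power: "lam f \<Longrightarrow> lam (\<lambda>q. f q ^ n)"
  by (induction n) (simp_all add: lam_one lam_mult)

lemma lam_sum: "(\<And>i. i \<in> I \<Longrightarrow> lam (f i)) \<Longrightarrow> lam (\<lambda>q. \<Sum>i\<in>I. f i q)"
  by (induction I rule: infinite_finite_induct) (simp_all add: lam_zero lam_add)

lemma lam_sum_list: "(\<And>x. x \<in> set xs \<Longrightarrow> lam (f x)) \<Longrightarrow> lam (\<lambda>q. \<Sum>x\<leftarrow>xs. f x q)"
  by (induction xs) (simp_all add: lam_zero lam_add)

lemma lam_prod_list: "(\<And>x. x \<in> set xs \<Longrightarrow> lam (f x)) \<Longrightarrow> lam (\<lambda>q. \<Prod>x\<leftarrow>xs. f x q)"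
  by (induction xs) (simp_all add: lam_one lam_mult)

lemma prime_power_minus_one:
  assumes "Factorial_Ring.prime p" "p \<ge> 3" "a \<ge> 1"
  shows "p ^ a - 1 > 0" "even (p ^ a - 1 :: nat)"
proof -
  have "odd p" using prime_odd_nat[OF assms(1)] assms(2) by simp
  then show "even (p ^ a - 1)" by simp
  have "1 < p ^ a" using assms by (intro one_less_power) auto
  then show "p ^ a - 1 > 0" by simp
qed

text \<open>The function is the sum of all characters modulo \<open>e\<close>; \<open>p > e\<close>
  makes \<open>q\<close> prime to \<open>e\<close>, as the orthogonality relation demands.\<close>

lemma lam_totient_indicator:
  assumes e: "e > 0"
  shows "lam (\<lambda>q. of_nat (if e dvd q - 1 then totient e else 0))"
proof -
  obtain \<chi>s where \<chi>s: "\<forall>\<chi>\<in>set \<chi>s. dirichlet_character e \<chi>" "\<forall>a. coprime a (int e) \<longrightarrow>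
      (\<Sum>\<chi>\<leftarrow>\<chi>s. \<chi> a) = (if [a = 1] (mod int e) then of_nat (totient e) else 0)"
    using dirichlet_orthogonality[OF e] by blast
  have "lam (\<lambda>q. \<Sum>\<chi>\<leftarrow>\<chi>s. \<chi> (int q))" by (rule lam_sum_list) (use \<chi>s(1) lam_character in blast)
  then show ?thesis
  proof (rule lam_eventually[of _ "e + 1"])
    fix p a :: nat assume p: "Factorial_Ring.prime p" "p \<ge> e + 1" "a \<ge> 1"
    have "\<not> p dvd e" using p(2) e by (auto dest: dvd_imp_le)
    then have "coprime (p ^ a) e" using prime_imp_coprime[OF p(1)] by simp
    then have c: "coprime (int (p ^ a)) (int e)" by (simp only: coprime_int_iff)
    have "p ^ a \<ge> 1" using prime_gt_0_nat[OF p(1)] by (simp add: Suc_le_eq)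
    have "[int (p ^ a) = 1] (mod int e) \<longleftrightarrow> e dvd p ^ a - 1"
    proof -
      have "int (p ^ a) - 1 = int (p ^ a - 1)" using \<open>p ^ a \<ge> 1\<close> by (simp add: of_nat_diff)
      then show ?thesis unfolding cong_iff_dvd_diff by (simp only: int_dvd_int_iff)
    qed
    with \<chi>s(2) c show "of_nat (if e dvd p ^ a - 1 then totient e else 0) = (\<Sum>\<chi>\<leftarrow>\<chi>s. \<chi> (int (p ^ a)))"
      by simp
  qed
qed

text \<open>Gauss's identity, by which a number is the sum of \<open>totient e\<close> over its
  divisors \<open>e\<close>, applied to the gcd.\<close>

lemma lam_gcd:
  assumes d: "d > 0"
  shows "lam (\<lambda>q. of_nat (gcd d (q - 1)))"
proof -
  have "lam (\<lambda>q. \<Sum>e\<in>{e. e dvd d}. of_nat (if e dvd q - 1 then totient e else 0))"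
    by (intro lam_sum lam_totient_indicator) (use d in \<open>auto intro: Nat.gr0I\<close>)
  moreover have "gcd d (q - 1) = (\<Sum>e\<in>{e. e dvd d}. if e dvd q - 1 then totient e else 0)" for q
  proof -
    have "gcd d (q - 1) = (\<Sum>e | e dvd gcd d (q - 1). totient e)" by (rule totient_divisor_sum[symmetric])
    also have "{e. e dvd gcd d (q - 1)} = {e \<in> {e. e dvd d}. e dvd q - 1}" by auto
    also have "sum totient \<dots> = (\<Sum>e\<in>{e. e dvd d}. if e dvd q - 1 then totient e else 0)"
      by (rule sum.inter_filter) (use d in simp)
    finally show ?thesis .
  qed
  ultimately show ?thesis by simp
qed

text \<open>For \<open>p \<ge> 3\<close> the number \<open>q - 1\<close> is even, so
  \<open>card_single\<close> expresses the count by gcds with \<open>q - 1\<close>.\<close>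

lemma lam_single:
  assumes d: "d \<noteq> 0"
  shows "lam (\<lambda>q. of_nat (card (single (q - 1) d e)))"
proof -
  have *: "lam (\<lambda>q. of_nat (gcd (nat \<bar>c\<bar>) (q - 1)))" if "c \<noteq> 0" for c :: int
    by (rule lam_gcd) (use that in simp)
  have "lam (\<lambda>q. if even e then of_nat (gcd (nat \<bar>d\<bar>) (q - 1))
      else of_nat (gcd (nat \<bar>2 * d\<bar>) (q - 1)) - of_nat (gcd (nat \<bar>d\<bar>) (q - 1)))"
    using *[OF d] lam_diff[OF *[of "2 * d"] *[OF d]] d by (cases "even e") simp_all
  then show ?thesis
  proof (rule lam_eventually[of _ 3])
    fix p a :: nat assume p: "Factorial_Ring.prime p" "p \<ge> 3" "a \<ge> 1"
    have "of_int (int (card (single (p ^ a - 1) d e))) =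
        (of_int (if even e then int (gcd (nat \<bar>d\<bar>) (p ^ a - 1))
          else int (gcd (nat \<bar>2 * d\<bar>) (p ^ a - 1)) - int (gcd (nat \<bar>d\<bar>) (p ^ a - 1))) :: complex)"
      by (rule arg_cong[OF card_single[OF prime_power_minus_one[OF p]]])
    then show "of_nat (card (single (p ^ a - 1) d e)) = (if even e then of_nat (gcd (nat \<bar>d\<bar>) (p ^ a - 1))
        else of_nat (gcd (nat \<bar>2 * d\<bar>) (p ^ a - 1)) - of_nat (gcd (nat \<bar>d\<bar>) (p ^ a - 1)) :: complex)"
      by (cases "even e") (simp_all only: if_True if_False of_int_of_nat_eq of_int_diff)
  qed
qed

text \<open>For even \<open>M\<close> the condition depends on the parity of \<open>c\<close> alone,
  so the function is constant on powers of odd primes.\<close>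

lemma lam_half_indicator:
  "lam (\<lambda>q. of_nat (if [c * half (q - 1) = 0] (mod int (q - 1)) then 1 else 0))"
proof -
  have "lam (\<lambda>_. if even c then 1 else 0)" using lam_one lam_zero by simp
  then show ?thesis
  proof (rule lam_eventually[of _ 3])
    fix p a :: nat assume p: "Factorial_Ring.prime p" "p \<ge> 3" "a \<ge> 1"
    define M where "M = p ^ a - 1"
    have M: "M > 0" "even M" using prime_power_minus_one[OF p] by (simp_all add: M_def)
    then obtain h where h: "M = 2 * h" by blast
    have half: "half M = int h" unfolding half_def using M(2) by (simp add: h)
    have "[c * half M = 0] (mod int M) \<longleftrightarrow> 2 * int h dvd c * int h"
      unfolding half by (simp add: cong_0_iff h)
    also have "\<dots> \<longleftrightarrow> even c" using M(1) h by simp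
    finally show "of_nat (if [c * half (p ^ a - 1) = 0] (mod int (p ^ a - 1)) then 1 else 0)
        = (if even c then 1 else 0 :: complex)" unfolding M_def by simp
  qed
qed

lemma of_nat_prod_list: "of_nat (\<Prod>x\<leftarrow>xs. f x) = (\<Prod>x\<leftarrow>xs. of_nat (f x) :: 'a::comm_semiring_1)"
  by (induction xs) simp_all

lemma lam_of_nat_minus_one: "lam (\<lambda>q. of_nat (q - 1))"
proof -
  have "lam (\<lambda>q. of_nat q - 1)" by (rule lam_diff[OF lam_q lam_one])
  then show ?thesis
  proof (rule lam_eventually[of _ 0])
    fix p a :: nat assume "Factorial_Ring.prime p"
    then have "p ^ a \<ge> 1" using prime_gt_0_nat[of p] by (simp add: Suc_le_eq)
    then show "of_nat (p ^ a - 1) = (of_nat (p ^ a) - 1 :: complex)" by (simp add: of_nat_diff)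
  qed
qed

lemma lam_sols:
  assumes "finite F" "finite T"
  shows "lam (\<lambda>q. of_nat (card (sols (q - 1) F T C e)))"
proof -
  obtain D zs r where D:
    "\<forall>M>0. card (sols M F T C e) = M ^ r * (\<Prod>(d, c)\<leftarrow>D. card (single M d c)) *
        (\<Prod>c\<leftarrow>zs. if [c * half M = 0] (mod int M) then 1 else 0)"
    "\<forall>(d, c)\<in>set D. d \<noteq> 0"
    using diag_count[OF assms, of C e] unfolding diag_count_def by blast
  have "lam (\<lambda>q. of_nat (q - 1) ^ r * (\<Prod>dc\<leftarrow>D. of_nat (card (single (q - 1) (fst dc) (snd dc)))) *
      (\<Prod>c\<leftarrow>zs. of_nat (if [c * half (q - 1) = 0] (mod int (q - 1)) then 1 else 0)))"
    by (intro lam_mult lam_power lam_of_nat_minus_one lam_prod_list lam_half_indicator lam_single)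
       (use D(2) in auto)
  then show ?thesis
  proof (rule lam_eventually[of _ 3])
    fix p a :: nat assume p: "Factorial_Ring.prime p" "p \<ge> 3" "a \<ge> 1"
    show "of_nat (card (sols (p ^ a - 1) F T C e)) =
      of_nat (p ^ a - 1) ^ r * (\<Prod>dc\<leftarrow>D. of_nat (card (single (p ^ a - 1) (fst dc) (snd dc)))) *
      (\<Prod>c\<leftarrow>zs. of_nat (if [c * half (p ^ a - 1) = 0] (mod int (p ^ a - 1)) then 1 else 0) :: complex)"
      unfolding D(1)[rule_format, OF prime_power_minus_one(1)[OF p]] of_nat_mult of_nat_power of_nat_prod_list
      by (simp only: case_prod_unfold)
  qed
qed

text \<open>Every pivot is a unit and contributes exactly one solution, whatever the right-hand
  side; only the free unknowns remain.\<close>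

lemma card_sols_surj:
  assumes F: "finite F" "finite T" and surj: "row_surj F T C" and M: "M > 0"
  shows "card (sols M F T C e) = M ^ (card F - card T)"
proof -
  obtain D zs r where D:
    "\<forall>M>0. card (sols M F T C e) = M ^ r * (\<Prod>(d, c)\<leftarrow>D. card (single M d c)) *
        (\<Prod>c\<leftarrow>zs. if [c * half M = 0] (mod int M) then 1 else 0)"
    "zs = []" "\<forall>(d, c)\<in>set D. \<bar>d\<bar> = 1" "r + card T = card F"
    using diag_count[OF F, of C e] surj unfolding diag_count_def by blast
  have "map (\<lambda>(d, c). card (single M d c)) D = map (\<lambda>_. 1) D"
    using D(3) card_single_unit[OF M] by (intro map_cong) auto
  then have "(\<Prod>(d, c)\<leftarrow>D. card (single M d c)) = 1" by (simp add: map_replicate_const)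
  moreover have "card F - card T = r" using D(4) by simp
  ultimately show ?thesis using D(1,2) M by simp
qed

subsection \<open>Counting points along the Louise recursion\<close>

text \<open>Dual to \<open>colindep_mutate\<close>: a combination of rows of \<open>B\<close> for a
  modified target becomes one of rows of the mutated matrix when only the coefficient of row
  \<open>k\<close> is changed.\<close>

lemma row_surj_mutate:
  assumes v: "valid N S (x, B)" and k: "k \<in> S" and surj: "row_surj {..<N} S B"
  shows "row_surj {..<N} S (mutate_matrix k B)"
  unfolding row_surj_def
proof
  fix t :: "nat \<Rightarrow> int"
  have kN: "k \<in> {..<N}" and Bkk: "B k k = 0" using valid_simps(1,6)[OF v] k by auto
  let ?G = "{..<N} - {k}"
  have split: "sum f {..<N} = f k + sum f ?G" for f :: "nat \<Rightarrow> int" by (rule sum.remove[OF _ kN]) simp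
  \<comment> \<open>The correction by a multiple of \<open>t k\<close> compensates the multiple of
    column \<open>k\<close> that mutation adds; the sign at \<open>k\<close> is the one that
    mutation reverses.\<close>
  define w where "w j = (if j = k then - t k else t j + t k * max (- B k j) 0)" for j
  obtain c where c: "\<forall>j\<in>S. w j = (\<Sum>i<N. c i * B i j)"
    using surj unfolding row_surj_def by blast
  \<comment> \<open>The total multiple of row \<open>k\<close> that mutation adds to the other rows
    of the combination; the new coefficient of row \<open>k\<close> absorbs it.\<close>
  define m where "m = (\<Sum>i\<in>?G. c i * max (B i k) 0)"
  define c' where "c' i = (if i = k then m - c k else c i)" for i
  have c'_k: "c' k = m - c k" and c'_G: "i \<in> ?G \<Longrightarrow> c' i = c i" for i by (simp_all add: c'_def)
  have wk: "(\<Sum>i\<in>?G. c i * B i k) = - t k"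
    using bspec[OF c k] by (simp add: split Bkk w_def)
  have "t j = (\<Sum>i<N. c' i * mutate_matrix k B i j)" if j: "j \<in> S" for j
  proof (cases "j = k")
    case True
    have "(\<Sum>i\<in>?G. c' i * mutate_matrix k B i k) = (\<Sum>i\<in>?G. - (c i * B i k))"
      by (rule sum.cong) (simp_all add: c'_G mutate_matrix_k)
    also have "\<dots> = t k" using wk by (simp add: sum_negf)
    finally show ?thesis unfolding True split by (simp add: mutate_matrix_k Bkk)
  next
    case False
    have "(\<Sum>i\<in>?G. c' i * mutate_matrix k B i j) = (\<Sum>i\<in>?G. c i * B i j
        + c i * max (B i k) 0 * B k j + c i * B i k * max (- B k j) 0)"
      by (rule sum.cong) (use False in \<open>auto simp: c'_G mutate_matrix_alt algebra_simps\<close>)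
    also have "\<dots> = (\<Sum>i\<in>?G. c i * B i j) + m * B k j - t k * max (- B k j) 0"
      unfolding sum.distrib sum_distrib_right[symmetric] wk m_def by simp
    finally have "(\<Sum>i<N. c' i * mutate_matrix k B i j)
        = (\<Sum>i\<in>?G. c i * B i j) + c k * B k j - t k * max (- B k j) 0"
      unfolding split c'_k by (simp add: mutate_matrix_k algebra_simps)
    also have "\<dots> = w j - t k * max (- B k j) 0" using bspec[OF c j] by (simp add: split)
    also have "\<dots> = t j" using False by (simp add: w_def)
    finally show ?thesis by simp
  qed
  then show "\<exists>c. \<forall>j\<in>S. t j = (\<Sum>i<N. c i * mutate_matrix k B i j)" by blast
qed

lemma row_surj_seeds:
  assumes v: "valid N S s" and s': "s' \<in> seeds N S s" and surj: "row_surj {..<N} S (snd s)"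
  shows "row_surj {..<N} S (snd s')"
  using s'
proof (induction rule: seeds.induct)
  case (mutate s' k)
  have "valid N S (fst s', snd s')" using seeds_valid[OF v mutate.hyps(1)] by simp
  from row_surj_mutate[OF this mutate.hyps(2) mutate.IH] show ?case by (simp add: mutate_seed_def)
qed (rule surj)

lemma row_surj_subset: "row_surj F T C \<Longrightarrow> U \<subseteq> T \<Longrightarrow> row_surj F U C"
  unfolding row_surj_def by (meson subsetD)

text \<open>The count is an integer function of \<open>q\<close> alone, so that counts can be
  subtracted. The bound \<open>q \<ge> 2\<close> holds for prime powers and keeps the modulus
  \<open>q - 1\<close> positive.\<close>

definition countable_by :: "nat \<Rightarrow> nat set \<Rightarrow> 'f::field seed \<Rightarrow> (nat \<Rightarrow> int) \<Rightarrow> bool" where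
  "countable_by N S s f \<longleftrightarrow>
     (\<forall>q K. is_finite_field q K \<longrightarrow> finite (ring_points (calg N S s) K) \<and>
        int (card (ring_points (calg N S s) K)) = f q) \<and>
     lam (\<lambda>q. of_int (f q)) \<and>
     (row_surj {..<N} S (snd s) \<longrightarrow> (\<exists>p :: int poly. \<forall>q\<ge>2. f q = poly p (int q)))"

lemma countable_by_no_edges:
  fixes x :: "nat \<Rightarrow> 'f::field_char_0"
  assumes v: "valid N S (x, B)" and no_edges: "quiver_edges S B = {}"
  shows "\<exists>f. countable_by N S (x, B) f"
proof -
  have B0: "B i k = 0" if "i \<in> S" "k \<in> S" for i k by (rule no_edges_entries[OF v no_edges that])
  have SN: "S \<subseteq> {..<N}" and fS: "finite S" using valid_simps(1,2)[OF v] .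
  let ?F = "{..<N} - S"
  define c where "c q = (\<Sum>T\<in>Pow S. q ^ card T * (q - 1) ^ card (S - T) * card (sols (q - 1) ?F T B (\<lambda>_. 1)))" for q
  have fT: "finite T" if "T \<in> Pow S" for T using that fS by (auto intro: finite_subset)
  have "finite (ring_points (calg N S (x, B)) K) \<and> int (card (ring_points (calg N S (x, B)) K)) = int (c q)"
    if K: "is_finite_field q K" for q K
  proof -
    have KF: "Ring.field K" "finite (carrier K)" "card (carrier K) = q" using K by (auto simp: is_finite_field_def)
    interpret K: Ring.field K by (rule KF(1))
    note bij = no_edges_points[OF v B0 K.is_cring]
    note ct = card_tuples[OF KF SN B0]
    from bij_betw_finite[OF bij] bij_betw_same_card[OF bij] ct show ?thesis by (simp add: c_def)
  qed
  moreover have "lam (\<lambda>q. of_int (int (c q)))"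
  proof -
    have "lam (\<lambda>q. \<Sum>T\<in>Pow S. of_nat q ^ card T * of_nat (q - 1) ^ card (S - T) *
        of_nat (card (sols (q - 1) ?F T B (\<lambda>_. 1))))"
      by (intro lam_sum lam_mult lam_power lam_q lam_of_nat_minus_one lam_sols) (use fT in simp_all)
    then show ?thesis by (simp add: c_def)
  qed
  moreover have "\<exists>p :: int poly. \<forall>q\<ge>2. int (c q) = poly p (int q)" if surj: "row_surj {..<N} S B"
  proof -
    have surjT: "row_surj ?F T B" if T: "T \<in> Pow S" for T
      unfolding row_surj_def
    proof
      fix t
      obtain b where b: "\<forall>k\<in>S. t k = (\<Sum>i<N. b i * B i k)" using surj unfolding row_surj_def by blast
      have "t k = (\<Sum>i\<in>?F. b i * B i k)" if k: "k \<in> T" for k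
      proof -
        have "k \<in> S" using T k by blast
        then have "t k = (\<Sum>i<N. b i * B i k)" using b by blast
        also have "\<dots> = (\<Sum>i\<in>?F. b i * B i k)"
          by (rule sum.mono_neutral_right) (use B0[OF _ \<open>k \<in> S\<close>] in auto)
        finally show ?thesis .
      qed
      then show "\<exists>b. \<forall>k\<in>T. t k = (\<Sum>i\<in>?F. b i * B i k)" by blast
    qed
    define p :: "int poly" where "p = (\<Sum>T\<in>Pow S. [:0, 1:] ^ card T * [:-1, 1:] ^ card (S - T) *
        [:-1, 1:] ^ (card ?F - card T))"
    have "int (c q) = poly p (int q)" if q: "q \<ge> 2" for q
    proof -
      have "int (c q) = (\<Sum>T\<in>Pow S. int q ^ card T * (int q - 1) ^ card (S - T) * (int q - 1) ^ (card ?F - card T))"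
        unfolding c_def of_nat_sum
      proof (rule sum.cong[OF refl])
        fix T assume T: "T \<in> Pow S"
        have "card (sols (q - 1) ?F T B (\<lambda>_. 1)) = (q - 1) ^ (card ?F - card T)"
          by (rule card_sols_surj[OF _ fT[OF T] surjT[OF T]]) (use q in simp_all)
        moreover have "int (q - 1) = int q - 1" using q by simp
        ultimately show "int (q ^ card T * (q - 1) ^ card (S - T) * card (sols (q - 1) ?F T B (\<lambda>_. 1)))
            = int q ^ card T * (int q - 1) ^ card (S - T) * (int q - 1) ^ (card ?F - card T)"
          by (simp only: of_nat_mult of_nat_power)
      qed
      then show ?thesis by (simp add: p_def poly_sum)
    qed
    then show ?thesis by blast
  qed
  ultimately show ?thesis unfolding countable_by_def by (intro exI[of _ "\<lambda>q. int (c q)"]) simp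
qed

lemma countable_by_seeds:
  assumes v: "valid N S s" and s': "s' \<in> seeds N S s" and f: "countable_by N S s' f"
  shows "countable_by N S s f"
  using f row_surj_seeds[OF v s'] unfolding countable_by_def calg_seeds[OF v s'] by blast

lemma countable_by_separating:
  fixes x :: "nat \<Rightarrow> 'f::field_char_0"
  assumes v: "valid N S (x, B)" and sep: "separating_edge (quiver_edges S B) i j"
    and L: "louise N (S - {i}) (x, B)" "louise N (S - {j}) (x, B)" "louise N (S - {i, j}) (x, B)"
    and f: "countable_by N (S - {i}) (x, B) f1" "countable_by N (S - {j}) (x, B) f2"
      "countable_by N (S - {i, j}) (x, B) f3"
  shows "countable_by N S (x, B) (\<lambda>q. f1 q + f2 q - f3 q)"
  unfolding countable_by_def
proof (intro conjI allI impI)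
  have eq: "calg N T (x, B) = ubound N T (x, B)" if "louise N T (x, B)" "T \<subseteq> S" for T
    by (rule louise_calg_eq_ubound[OF that(1) valid_subset[OF v that(2)]])
  have eqs: "calg N (S - {i}) (x, B) = ubound N (S - {i}) (x, B)"
    "calg N (S - {j}) (x, B) = ubound N (S - {j}) (x, B)"
    "calg N (S - {i, j}) (x, B) = ubound N (S - {i, j}) (x, B)"
    by (rule eq[OF L(1)], blast, rule eq[OF L(2)], blast, rule eq[OF L(3)], blast)
  fix q and K :: "nat ring" assume K: "is_finite_field q K"
  have KF: "Ring.field K" using K by (simp add: is_finite_field_def)
  have fin: "finite (ring_points (calg N (S - {i}) (x, B)) K)" "finite (ring_points (calg N (S - {j}) (x, B)) K)"
    and card: "int (card (ring_points (calg N (S - {i}) (x, B)) K)) = f1 q"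
      "int (card (ring_points (calg N (S - {j}) (x, B)) K)) = f2 q"
      "int (card (ring_points (calg N (S - {i, j}) (x, B)) K)) = f3 q"
    using f K unfolding countable_by_def by blast+
  note sp = separating_points[OF KF v sep eqs fin]
  show "finite (ring_points (calg N S (x, B)) K)" by (rule sp(1))
  show "int (card (ring_points (calg N S (x, B)) K)) = f1 q + f2 q - f3 q"
    using sp(2) card by linarith
next
  have "lam (\<lambda>q. of_int (f1 q))" "lam (\<lambda>q. of_int (f2 q))" "lam (\<lambda>q. of_int (f3 q))"
    using f unfolding countable_by_def by blast+
  then have "lam (\<lambda>q. of_int (f1 q) + of_int (f2 q) - of_int (f3 q))" by (intro lam_diff lam_add)
  then show "lam (\<lambda>q. of_int (f1 q + f2 q - f3 q))" by simp
next
  assume surj: "row_surj {..<N} S (snd (x, B))"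
  have "row_surj {..<N} T (snd (x, B))" if "T \<subseteq> S" for T by (rule row_surj_subset[OF surj that])
  then have "row_surj {..<N} (S - {i}) (snd (x, B))" "row_surj {..<N} (S - {j}) (snd (x, B))"
    "row_surj {..<N} (S - {i, j}) (snd (x, B))" by blast+
  with f obtain p1 p2 p3 :: "int poly" where
    "\<forall>q\<ge>2. f1 q = poly p1 (int q)" "\<forall>q\<ge>2. f2 q = poly p2 (int q)" "\<forall>q\<ge>2. f3 q = poly p3 (int q)"
    unfolding countable_by_def by blast
  then have "\<forall>q\<ge>2. f1 q + f2 q - f3 q = poly (p1 + p2 - p3) (int q)" by simp
  then show "\<exists>p. \<forall>q\<ge>2. f1 q + f2 q - f3 q = poly p (int q)" by blast
qed

theorem louise_countable_by:
  fixes s :: "'f::field_char_0 seed"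
  assumes "louise N S s" "valid N S s"
  shows "\<exists>f. countable_by N S s f"
  using assms
proof (induction rule: louise.induct)
  case (no_edges x B S s)
  have v: "valid N S (x, B)" by (rule seeds_valid[OF no_edges.prems no_edges.hyps(1)])
  from countable_by_no_edges[OF v no_edges.hyps(2)] show ?case
    using countable_by_seeds[OF no_edges.prems no_edges.hyps(1)] by blast
next
  case (separating x B S s i j)
  have v: "valid N S (x, B)" by (rule seeds_valid[OF separating.prems separating.hyps(1)])
  obtain f1 where f1: "countable_by N (S - {i}) (x, B) f1"
    using separating.IH(1)[OF valid_subset[OF v]] by blast
  obtain f2 where f2: "countable_by N (S - {j}) (x, B) f2"
    using separating.IH(2)[OF valid_subset[OF v]] by blast
  obtain f3 where f3: "countable_by N (S - {i, j}) (x, B) f3"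
    using separating.IH(3)[OF valid_subset[OF v]] by blast
  have "countable_by N S (x, B) (\<lambda>q. f1 q + f2 q - f3 q)"
    by (rule countable_by_separating[OF v separating.hyps(2-5) f1 f2 f3])
  then show ?case using countable_by_seeds[OF separating.prems separating.hyps(1)] by blast
qed

subsection \<open>Seeds and their ranks\<close>

text \<open>Rank \<open>n\<close> forces the \<open>n\<close> columns to be pairwise distinct; only
  then does linear independence of the set of columns exclude relations among them as a
  family.\<close>

lemma full_rank_colindep:
  assumes "full_rank n m B"
  shows "colindep (n + m) {..<n} B"
proof -
  define A where "A = mat (n + m) n (\<lambda>(i, j). rat_of_int (B i j))"
  have A: "A \<in> carrier_mat (n + m) n" by (simp add: A_def)
  interpret vec_space "TYPE(rat)" "n + m" .
  have rank: "rank A = n" using assms by (simp add: full_rank_def A_def)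
  obtain T where T: "maximal T (\<lambda>T. T \<subseteq> set (cols A) \<and> lin_indpt T)"
    using maximal_exists[of "(\<lambda>T. T \<subseteq> set (cols A) \<and> lin_indpt T)" "card (set (cols A))" "{}"]
    by (meson List.finite_set card_mono empty_iff empty_subsetI finite_lin_indpt2 rev_finite_subset)
  have "card T \<le> card (set (cols A))" using T by (simp add: card_mono maximal_def)
  then have "n \<le> card (set (cols A))" using rank_card_indpt[OF A T] rank by simp
  moreover have "card (set (cols A)) \<le> length (cols A)" by (rule card_length)
  ultimately have dist: "distinct (cols A)" using A by (intro card_distinct) simp
  have ind: "lin_indpt (set (cols A))" by (rule full_rank_lin_indpt[OF A rank dist])
  show ?thesis
    unfolding colindep_def
  proof (intro allI impI)
    fix c assume c: "\<forall>i<n + m. (\<Sum>j<n. B i j * c j) = 0"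
    define u where "u = vec n (\<lambda>j. rat_of_int (c j))"
    have "A *\<^sub>v u = 0\<^sub>v (n + m)"
    proof (rule eq_vecI)
      fix i assume "i < dim_vec (0\<^sub>v (n + m) :: rat vec)"
      then have i: "i < n + m" by simp
      have "(A *\<^sub>v u) $ i = (\<Sum>j = 0..<n. rat_of_int (B i j) * rat_of_int (c j))"
        using i by (simp add: A_def u_def scalar_prod_def)
      also have "\<dots> = rat_of_int (\<Sum>j<n. B i j * c j)" by (simp add: atLeast0LessThan)
      also have "\<dots> = 0" using c i by simp
      finally show "(A *\<^sub>v u) $ i = 0\<^sub>v (n + m) $ i" using i by simp
    qed (use A in simp)
    then have "u = 0\<^sub>v n" using lin_depI[OF A _ _ _ dist, of u] ind by (auto simp: u_def)
    then have "u $ j = 0" if "j < n" for j using that by simp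
    then show "\<forall>j\<in>{..<n}. c j = 0" by (simp add: u_def)
  qed
qed

lemma really_full_rank_row_surj:
  assumes "really_full_rank n m B"
  shows "row_surj {..<n + m} {..<n} B"
  unfolding row_surj_def
proof
  fix v :: "nat \<Rightarrow> int"
  obtain c where "\<forall>j<n. v j = (\<Sum>i<n + m. c i * B i j)"
    using assms[unfolded really_full_rank_def, rule_format, of v] by blast
  then show "\<exists>c. \<forall>j\<in>{..<n}. v j = (\<Sum>i<n + m. c i * B i j)" by (intro exI[of _ c]) simp
qed

section \<open>From algebraic independence over the ground field to independent clusters\<close>

context
  fixes k :: "'f::field set" and N :: nat and x :: "nat \<Rightarrow> 'f"
  assumes k: "subfield k (ring_of_type_algebra :: 'f ring)" and x: "algebraically_independent k N x"
begin

private definition xpow :: "(nat \<Rightarrow>\<^sub>0 nat) \<Rightarrow> 'f" where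
  "xpow e = (\<Prod>i<N. x i ^ Poly_Mapping.lookup e i)"

private definition exps :: "nat set \<Rightarrow> (nat \<Rightarrow>\<^sub>0 nat) set" where
  "exps I = {e. Poly_Mapping.keys e \<subseteq> I}"

private lemma sring_k: "sring k"
proof -
  note s = subringE[OF subfieldE(1)[OF k]]
  show ?thesis
    unfolding sring_def
  proof (intro conjI ballI)
    show "1 \<in> k" using s(3) by (simp add: ring_of_type_algebra_def)
    fix a b assume ab: "a \<in> k" "b \<in> k"
    from s(6)[OF ab] show "a * b \<in> k" by (simp add: ring_of_type_algebra_def)
    from s(7)[OF ab(1) s(5)[OF ab(2)]] show "a - b \<in> k"
      unfolding a_minus_type_algebra by (simp add: ring_of_type_algebra_def)
  qed
qed

private lemma xpow_zero: "xpow 0 = 1"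
  by (simp add: xpow_def)

private lemma xpow_add: "xpow (e + e') = xpow e * xpow e'"
  by (simp add: xpow_def lookup_add power_add prod.distrib)

private lemma xpow_single: "i < N \<Longrightarrow> xpow (Poly_Mapping.single i n) = x i ^ n"
proof -
  assume i: "i < N"
  have "xpow (Poly_Mapping.single i n) = (\<Prod>j<N. if j = i then x i ^ n else 1)"
    unfolding xpow_def by (rule prod.cong) (auto simp: lookup_single when_def)
  with i show ?thesis by simp
qed

private lemma xpow_keys: "Poly_Mapping.keys e \<subseteq> {..<N} \<Longrightarrow> xpow e = (\<Prod>i\<in>Poly_Mapping.keys e. x i ^ Poly_Mapping.lookup e i)"
  unfolding xpow_def by (rule prod.mono_neutral_right) (auto simp: in_keys_iff)

private lemma xpow_indep:
  assumes E: "finite E" "E \<subseteq> exps {..<N}" and c: "\<And>e. e \<in> E \<Longrightarrow> c e \<in> k"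
    and sum: "(\<Sum>e\<in>E. c e * xpow e) = 0" and e: "e \<in> E"
  shows "c e = 0"
proof -
  define p where "p = Abs_poly_mapping (\<lambda>e. if e \<in> E then c e else 0)"
  have p_lookup: "Poly_Mapping.lookup p e = (if e \<in> E then c e else 0)" for e
    unfolding p_def by (subst Abs_poly_mapping_inverse) (use E(1) in auto)
  have p_keys: "Poly_Mapping.keys p \<subseteq> E" by (auto simp: in_keys_iff p_lookup split: if_splits)
  have "mpoly_eval x p = (\<Sum>e\<in>Poly_Mapping.keys p. c e * xpow e)"
    unfolding mpoly_eval_def
    by (rule sum.cong) (use p_keys E(2) in \<open>auto simp: p_lookup xpow_keys exps_def\<close>)
  also have "\<dots> = (\<Sum>e\<in>E. c e * xpow e)"
    by (rule sum.mono_neutral_left) (use E(1) p_keys in \<open>auto simp: in_keys_iff p_lookup\<close>)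
  finally have "mpoly_eval x p = 0" using sum by simp
  moreover have "range (Poly_Mapping.lookup p) \<subseteq> k" using c sring_zero[OF sring_k] by (auto simp: p_lookup)
  moreover have "\<forall>e\<in>Poly_Mapping.keys p. Poly_Mapping.keys e \<subseteq> {..<N}" using p_keys E(2) by (auto simp: exps_def)
  ultimately have "p = 0" using x unfolding algebraically_independent_def by blast
  with p_lookup[of e] e show ?thesis by simp
qed

private definition polys :: "nat set \<Rightarrow> 'f set" where
  "polys I = {\<Sum>e\<in>E. c e * xpow e | E c. finite E \<and> E \<subseteq> exps I \<and> (\<forall>e. c e \<in> k)}"

private lemma polysI: "finite E \<Longrightarrow> E \<subseteq> exps I \<Longrightarrow> \<forall>e. c e \<in> k \<Longrightarrow> (\<Sum>e\<in>E. c e * xpow e) \<in> polys I"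
  unfolding polys_def by blast

private lemma polys_term: "e \<in> exps I \<Longrightarrow> c \<in> k \<Longrightarrow> c * xpow e \<in> polys I"
  using polysI[of "{e}" I "\<lambda>_. c"] by simp

private lemma sring_polys: "sring (polys I)"
  unfolding sring_def
proof (intro conjI ballI)
  show "1 \<in> polys I"
    using polys_term[of 0 I 1] sring_one[OF sring_k] by (simp add: exps_def xpow_zero)
  have add: "f + g \<in> polys I" if "f \<in> polys I" "g \<in> polys I" for f g
  proof -
    from that(1) obtain E c where E: "finite E" "E \<subseteq> exps I" "\<forall>e. c e \<in> k" "f = (\<Sum>e\<in>E. c e * xpow e)"
      unfolding polys_def by auto
    from that(2) obtain E' c' where E': "finite E'" "E' \<subseteq> exps I" "\<forall>e. c' e \<in> k" "g = (\<Sum>e\<in>E'. c' e * xpow e)"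
      unfolding polys_def by auto
    have f: "f = (\<Sum>e\<in>E \<union> E'. (if e \<in> E then c e else 0) * xpow e)"
      unfolding E(4) by (rule sum.mono_neutral_cong_left) (use E E' in auto)
    have g: "g = (\<Sum>e\<in>E \<union> E'. (if e \<in> E' then c' e else 0) * xpow e)"
      unfolding E'(4) by (rule sum.mono_neutral_cong_left) (use E E' in auto)
    have "f + g = (\<Sum>e\<in>E \<union> E'. ((if e \<in> E then c e else 0) + (if e \<in> E' then c' e else 0)) * xpow e)"
      unfolding f g by (simp only: distrib_right sum.distrib)
    also have "\<dots> \<in> polys I"
    proof (rule polysI)
      have "(if e \<in> E then c e else 0) \<in> k" "(if e \<in> E' then c' e else 0) \<in> k" for e
        using E(3) E'(3) sring_zero[OF sring_k] by simp_all
      then show "\<forall>e. (if e \<in> E then c e else 0) + (if e \<in> E' then c' e else 0) \<in> k"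
        by (intro allI sring_add[OF sring_k])
    qed (use E E' in auto)
    finally show ?thesis .
  qed
  have sum: "sum f A \<in> polys I" if "\<And>a. a \<in> A \<Longrightarrow> f a \<in> polys I" for f :: "(nat \<Rightarrow>\<^sub>0 nat) \<Rightarrow> 'f" and A
    using that
  proof (induction A rule: infinite_finite_induct)
    case (insert a A)
    then show ?case using add by simp
  qed (use polysI[of "{}" I "\<lambda>_. 0"] sring_zero[OF sring_k] in simp_all)
  fix f g assume f: "f \<in> polys I" and g: "g \<in> polys I"
  from f obtain E c where E: "finite E" "E \<subseteq> exps I" "\<forall>e. c e \<in> k" "f = (\<Sum>e\<in>E. c e * xpow e)"
    unfolding polys_def by auto
  from g obtain E' c' where E': "finite E'" "E' \<subseteq> exps I" "\<forall>e. c' e \<in> k" "g = (\<Sum>e\<in>E'. c' e * xpow e)"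
    unfolding polys_def by auto
  have "(\<Sum>e\<in>E'. - c' e * xpow e) \<in> polys I"
    by (rule polysI) (use E' sring_uminus[OF sring_k] in auto)
  from add[OF f this] show "f - g \<in> polys I" by (simp add: E'(4) sum_negf)
  have "f * g = (\<Sum>e\<in>E. \<Sum>e'\<in>E'. (c e * c' e') * xpow (e + e'))"
    unfolding E(4) E'(4) sum_product by (simp add: xpow_add mult_ac)
  also have "\<dots> \<in> polys I"
  proof (intro sum polys_term)
    fix e e' assume "e \<in> E" "e' \<in> E'"
    then have "Poly_Mapping.keys e \<subseteq> I" "Poly_Mapping.keys e' \<subseteq> I" using E(2) E'(2) by (auto simp: exps_def)
    then show "e + e' \<in> exps I" using keys_add[of e e'] unfolding exps_def by blast
    show "c e * c' e' \<in> k" by (intro sring_mult[OF sring_k]) (use E(3) E'(3) in auto)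
  qed
  finally show "f * g \<in> polys I" .
qed

private lemma x_in_polys: "i \<in> I \<Longrightarrow> i < N \<Longrightarrow> x i \<in> polys I"
  using polys_term[of "Poly_Mapping.single i 1" I 1] sring_one[OF sring_k] xpow_single[of i 1]
  by (simp add: exps_def)

text \<open>Monomials in the other variables times distinct powers of \<open>x j\<close> are
  distinct monomials, so \<open>xpow_indep\<close> applies to the combined sum. The function
  \<open>h\<close> allows for a shift that makes integer exponents natural.\<close>

private lemma polys_transc:
  assumes j: "j < N" "j \<notin> I" and I: "I \<subseteq> {..<N}" and F: "finite F" and a: "\<And>r. r \<in> F \<Longrightarrow> a r \<in> polys I"
    and h: "inj_on h F" and sum: "(\<Sum>r\<in>F. a r * x j ^ h r) = 0" and r: "r \<in> F"
  shows "a r = (0 :: 'f)"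
proof -
  have "\<forall>r\<in>F. \<exists>Ec. finite (fst Ec) \<and> fst Ec \<subseteq> exps I \<and> (\<forall>e. snd Ec e \<in> k) \<and>
      a r = (\<Sum>e\<in>fst Ec. snd Ec e * xpow e)"
    using a unfolding polys_def by force
  from bchoice[OF this] obtain Ec where Ec: "\<forall>r\<in>F. finite (fst (Ec r)) \<and> fst (Ec r) \<subseteq> exps I \<and>
      (\<forall>e. snd (Ec r) e \<in> k) \<and> a r = (\<Sum>e\<in>fst (Ec r). snd (Ec r) e * xpow e)" by blast
  define P where "P = (SIGMA r:F. fst (Ec r))"
  define \<iota> where "\<iota> = (\<lambda>(r, e). e + Poly_Mapping.single j (h r))"
  have P: "finite P" unfolding P_def using F Ec by (intro finite_SigmaI) auto
  have lookup_j: "Poly_Mapping.lookup (\<iota> (r, e)) j = h r" if "(r, e) \<in> P" for r e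
  proof -
    have "j \<notin> Poly_Mapping.keys e" using that Ec j by (auto simp: P_def exps_def)
    then show ?thesis by (simp add: \<iota>_def lookup_add in_keys_iff)
  qed
  have inj: "inj_on \<iota> P"
  proof (rule inj_onI)
    fix p p' assume p: "p \<in> P" "p' \<in> P" and eq: "\<iota> p = \<iota> p'"
    obtain r e r' e' where re: "p = (r, e)" "p' = (r', e')" by (cases p, cases p') auto
    have "h r = h r'" using lookup_j p eq unfolding re by metis
    then have "r = r'" using h p by (auto simp: re P_def dest: inj_onD)
    with eq show "p = p'" by (simp add: re \<iota>_def)
  qed
  define c where "c u = (case inv_into P \<iota> u of (r, e) \<Rightarrow> snd (Ec r) e)" for u
  have c: "c (\<iota> (r, e)) = snd (Ec r) e" if "(r, e) \<in> P" for r e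
    unfolding c_def inv_into_f_f[OF inj that] by simp
  have "0 = (\<Sum>r\<in>F. \<Sum>e\<in>fst (Ec r). snd (Ec r) e * xpow e * x j ^ h r)"
    unfolding sum[symmetric] by (rule sum.cong) (use Ec in \<open>auto simp: sum_distrib_right\<close>)
  also have "\<dots> = (\<Sum>(r, e)\<in>P. snd (Ec r) e * xpow e * x j ^ h r)"
    unfolding P_def by (rule sum.Sigma) (use F Ec in auto)
  also have "\<dots> = (\<Sum>p\<in>P. c (\<iota> p) * xpow (\<iota> p))"
    by (rule sum.cong) (auto simp: c \<iota>_def[unfolded split_def] xpow_add xpow_single[OF j(1)] split_def
      c[unfolded \<iota>_def split_def, simplified])
  also have "\<dots> = (\<Sum>u\<in>\<iota> ` P. c u * xpow u)" by (simp add: sum.reindex[OF inj])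
  finally have eq0: "(\<Sum>u\<in>\<iota> ` P. c u * xpow u) = 0" by simp
  have sub: "\<iota> ` P \<subseteq> exps {..<N}"
  proof
    fix u assume "u \<in> \<iota> ` P"
    then obtain r e where re: "(r, e) \<in> P" "u = e + Poly_Mapping.single j (h r)" by (auto simp: \<iota>_def)
    have "Poly_Mapping.keys e \<subseteq> I" using re(1) Ec by (auto simp: P_def exps_def)
    moreover have "Poly_Mapping.keys u \<subseteq> Poly_Mapping.keys e \<union> {j}" unfolding re(2) using keys_add[of e "Poly_Mapping.single j (h r)"]
      by (auto split: if_splits)
    ultimately show "u \<in> exps {..<N}" using I j by (auto simp: exps_def)
  qed
  have ck: "c u \<in> k" if "u \<in> \<iota> ` P" for u using that c Ec by (auto simp: P_def)
  have "snd (Ec r) e = 0" if e: "e \<in> fst (Ec r)" for e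
  proof -
    have p: "(r, e) \<in> P" using r e by (simp add: P_def)
    have "c (\<iota> (r, e)) = 0" by (rule xpow_indep[OF finite_imageI[OF P] sub ck eq0]) (use p in auto)
    then show ?thesis using c[OF p] by simp
  qed
  with Ec r show ?thesis by simp
qed

lemma algebraically_independent_indep: "indep {..<N} x"
  unfolding indep_def transc_def
proof (intro ballI allI impI)
  fix j F c r
  assume j: "j \<in> {..<N}" and F: "finite F" and c: "\<forall>r\<in>F. c r \<in> laur ({..<N} - {j}) x"
    and sum: "(\<Sum>r\<in>F. c r * x j powi r) = 0" and r: "r \<in> F"
  let ?I = "{..<N} - {j}"
  \<comment> \<open>Powers of the product \<open>D\<close> of the other variables clear the
    denominators of the coefficients; the shift \<open>m\<close> below does the same for
    \<open>x j\<close>.\<close>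
  define D where "D = (\<Prod>i\<in>?I. x i)"
  have x0: "x i \<noteq> 0" if i: "i < N" for i
  proof
    assume "x i = 0"
    then have "(\<Sum>e\<in>{Poly_Mapping.single i 1}. 1 * xpow e) = 0" using xpow_single[OF i, of 1] by simp
    from xpow_indep[OF _ _ _ this, of "Poly_Mapping.single i 1"] i sring_one[OF sring_k]
    show False by (simp add: exps_def)
  qed
  have D0: "D \<noteq> 0" using x0 by (simp add: D_def)
  have D_mem: "D \<in> polys ?I" unfolding D_def by (rule sring_prod[OF sring_polys]) (auto intro: x_in_polys)
  have "laur ?I x \<subseteq> loc (polys ?I) D"
  proof (rule laur_least[OF sring_loc[OF sring_polys D_mem]])
    fix i assume i: "i \<in> ?I"
    show "x i \<in> loc (polys ?I) D" using x_in_polys[OF i] i subset_loc[of "polys ?I" D] by auto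
    have "D = x i * (\<Prod>l\<in>?I - {i}. x l)" unfolding D_def using i by (simp add: prod.remove)
    then have "D ^ 1 * inverse (x i) = (\<Prod>l\<in>?I - {i}. x l)" using x0[of i] i by simp
    also have "\<dots> \<in> polys ?I" by (rule sring_prod[OF sring_polys]) (auto intro: x_in_polys)
    finally show "inverse (x i) \<in> loc (polys ?I) D" by (rule locI)
  qed
  then have "\<forall>r\<in>F. \<exists>n. D ^ n * c r \<in> polys ?I" using c by (auto simp: loc_def)
  from bchoice[OF this] obtain n where n: "\<forall>r\<in>F. D ^ n r * c r \<in> polys ?I" by blast
  define M where "M = (\<Sum>r\<in>F. n r)"
  have DM: "D ^ M * c r \<in> polys ?I" if "r \<in> F" for r
  proof -
    have "n r \<le> M" unfolding M_def by (rule member_le_sum) (use that F in auto)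
    then have "D ^ M * c r = D ^ (M - n r) * (D ^ n r * c r)"
      by (simp add: mult.assoc[symmetric] power_add[symmetric])
    also have "\<dots> \<in> polys ?I"
      by (rule sring_mult[OF sring_polys sring_power[OF sring_polys D_mem] bspec[OF n that]])
    finally show ?thesis .
  qed
  define m where "m = (\<Sum>r\<in>F. \<bar>r\<bar>)"
  have m: "r + m \<ge> 0" if "r \<in> F" for r
  proof -
    have "\<bar>r\<bar> \<le> m" unfolding m_def by (rule member_le_sum) (use that F in auto)
    then show ?thesis by linarith
  qed
  have xj: "x j \<noteq> 0" using x0 j by simp
  have "(\<Sum>r\<in>F. (D ^ M * c r) * x j ^ nat (r + m)) = D ^ M * x j powi m * (\<Sum>r\<in>F. c r * x j powi r)"
    unfolding sum_distrib_left
  proof (rule sum.cong[OF refl])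
    fix r assume "r \<in> F"
    then have "x j ^ nat (r + m) = x j powi (r + m)" using m by (simp add: power_int_def)
    also have "\<dots> = x j powi r * x j powi m" using xj by (simp add: power_int_add)
    finally show "D ^ M * c r * x j ^ nat (r + m) = D ^ M * x j powi m * (c r * x j powi r)"
      by (simp add: mult_ac)
  qed
  then have eq0: "(\<Sum>r\<in>F. (D ^ M * c r) * x j ^ nat (r + m)) = 0" using sum by simp
  have "D ^ M * c r = 0"
  proof (rule polys_transc[OF _ _ _ F DM _ eq0 r])
    show "inj_on (\<lambda>r. nat (r + m)) F"
    proof (rule inj_onI)
      fix r r' assume "r \<in> F" "r' \<in> F" "nat (r + m) = nat (r' + m)"
      then show "r = r'" using m[of r] m[of r'] by (simp add: eq_nat_nat_iff)
    qed
  qed (use j in auto)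
  then show "c r = 0" using D0 by simp
qed

end

theorem theorem10p5:
  fixes n m :: nat and k :: "'f::field_char_0 set"
    and x :: "nat \<Rightarrow> 'f" and B :: exchange_matrix
  assumes "is_seed k (n + m) {..<n} (x, B)"
    and "louise (n + m) {..<n} (x, B)"
    and "full_rank n m B"
  shows "(\<exists>g\<in>Lambda_ring. \<exists>P::nat. \<forall>p a. Factorial_Ring.prime p \<and> p \<ge> P \<and> a \<ge> 1 \<longrightarrow>
            (\<forall>K. is_finite_field (p ^ a) K \<longrightarrow>
               finite (ring_points (cluster_algebra_Z (n + m) {..<n} (x, B)) K) \<and>
               of_nat (card (ring_points (cluster_algebra_Z (n + m) {..<n} (x, B)) K))
                 = g (p ^ a)))
       \<and> (really_full_rank n m B \<longrightarrow>
            (\<exists>f :: int poly. \<forall>q. primepow q \<longrightarrow>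
               (\<forall>K. is_finite_field q K \<longrightarrow>
                  finite (ring_points (cluster_algebra_Z (n + m) {..<n} (x, B)) K) \<and>
                  int (card (ring_points (cluster_algebra_Z (n + m) {..<n} (x, B)) K))
                    = poly f (int q))))"
proof -
  let ?A = "calg (n + m) {..<n} (x, B)"
  have seed: "ext_exchange_matrix (n + m) {..<n} B" "subfield k (ring_of_type_algebra :: 'f ring)"
    "algebraically_independent k (n + m) x"
    using assms(1) by (simp_all add: is_seed_def)
  have "valid (n + m) {..<n} (x, B)"
    using seed(1) algebraically_independent_indep[OF seed(2,3)] full_rank_colindep[OF assms(3)]
    by (simp add: valid_def)
  from louise_countable_by[OF assms(2) this] obtain f where f: "countable_by (n + m) {..<n} (x, B) f"
    by blast
  have card: "finite (ring_points ?A K)" "int (card (ring_points ?A K)) = f q"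
    if "is_finite_field q K" for q K
    using f that unfolding countable_by_def by blast+
  have "lam (\<lambda>q. of_int (f q))" using f unfolding countable_by_def by blast
  then obtain g P where g: "g \<in> Lambda_ring"
    "\<forall>p a. Factorial_Ring.prime p \<and> p \<ge> P \<and> a \<ge> 1 \<longrightarrow> of_int (f (p ^ a)) = g (p ^ a)" by (rule lamE)
  have "of_nat (card (ring_points ?A K)) = g (p ^ a)"
    if "Factorial_Ring.prime p \<and> p \<ge> P \<and> a \<ge> 1" "is_finite_field (p ^ a) K" for p a K
    using g(2) that(1) card(2)[OF that(2)] by (metis of_int_of_nat_eq)
  with g(1) card(1) have 1: "\<exists>g\<in>Lambda_ring. \<exists>P::nat. \<forall>p a. Factorial_Ring.prime p \<and> p \<ge> P \<and> a \<ge> 1 \<longrightarrow>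
      (\<forall>K. is_finite_field (p ^ a) K \<longrightarrow> finite (ring_points ?A K) \<and> of_nat (card (ring_points ?A K)) = g (p ^ a))"
    by blast
  have 2: "\<exists>f :: int poly. \<forall>q. primepow q \<longrightarrow> (\<forall>K. is_finite_field q K \<longrightarrow>
      finite (ring_points ?A K) \<and> int (card (ring_points ?A K)) = poly f (int q))"
    if rfr: "really_full_rank n m B"
  proof -
    obtain p :: "int poly" where p: "\<forall>q\<ge>2. f q = poly p (int q)"
      using f really_full_rank_row_surj[OF rfr] unfolding countable_by_def by auto
    have "q \<ge> 2" if "primepow q" for q :: nat using primepow_gt_Suc_0[OF that] by simp
    with p card show ?thesis by (intro exI[of _ p]) simp
  qed
  show ?thesis using 1 2 by blast
qed

end
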